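(* Let $\Lambda \subset \mathbb{R}$ be an exponentially small perturbation of the integers, i.e. $\Lambda=\{n+r_n\}_{n\in\mathbb{Z}}$, where the $r_n$ are real numbers satisfying $0<|r_n|\le \gamma^{|n|}$ for all $n\in\mathbb{Z}$ and some $0<\gamma<1$. Then there exists a pair of functions $f_1$ and $f_2$ in $H^1(\mathbb{R})$ such that $\mathrm{span}\{\tau_\lambda f_1,\tau_\nu f_2\}_{\lambda,\nu\in\Lambda}$ is dense in $H^1(\mathbb{R})$.
   Context: Functions are complex-valued. For $f \in L^1(\mathbb{R})$ the Fourier transform is $\hat f(\zeta)=\int_{\mathbb{R}} f(x)e^{ix\zeta}\,dx$. The Hilbert transform $Hf$ is the multiplier operator given by $\widehat{Hf}(\zeta)=-i\frac{\zeta}{|\zeta|}\hat f(\zeta)$. The real Hardy space is $H^1(\mathbb{R})=\{f\in L^1(\mathbb{R}) : Hf\in L^1(\mathbb{R})\}$ (that is, there is a function $Hf\in L^1(\mathbb{R})$ satisfying $\widehat{Hf}(\zeta)=-i\frac{\zeta}{|\zeta|}\hat f(\zeta)$ for $\zeta\neq 0$), with norm $\|f\|_{H^1}=\|f\|_{L^1}+\|Hf\|_{L^1}$. Translation: $\tau_\lambda f(\cdot)=f(\cdot-\lambda)$. Spans are complex linear spans. *)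

theory Defs
  imports "HOL-Analysis.Analysis" "HOL-Library.Function_Algebras"
begin

text \<open>
  Elements of \<open>L\<^sup>1(\<real>)\<close> are represented by functions integrable with respect to Lebesgue measure.
  No quotient by almost-everywhere equality is formed; all notions below that matter
  (Fourier transform, norms, membership, density) only depend on the equivalence class.
\<close>

definition L1 :: "(real \<Rightarrow> complex) set" where
  "L1 = {f. integrable lebesgue f}"

definition L1_norm :: "(real \<Rightarrow> complex) \<Rightarrow> real" where
  "L1_norm f = (LINT x|lebesgue. norm (f x))"

definition fourier :: "(real \<Rightarrow> complex) \<Rightarrow> real \<Rightarrow> complex" where
  "fourier f \<zeta> = (LINT x|lebesgue. f x * exp (\<i> * of_real x * of_real \<zeta>))"

definition is_Hilbert_transform :: "(real \<Rightarrow> complex) \<Rightarrow> (real \<Rightarrow> complex) \<Rightarrow> bool" where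
  "is_Hilbert_transform f g \<longleftrightarrow>
     g \<in> L1 \<and> (\<forall>\<zeta>. \<zeta> \<noteq> 0 \<longrightarrow> fourier g \<zeta> = - \<i> * of_real (\<zeta> / \<bar>\<zeta>\<bar>) * fourier f \<zeta>)"

definition H1 :: "(real \<Rightarrow> complex) set" where
  "H1 = {f \<in> L1. \<exists>g. is_Hilbert_transform f g}"

text \<open>
  For \<open>f \<in> H1\<close> the choice below is unique up to almost-everywhere equality, by injectivity of
  the Fourier transform on \<open>L\<^sup>1(\<real>)\<close>. It is unspecified for \<open>f \<notin> H1\<close>.
\<close>

definition Hilbert_transform :: "(real \<Rightarrow> complex) \<Rightarrow> real \<Rightarrow> complex" where
  "Hilbert_transform f = (SOME g. is_Hilbert_transform f g)"

definition H1_norm :: "(real \<Rightarrow> complex) \<Rightarrow> real" where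
  "H1_norm f = L1_norm f + L1_norm (Hilbert_transform f)"

definition translate :: "real \<Rightarrow> (real \<Rightarrow> complex) \<Rightarrow> real \<Rightarrow> complex" where
  "translate a f = (\<lambda>x. f (x - a))"

global_interpretation cfun: vector_space "\<lambda>(c::complex) (f::real \<Rightarrow> complex) x. c * f x"
  defines cspan = cfun.span
  by unfold_locales (auto simp: fun_eq_iff algebra_simps)

definition dense_in_H1 :: "(real \<Rightarrow> complex) set \<Rightarrow> bool" where
  "dense_in_H1 S \<longleftrightarrow>
     S \<subseteq> H1 \<and> (\<forall>g\<in>H1. \<forall>\<epsilon>>0. \<exists>h\<in>S. H1_norm (\<lambda>x. g x - h x) < \<epsilon>)"

end

theory Submission
  imports Defs
begin

text \<open>
  Up to real and imaginary parts, \<open>H\<^sup>1\<close> consists of the functions \<open>2 Re U\<close> with \<open>U \<in> L\<^sup>1\<close> and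
  \<open>fourier U = 0\<close> on \<open>\<zeta> > 0\<close>; then \<open>- 2 Im U\<close> is the Hilbert transform. So it suffices to approximate
  such \<open>U\<close> by \<^emph>\<open>real\<close> combinations of translates. Duality is avoided: everything is phrased by
  the \<open>L\<^sup>1\<close>-distance \<open>dst\<close> to the real span.

  Put \<open>W\<^sub>j x = 1 / (x + \<i>) ^ (j + 2)\<close> and let \<open>\<tau>\<close> be the translation by a large integer \<open>N\<close>. The generators
  are \<open>B(\<tau>) W\<^sub>0\<close> and \<open>B(-\<tau>) W\<^sub>0\<close>, where \<open>B\<close> has absolutely summable Taylor coefficients and is divisible by
  every power of \<open>1 - z\<close>. If the distances of \<open>B(\<tau>) W\<^sub>i\<close> and its integer translates vanish
  for \<open>i < j\<close>, Taylor expansion at \<open>n + r\<^sub>n\<close> shows that the \<open>n\<close>-th translate of \<open>B(\<tau>) W\<^sub>j\<close> has distance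
  \<open>O(\<gamma> ^ \<bar>n\<bar>)\<close>. Dividing by \<open>(1 - \<tau>) ^ 2\<close> keeps the translates bounded and gains a factor
  \<open>g / (1 - g)\<^sup>2\<close> with \<open>g = \<gamma> ^ N\<close>, while multiplying by \<open>(1 - \<tau>) ^ 2\<close> costs at most \<open>4\<close>; for large \<open>N\<close>
  the distance must be \<open>0\<close>. The ideals generated by \<open>B(z)\<close> and \<open>B(-z)\<close> contain \<open>1 - z\<close> and \<open>1 + z\<close> in their
  closures, so all \<open>W\<^sub>j\<close> have distance \<open>0\<close>. By Taylor expansion so do all their translates, hence all
  convolutions \<open>U * W\<^sub>j\<close>, hence, moving the pole along the imaginary axis, \<open>U * (P\<^sub>a - P\<^sub>b)\<close> for all Poisson
  kernels. Let \<open>a \<rightarrow> 0\<close> and \<open>b \<rightarrow> \<infinity>\<close>.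
\<close>

section \<open>Distance to a real subspace of \<open>L\<^sup>1\<close>\<close>

text \<open>Combinations must be real because the generators in \<open>H1\<close> are real parts
  \<open>2 * Re\<close>, and taking real parts commutes only with real scalars. A zero of infinite
  order of \<open>B\<close> is what the division argument needs: every division by
  \<open>(1 - \<tau>) ^ 2\<close> gains a fixed factor, but no finite number of divisions brings the
  distance to 0. The norms of the successive quotients may grow without control, since only their
  finiteness enters. The price is \<open>B(1) = 0\<close>: the Fourier transform of
  \<open>B(\<tau>) W\<^sub>0\<close> and of all its translates vanishes at the frequencies with
  exp(i N zeta) = 1, so this generator alone cannot suffice. The second one has its zeros where
  exp(i N zeta) = -1, and \<open>(1 - z) + (1 + z) = 2\<close> recovers everything. \<open>B\<close>
  is realized not by its Taylor coefficients but as a series of resolvents of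
  \<open>1 - \<tau>\<close> at the points \<open>- (1/4) ^ k\<close>, weighted by the coefficients
  of Euler's product; its divisibility by \<open>1 - z\<close> then becomes the vanishing of moments
  of these weights.\<close>

text \<open>
  Unlike in the definitions, the measure is \<open>lborel\<close>, as Fubini's theorem needs Borel representatives.
\<close>

definition nrm :: "(real \<Rightarrow> complex) \<Rightarrow> real" where
  "nrm F = (LINT x|lborel. norm (F x))"

lemma nrm_nonneg: "0 \<le> nrm F"
  by (simp add: nrm_def)

lemma nrm_zero [simp]: "nrm (\<lambda>x. 0) = 0"
  by (simp add: nrm_def)

lemma nrm_add_le:
  assumes "integrable lborel F" "integrable lborel G"
  shows "nrm (\<lambda>x. F x + G x) \<le> nrm F + nrm G"
proof -
  have "nrm (\<lambda>x. F x + G x) \<le> (LINT x|lborel. norm (F x) + norm (G x))"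
    unfolding nrm_def using assms by (intro integral_mono) (auto intro: norm_triangle_ineq)
  then show ?thesis
    using assms by (simp add: nrm_def)
qed

lemma nrm_scale: "nrm (\<lambda>x. c * F x) = norm c * nrm F"
  by (simp add: nrm_def norm_mult)

lemma nrm_diff_le:
  assumes "integrable lborel F" "integrable lborel G"
  shows "nrm (\<lambda>x. F x - G x) \<le> nrm F + nrm G"
proof -
  have "nrm (\<lambda>x. F x - G x) \<le> (LINT x|lborel. norm (F x) + norm (G x))"
    unfolding nrm_def using assms by (intro integral_mono) (auto intro: norm_triangle_ineq4)
  then show ?thesis
    using assms by (simp add: nrm_def)
qed

lemma integrable_translate [intro]:
  "integrable lborel F \<Longrightarrow> integrable lborel (translate a F)"
  using lborel_integrable_real_affine[of F 1 "-a"] by (simp add: translate_def)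

lemma integral_translate:
  "(LINT x|lborel. translate a F x) = (LINT x|lborel. (F x::complex))"
  using lborel_integral_real_affine[of 1 F "-a"] by (simp add: translate_def)

lemma nrm_translate: "nrm (translate a F) = nrm F"
  using lborel_integral_real_affine[of 1 "\<lambda>x. norm (F x)" "-a"]
  by (simp add: translate_def nrm_def)

lemma translate_translate: "translate a (translate b F) = translate (a + b) F"
  by (simp add: translate_def fun_eq_iff algebra_simps)

lemma translate_0 [simp]: "translate 0 F = F"
  by (simp add: translate_def)

locale real_subspace =
  fixes S :: "(real \<Rightarrow> complex) set"
  assumes zero: "(\<lambda>x. 0) \<in> S"
    and add: "\<And>f g. f \<in> S \<Longrightarrow> g \<in> S \<Longrightarrow> (\<lambda>x. f x + g x) \<in> S"
    and scale: "\<And>f c. f \<in> S \<Longrightarrow> (\<lambda>x. of_real c * f x) \<in> S"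
    and integrable: "\<And>f. f \<in> S \<Longrightarrow> integrable lborel f"
begin

text \<open>\<open>dst F = 0\<close> means that \<open>F\<close> lies in the L1-closure of
  \<open>S\<close>. This real seminorm takes the place of the functionals that vanish on
  \<open>S\<close>.\<close>

definition dst :: "(real \<Rightarrow> complex) \<Rightarrow> real" where
  "dst F = (INF s\<in>S. nrm (\<lambda>x. F x - s x))"

lemma bdd: "bdd_below ((\<lambda>s. nrm (\<lambda>x. F x - s x)) ` S)"
  by (rule bdd_belowI[of _ 0]) (auto simp: nrm_nonneg)

lemma dst_nonneg: "0 \<le> dst F"
  unfolding dst_def using zero by (intro cINF_greatest) (auto simp: nrm_nonneg)

lemma dst_le: "s \<in> S \<Longrightarrow> dst F \<le> nrm (\<lambda>x. F x - s x)"
  unfolding dst_def using bdd by (rule cINF_lower)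

lemma dst_le_nrm: "dst F \<le> nrm F"
  using dst_le[OF zero, of F] by simp

lemma dst_mem: "s \<in> S \<Longrightarrow> dst s = 0"
  using dst_le[of s s] dst_nonneg[of s] by simp

lemma dst_lessD: "dst F < e \<Longrightarrow> \<exists>s\<in>S. nrm (\<lambda>x. F x - s x) < e"
  unfolding dst_def using cINF_less_iff[of S "\<lambda>s. nrm (\<lambda>x. F x - s x)" e] bdd zero by auto

lemma dst_add_le:
  assumes [simp]: "integrable lborel F" "integrable lborel G"
  shows "dst (\<lambda>x. F x + G x) \<le> dst F + dst G"
proof (rule field_le_epsilon)
  fix e :: real assume "e > 0"
  then obtain s t where st: "s \<in> S" "nrm (\<lambda>x. F x - s x) < dst F + e/2"
      "t \<in> S" "nrm (\<lambda>x. G x - t x) < dst G + e/2"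
    using dst_lessD[of F "dst F + e/2"] dst_lessD[of G "dst G + e/2"] by auto
  have "dst (\<lambda>x. F x + G x) \<le> nrm (\<lambda>x. F x + G x - (s x + t x))"
    using st by (intro dst_le add)
  also have "\<dots> = nrm (\<lambda>x. (F x - s x) + (G x - t x))"
    by (simp add: algebra_simps)
  also have "\<dots> \<le> nrm (\<lambda>x. F x - s x) + nrm (\<lambda>x. G x - t x)"
    using st integrable by (intro nrm_add_le) auto
  finally show "dst (\<lambda>x. F x + G x) \<le> dst F + dst G + e"
    using st by simp
qed

lemma dst_scale_le: "dst (\<lambda>x. of_real c * F x) \<le> \<bar>c\<bar> * dst F"
proof (rule field_le_epsilon)
  fix e :: real assume "e > 0"
  then obtain s where s: "s \<in> S" "nrm (\<lambda>x. F x - s x) < dst F + e / (\<bar>c\<bar> + 1)"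
    using dst_lessD[of F "dst F + e / (\<bar>c\<bar> + 1)"] by auto
  have "dst (\<lambda>x. of_real c * F x) \<le> nrm (\<lambda>x. of_real c * F x - of_real c * s x)"
    using s by (intro dst_le scale)
  also have "\<dots> = nrm (\<lambda>x. of_real c * (F x - s x))"
    by (simp add: algebra_simps)
  also have "\<dots> = \<bar>c\<bar> * nrm (\<lambda>x. F x - s x)"
    by (simp add: nrm_scale)
  also have "\<dots> \<le> \<bar>c\<bar> * (dst F + e / (\<bar>c\<bar> + 1))"
    using s by (intro mult_left_mono) auto
  also have "\<dots> \<le> \<bar>c\<bar> * dst F + e"
    using \<open>e > 0\<close> by (simp add: field_simps)
  finally show "dst (\<lambda>x. of_real c * F x) \<le> \<bar>c\<bar> * dst F + e" .
qed

lemma dst_uminus: "dst (\<lambda>x. - F x) = dst F"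
  using dst_scale_le[of "-1" F] dst_scale_le[of "-1" "\<lambda>x. - F x"] by simp

lemma dst_diff_le:
  assumes "integrable lborel F" "integrable lborel G"
  shows "dst (\<lambda>x. F x - G x) \<le> dst F + dst G"
  using dst_add_le[of F "\<lambda>x. - G x"] assms by (simp add: dst_uminus)

lemma dst_triangle:
  assumes "integrable lborel F" "integrable lborel G"
  shows "dst F \<le> dst G + nrm (\<lambda>x. F x - G x)"
  using dst_add_le[of G "\<lambda>x. F x - G x"] dst_le_nrm[of "\<lambda>x. F x - G x"] assms by simp

lemma dst_sum_le:
  assumes "\<And>i. i \<in> I \<Longrightarrow> integrable lborel (F i)"
  shows "dst (\<lambda>x. \<Sum>i\<in>I. F i x) \<le> (\<Sum>i\<in>I. dst (F i))"
  using assms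
proof (induction I rule: infinite_finite_induct)
  case (insert i I)
  have "dst (\<lambda>x. F i x + (\<Sum>i\<in>I. F i x)) \<le> dst (F i) + dst (\<lambda>x. \<Sum>i\<in>I. F i x)"
    using insert by (intro dst_add_le) auto
  then show ?case using insert by fastforce
qed (auto simp: dst_mem[OF zero])

lemma dst_limit:
  assumes "integrable lborel F" "\<And>k::nat. integrable lborel (G k)" "\<And>k. dst (G k) = 0"
    and "(\<lambda>k. nrm (\<lambda>x. F x - G k x)) \<longlonglongrightarrow> 0"
  shows "dst F = 0"
proof -
  have "dst F \<le> 0"
    using assms dst_triangle[of F "G _"] by (intro LIMSEQ_le_const[OF assms(4)]) auto
  then show ?thesis using dst_nonneg[of F] by simp
qed

end

text \<open>One constant bounds both the supremum and the \<open>L\<^sup>1\<close>-norm, so that series converge pointwise and in \<open>L\<^sup>1\<close>.\<close>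

definition bd :: "(real \<Rightarrow> complex) \<Rightarrow> real \<Rightarrow> bool" where
  "bd F C \<longleftrightarrow> integrable lborel F \<and> (\<forall>x. norm (F x) \<le> C) \<and> nrm F \<le> C"

lemma bd_integrable: "bd F C \<Longrightarrow> integrable lborel F"
  and bd_norm: "bd F C \<Longrightarrow> norm (F x) \<le> C"
  and bd_nrm: "bd F C \<Longrightarrow> nrm F \<le> C"
  by (auto simp: bd_def)

lemma bd_nonneg: "bd F C \<Longrightarrow> 0 \<le> C"
  using bd_nrm nrm_nonneg order_trans by blast

lemma bd_mono: "bd F C \<Longrightarrow> C \<le> D \<Longrightarrow> bd F D"
  by (auto simp: bd_def intro: order_trans)

lemma bd_zero: "bd (\<lambda>x. 0) 0"
  by (simp add: bd_def)

lemma bd_add: "bd F C \<Longrightarrow> bd G D \<Longrightarrow> bd (\<lambda>x. F x + G x) (C + D)"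
  unfolding bd_def using nrm_add_le[of F G] by (auto intro: norm_triangle_mono)

lemma bd_scale:
  assumes "bd F C" shows "bd (\<lambda>x. c * F x) (norm c * C)"
  using assms unfolding bd_def by (auto simp: nrm_scale norm_mult mult_left_mono)

lemma bd_uminus: "bd F C \<Longrightarrow> bd (\<lambda>x. - F x) C"
  using bd_scale[of F C "-1"] by simp

lemma bd_diff: "bd F C \<Longrightarrow> bd G D \<Longrightarrow> bd (\<lambda>x. F x - G x) (C + D)"
  using bd_add[of F C "\<lambda>x. - G x" D] bd_uminus by simp

lemma bd_sum: "(\<And>i. i \<in> I \<Longrightarrow> bd (F i) (C i)) \<Longrightarrow> bd (\<lambda>x. \<Sum>i\<in>I. F i x) (\<Sum>i\<in>I. C i)"
  by (induction I rule: infinite_finite_induct) (auto simp: bd_zero bd_add)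

lemma bd_translate: "bd F C \<Longrightarrow> bd (translate a F) C"
  unfolding bd_def by (auto simp: nrm_translate) (simp add: translate_def)

lemma bd_dominated:
  assumes "F \<in> borel_measurable borel" "\<And>x. norm (F x) \<le> C * norm (G x)" "bd G D" "C \<ge> 0"
  shows "bd F (C * D)"
proof -
  have "integrable lborel (\<lambda>x. C * norm (G x))"
    using bd_integrable[OF assms(3)] by auto
  then have i: "integrable lborel F"
    by (rule Bochner_Integration.integrable_bound) (use assms in auto)
  have "nrm F \<le> (LINT x|lborel. C * norm (G x))"
    unfolding nrm_def using i bd_integrable[OF assms(3)] assms(2) by (intro integral_mono) auto
  also have "\<dots> = C * nrm G" by (simp add: nrm_def)
  also have "\<dots> \<le> C * D" using assms bd_nrm by (intro mult_left_mono) auto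
  finally have "nrm F \<le> C * D" .
  moreover have "norm (F x) \<le> C * D" for x
    using assms(2)[of x] mult_left_mono[OF bd_norm[OF assms(3), of x] \<open>C \<ge> 0\<close>] by simp
  ultimately show ?thesis
    using i by (simp add: bd_def)
qed

lemma bd_suminf:
  assumes b: "\<And>k::nat. bd (F k) (C k)" and s: "summable C"
  shows "bd (\<lambda>x. \<Sum>k. F k x) (\<Sum>k. C k)" "\<And>x. summable (\<lambda>k. F k x)"
proof -
  have sn: "summable (\<lambda>k. norm (F k x))" for x
    using s by (rule summable_comparison_test') (use bd_norm[OF b] in auto)
  then show sm: "summable (\<lambda>k. F k x)" for x
    by (rule summable_norm_cancel)
  have i: "integrable lborel (F k)" for k using b by (rule bd_integrable)
  have s2: "summable (\<lambda>k. LINT x|lborel. norm (F k x))"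
    using s by (rule summable_comparison_test') (use bd_nrm[OF b] in \<open>auto simp: nrm_def\<close>)
  have I: "integrable lborel (\<lambda>x. \<Sum>k. F k x)"
    using i sn s2 by (intro integrable_suminf) auto
  have I': "integrable lborel (\<lambda>x. \<Sum>k. norm (F k x))"
    using i sn s2 by (intro integrable_suminf) auto
  have "nrm (\<lambda>x. \<Sum>k. F k x) \<le> (LINT x|lborel. (\<Sum>k. norm (F k x)))"
    unfolding nrm_def using I I' sn by (intro integral_mono) (auto intro: summable_norm)
  also have "\<dots> = (\<Sum>k. LINT x|lborel. norm (F k x))"
    using i sn s2 by (intro integral_suminf) auto
  also have "\<dots> \<le> (\<Sum>k. C k)"
    using s2 s by (intro suminf_le) (auto intro!: bd_nrm[OF b, unfolded nrm_def])
  finally have n: "nrm (\<lambda>x. \<Sum>k. F k x) \<le> (\<Sum>k. C k)" .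
  have "norm (\<Sum>k. F k x) \<le> (\<Sum>k. C k)" for x
    using summable_norm[OF sn, of x] suminf_le[of "\<lambda>k. norm (F k x)" C] sn s bd_norm[OF b]
    by (metis order_trans)
  with I n show "bd (\<lambda>x. \<Sum>k. F k x) (\<Sum>k. C k)" by (simp add: bd_def)
qed

lemma bd_suminf_tail:
  assumes b: "\<And>k::nat. bd (F k) (C k)" and s: "summable C"
  shows "bd (\<lambda>x. (\<Sum>k. F k x) - (\<Sum>k<m. F k x)) (\<Sum>k. C (k + m))"
proof -
  have "(\<Sum>k. F k x) - (\<Sum>k<m. F k x) = (\<Sum>k. F (k + m) x)" for x
    using suminf_minus_initial_segment[OF bd_suminf(2)[OF b s], of m x] by simp
  moreover have "bd (\<lambda>x. \<Sum>k. F (k + m) x) (\<Sum>k. C (k + m))"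
    using b s by (intro bd_suminf) (auto simp: summable_iff_shift)
  ultimately show ?thesis by simp
qed

lemma (in real_subspace) dst_suminf:
  assumes b: "\<And>k::nat. bd (F k) (C k)" and s: "summable C" and z: "\<And>k. dst (F k) = 0"
  shows "dst (\<lambda>x. \<Sum>k. F k x) = 0"
proof (rule dst_limit)
  show "integrable lborel (\<lambda>x. \<Sum>k. F k x)"
    using bd_suminf(1)[OF b s] by (rule bd_integrable)
  show "integrable lborel (\<lambda>x. \<Sum>k<m. F k x)" for m
    using bd_integrable[OF b] by auto
  show "dst (\<lambda>x. \<Sum>k<m. F k x) = 0" for m
    using dst_sum_le[of "{..<m}" F] bd_integrable[OF b] z dst_nonneg[of "\<lambda>x. \<Sum>k<m. F k x"] by auto
  have "(\<lambda>m. \<Sum>k. C (k + m)) \<longlonglongrightarrow> 0"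
    using suminf_exist_split2[OF s] .
  then show "(\<lambda>m. nrm (\<lambda>x. (\<Sum>k. F k x) - (\<Sum>k<m. F k x))) \<longlonglongrightarrow> 0"
    by (rule tendsto_sandwich[OF _ _ tendsto_const, rotated 2])
      (auto simp: nrm_nonneg intro!: always_eventually bd_nrm bd_suminf_tail[OF b s])
qed

section \<open>Sequences divisible by all powers of the difference operator\<close>

context real_subspace
begin

text \<open>
  Modulo the subspace, \<open>y\<close> is Cauchy; as its sums \<open>e\<close> are bounded, averaging shows that its limit is \<open>0\<close>.
\<close>

lemma dst_tail:
  fixes y e :: "nat \<Rightarrow> real \<Rightarrow> complex"
  assumes int: "\<And>i. integrable lborel (e i)"
    and y: "\<And>i t. y i t = e (Suc i) t - e i t"
    and M: "\<And>i. dst (e i) \<le> M"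
    and g: "0 < g" "g < 1"
    and d: "\<And>i. dst (\<lambda>t. y i t - y (Suc i) t) \<le> C * g ^ i"
  shows "dst (y i) \<le> C / (1 - g) * g ^ i"
proof -
  have [simp]: "integrable lborel (y i)" for i
    using int[of i] int[of "Suc i"] by (subst y[abs_def]) simp
  have C: "0 \<le> C" using order_trans[OF dst_nonneg d[of 0]] by simp
  have part: "dst (\<lambda>t. y i t - y (i + j) t) \<le> C / (1 - g) * g ^ i" for i j
  proof -
    have "dst (\<lambda>t. y i t - y (i + j) t) \<le> C * g ^ i * (\<Sum>l<j. g ^ l)"
    proof (induction j)
      case 0 then show ?case by (simp add: dst_mem[OF zero])
    next
      case (Suc j)
      have "dst (\<lambda>t. (y i t - y (i + j) t) + (y (i + j) t - y (Suc (i + j)) t)) \<le>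
          dst (\<lambda>t. y i t - y (i + j) t) + dst (\<lambda>t. y (i + j) t - y (Suc (i + j)) t)"
        by (intro dst_add_le) auto
      also have "\<dots> \<le> C * g ^ i * (\<Sum>l<j. g ^ l) + C * g ^ (i + j)"
        using Suc d[of "i + j"] by simp
      finally show ?case by (simp add: algebra_simps power_add)
    qed
    also have "\<dots> \<le> C * g ^ i * (1 / (1 - g))"
    proof (intro mult_left_mono)
      have "(\<Sum>l<j. g ^ l) = (1 - g ^ j) / (1 - g)"
        using g by (simp add: sum_gp_strict)
      also have "\<dots> \<le> 1 / (1 - g)"
        using g by (intro divide_right_mono) auto
      finally show "(\<Sum>l<j. g ^ l) \<le> 1 / (1 - g)" .
    qed (use C g in simp)
    finally show ?thesis by simp
  qed
  have "dst (y i) \<le> C / (1 - g) * g ^ i + 2 * M * (1 / real (Suc J))" for J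
  proof -
    define K where "K = Suc J"
    have e: "(\<Sum>j<K. y (i + j) t) = e (i + K) t - e i t" for t
      by (induction K) (auto simp: y)
    \<comment> \<open>Averaging: \<open>y i\<close> is the mean of the differences
      \<open>y i - y (i + j)\<close>, which are small by \<open>part\<close>, plus the mean of the
      \<open>y (i + j)\<close>, which telescopes to \<open>(e (i + K) - e i) / K\<close> and
      disappears as \<open>K\<close> grows.\<close>
    have "y i = (\<lambda>t. of_real (1 / real K) *
        ((\<Sum>j<K. y i t - y (i + j) t) + (e (i + K) t - e i t)))"
    proof
      fix t show "y i t = of_real (1 / real K) *
        ((\<Sum>j<K. y i t - y (i + j) t) + (e (i + K) t - e i t))"
        unfolding e[symmetric] by (simp add: sum_subtractf K_def del: of_nat_Suc)
    qed
    then have "dst (y i) = dst (\<lambda>t. of_real (1 / real K) *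
        ((\<Sum>j<K. y i t - y (i + j) t) + (e (i + K) t - e i t)))"
      by (rule arg_cong)
    also have "\<dots> \<le> \<bar>1 / real K\<bar> *
        dst (\<lambda>t. (\<Sum>j<K. y i t - y (i + j) t) + (e (i + K) t - e i t))"
      by (rule dst_scale_le)
    also have "\<dots> = 1 / real K *
        dst (\<lambda>t. (\<Sum>j<K. y i t - y (i + j) t) + (e (i + K) t - e i t))"
      by simp
    also have "\<dots> \<le> 1 / real K * (dst (\<lambda>t. \<Sum>j<K. y i t - y (i + j) t) + dst (\<lambda>t. e (i + K) t - e i t))"
      using int by (intro mult_left_mono dst_add_le) auto
    also have "\<dots> \<le> 1 / real K * ((\<Sum>j<K. C / (1 - g) * g ^ i) + (M + M))"
    proof (intro mult_left_mono add_mono)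
      have "dst (\<lambda>t. \<Sum>j<K. y i t - y (i + j) t) \<le> (\<Sum>j<K. dst (\<lambda>t. y i t - y (i + j) t))"
        by (intro dst_sum_le) auto
      also have "\<dots> \<le> (\<Sum>j<K. C / (1 - g) * g ^ i)"
        by (intro sum_mono part)
      finally show "dst (\<lambda>t. \<Sum>j<K. y i t - y (i + j) t) \<le> (\<Sum>j<K. C / (1 - g) * g ^ i)" .
      show "dst (\<lambda>t. e (i + K) t - e i t) \<le> M + M"
        using dst_diff_le[of "e (i + K)" "e i"] int M[of "i + K"] M[of i] by simp
    qed auto
    finally show ?thesis
      by (simp add: K_def field_simps del: of_nat_Suc)
  qed
  moreover have "(\<lambda>J. C / (1 - g) * g ^ i + 2 * M * (1 / real (Suc J))) \<longlonglongrightarrow>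
      C / (1 - g) * g ^ i + 2 * M * 0"
    by (intro tendsto_intros LIMSEQ_Suc lim_1_over_n)
  ultimately show ?thesis
    by (intro LIMSEQ_le_const[where X = "\<lambda>J. C / (1 - g) * g ^ i + 2 * M * (1 / real (Suc J))"]) auto
qed

text \<open>\<open>dst_tail\<close> applied twice, forwards for \<open>j \<ge> 0\<close> and
  backwards for \<open>j < 0\<close>; each application costs \<open>1 / (1 - g)\<close>. As
  \<open>a\<close> is a second difference of \<open>x\<close>, \<open>a c\<close> is centred at
  \<open>x (c + 1)\<close>; with the centre moved there, both directions gain the same factor
  \<open>g\<close>. The sequence \<open>z\<close> serves only to give \<open>x\<close> bounded
  sums.\<close>

lemma dst_double_tail:
  fixes a y x z :: "int \<Rightarrow> real \<Rightarrow> complex"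
  assumes int: "\<And>n. integrable lborel (z n)"
    and a: "\<And>n t. a n t = y (n + 1) t - y n t"
    and y: "\<And>n t. y n t = x (n + 1) t - x n t"
    and x: "\<And>n t. x n t = z (n + 1) t - z n t"
    and Mx: "\<And>n. dst (x n) \<le> Mx" and Mz: "\<And>n. dst (z n) \<le> Mz"
    and g: "0 < g" "g < 1"
    and d: "\<And>j. dst (a (c + j)) \<le> C * g ^ nat \<bar>j\<bar>"
  shows "dst (x (c + 1 + j)) \<le> C * (g / (1 - g)\<^sup>2) * g ^ nat \<bar>j\<bar>"
proof -
  have intx: "integrable lborel (x n)" for n
    using int[of n] int[of "n+1"] by (subst x[abs_def]) simp
  have inty: "integrable lborel (y n)" for n
    using intx[of n] intx[of "n+1"] by (subst y[abs_def]) simp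
  show ?thesis
  proof (cases "j \<ge> 0")
    case True
    have 1: "dst (y (c + int i)) \<le> C / (1 - g) * g ^ i" for i
    proof (rule dst_tail[where e = "\<lambda>i. x (c + int i)" and M = Mx, OF _ _ Mx g])
      fix i
      have "(\<lambda>t. y (c + int i) t - y (c + int (Suc i)) t) = (\<lambda>t. - a (c + int i) t)"
        by (simp add: a fun_eq_iff algebra_simps)
      then show "dst (\<lambda>t. y (c + int i) t - y (c + int (Suc i)) t) \<le> C * g ^ i"
        using d[of "int i"] by (simp add: dst_uminus)
    qed (auto simp: intx y algebra_simps)
    have "dst (x (c + int i)) \<le> C / (1 - g) / (1 - g) * g ^ i" for i
    proof (rule dst_tail[where e = "\<lambda>i. z (c + int i)" and M = Mz, OF _ _ Mz g])
      fix i
      have "(\<lambda>t. x (c + int i) t - x (c + int (Suc i)) t) = (\<lambda>t. - y (c + int i) t)"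
        by (simp add: y fun_eq_iff algebra_simps)
      then show "dst (\<lambda>t. x (c + int i) t - x (c + int (Suc i)) t) \<le> C / (1 - g) * g ^ i"
        using 1[of i] by (simp add: dst_uminus)
    qed (auto simp: int x algebra_simps)
    from this[of "Suc (nat j)"] True show ?thesis
      by (simp add: algebra_simps power2_eq_square)
  next
    case False
    have 1: "dst (y (c + 1 - int i)) \<le> C / (1 - g) * g ^ i" for i
    proof (rule dst_tail[where e = "\<lambda>i t. - x (c + 2 - int i) t" and M = Mx, OF _ _ _ g])
      fix i
      have "(\<lambda>t. y (c + 1 - int i) t - y (c + 1 - int (Suc i)) t) = a (c - int i)"
        by (simp add: a fun_eq_iff algebra_simps)
      then show "dst (\<lambda>t. y (c + 1 - int i) t - y (c + 1 - int (Suc i)) t) \<le> C * g ^ i"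
        using d[of "- int i"] by simp
    qed (auto simp: intx y algebra_simps Mx dst_uminus)
    have "dst (x (c + 2 - int i)) \<le> C / (1 - g) / (1 - g) * g ^ i" for i
    proof (rule dst_tail[where e = "\<lambda>i t. - z (c + 3 - int i) t" and M = Mz, OF _ _ _ g])
      fix i
      have "(\<lambda>t. x (c + 2 - int i) t - x (c + 2 - int (Suc i)) t) = y (c + 1 - int i)"
        by (simp add: y fun_eq_iff algebra_simps)
      then show "dst (\<lambda>t. x (c + 2 - int i) t - x (c + 2 - int (Suc i)) t) \<le> C / (1 - g) * g ^ i"
        using 1[of i] by simp
    qed (auto simp: int x algebra_simps Mz dst_uminus)
    from this[of "Suc (nat (-j))"] False show ?thesis
      by (simp add: algebra_simps power2_eq_square)
  qed
qed

text \<open>Climbing two levels at a time improves the constant by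
  \<open>r = g / (1 - g)\<^sup>2\<close> and moves the centre by one, so level \<open>2 * k\<close>
  is bounded by \<open>C * r ^ k\<close>. Coming back down costs a factor 2 per level, and
  \<open>4 * r < 1\<close>. The bounds \<open>M k\<close> may grow arbitrarily fast because
  \<open>dst_tail\<close> does not carry them into its conclusion.\<close>

lemma dst_infinite_difference:
  fixes x :: "nat \<Rightarrow> int \<Rightarrow> real \<Rightarrow> complex"
  assumes int: "\<And>k n. integrable lborel (x k n)"
    and x: "\<And>k n t. x k n t = x (Suc k) (n + 1) t - x (Suc k) n t"
    and M: "\<And>k n. dst (x k n) \<le> M k"
    and g: "0 < g" "g < 1" "4 * g < (1 - g)\<^sup>2"
    and d: "\<And>j. dst (x 0 j) \<le> C * g ^ nat \<bar>j\<bar>"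
  shows "dst (x 0 n) = 0"
proof -
  define r where "r = g / (1 - g)\<^sup>2"
  have r: "0 \<le> r" "4 * r < 1" using g by (auto simp: r_def field_simps)
  have C: "0 \<le> C" using order_trans[OF dst_nonneg d[of 0]] by simp
  have 1: "dst (x (2 * k) (int k + j)) \<le> C * r ^ k * g ^ nat \<bar>j\<bar>" for k j
  proof (induction k arbitrary: j)
    case (Suc k)
    have "dst (x (Suc (Suc (2 * k))) (int k + 1 + j)) \<le> C * r ^ k * (g / (1 - g)\<^sup>2) * g ^ nat \<bar>j\<bar>"
      by (rule dst_double_tail[OF int x x x M M g(1,2) Suc])
    moreover have "int (Suc k) + j = int k + 1 + j" "2 * Suc k = Suc (Suc (2 * k))"
      "C * r ^ k * (g / (1 - g)\<^sup>2) = C * r ^ Suc k"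
      by (simp_all add: r_def)
    ultimately show ?case by metis
  qed (use d in auto)
  have 2: "dst (x (2 * k) j) \<le> C * r ^ k" for k j
  proof -
    have "C * r ^ k * g ^ nat \<bar>j - int k\<bar> \<le> C * r ^ k * 1"
      using C r g by (intro mult_left_mono power_le_one) auto
    then show ?thesis using 1[of k "j - int k"] by simp
  qed
  have 3: "dst (x m n) \<le> 2 ^ k * B" if "\<And>j. dst (x (m + k) j) \<le> B" for m k n B
    using that
  proof (induction k arbitrary: B)
    case (Suc k)
    have "dst (x (m + k) j) \<le> 2 * B" for j
    proof -
      have "x (m + k) j = (\<lambda>t. x (Suc (m + k)) (j + 1) t - x (Suc (m + k)) j t)"
        by (rule ext) (rule x)
      then show ?thesis
        using dst_diff_le[OF int int, of "Suc (m + k)" "j + 1" "Suc (m + k)" j] Suc(2)[of j] Suc(2)[of "j+1"]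
        by simp
    qed
    from Suc.IH[OF this] show ?case by simp
  qed auto
  have "dst (x 0 n) \<le> 2 ^ (2 * k) * (C * r ^ k)" for k
    by (rule 3) (use 2 in simp)
  then have "dst (x 0 n) \<le> C * (4 * r) ^ k" for k
    using power_mult[of "2::real" 2] by (simp add: power_mult_distrib mult_ac)
  moreover have "(\<lambda>k. C * (4 * r) ^ k) \<longlonglongrightarrow> C * 0"
    using r by (intro tendsto_intros LIMSEQ_realpow_zero) auto
  ultimately have "dst (x 0 n) \<le> 0"
    by (intro LIMSEQ_le_const[where X = "\<lambda>k. C * (4 * r) ^ k"]) auto
  then show ?thesis using dst_nonneg[of "x 0 n"] by simp
qed

end

section \<open>A power series divisible by all powers of \<open>1 - z\<close>\<close>

text \<open>
  By Euler's identity these are the coefficients of the product of \<open>1 - (1/4) ^ m * w\<close> over \<open>m \<ge> 1\<close>,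
  which vanishes at \<open>w = 4 ^ l\<close> for \<open>l \<ge> 1\<close>.
\<close>

primrec euler_coeff :: "nat \<Rightarrow> real" where
  "euler_coeff 0 = 1"
| "euler_coeff (Suc k) = - ((1/4) ^ Suc k / (1 - (1/4) ^ Suc k)) * euler_coeff k"

lemma euler_coeff_Suc: "euler_coeff (Suc k) * (1 - (1/4) ^ Suc k) = - ((1/4) ^ Suc k) * euler_coeff k"
proof -
  have "(1/4::real) ^ Suc k < 1" by (intro power_Suc_less_one) auto
  then have "1 - (1/4::real) ^ Suc k \<noteq> 0" by linarith
  then show ?thesis by (simp only: euler_coeff.simps) (simp add: field_simps)
qed

lemma abs_euler_coeff_Suc: "\<bar>euler_coeff (Suc k)\<bar> \<le> (4/3) * (1/4) ^ Suc k * \<bar>euler_coeff k\<bar>"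
proof -
  have "(1/4::real) ^ Suc k \<le> 1/4" using power_decreasing[of 1 "Suc k" "1/4::real"] by simp
  then have "3/4 \<le> 1 - (1/4::real) ^ Suc k" by linarith
  then have "(1/4) ^ Suc k / (1 - (1/4::real) ^ Suc k) \<le> (1/4) ^ Suc k / (3/4)"
    by (intro divide_left_mono mult_pos_pos) auto
  moreover have "\<bar>euler_coeff (Suc k)\<bar> = (1/4) ^ Suc k / (1 - (1/4::real) ^ Suc k) * \<bar>euler_coeff k\<bar>"
    using \<open>3/4 \<le> _\<close> by (simp only: euler_coeff.simps) (simp add: abs_mult)
  ultimately show ?thesis
    using mult_right_mono[of _ _ "\<bar>euler_coeff k\<bar>"] by fastforce
qed

text \<open>The coefficients decay like \<open>4 ^ - (k * (k + 1) / 2)\<close>, which beats every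
  \<open>4 ^ (k * l)\<close>: from \<open>k = l\<close> on the ratio is at most
  \<open>(4/3) * (1/4)\<close>.\<close>

lemma summable_euler_coeff: "summable (\<lambda>k. \<bar>euler_coeff k\<bar> * 4 ^ (k * l))"
proof (rule summable_ratio_test[where c = "1/3" and N = l])
  fix k assume "l \<le> k"
  have "\<bar>euler_coeff (Suc k)\<bar> * 4 ^ (Suc k * l) \<le>
      ((4/3) * (1/4) ^ Suc k * \<bar>euler_coeff k\<bar>) * 4 ^ (Suc k * l)"
    by (intro mult_right_mono abs_euler_coeff_Suc) auto
  also have "\<dots> = ((4/3) * ((1/4) ^ Suc k * 4 ^ l)) * (\<bar>euler_coeff k\<bar> * 4 ^ (k * l))"
    by (simp add: power_add)
  also have "(1/4::real) ^ Suc k * 4 ^ l \<le> (1/4) ^ Suc k * 4 ^ k"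
    using \<open>l \<le> k\<close> by (intro mult_left_mono power_increasing) auto
  also have "\<dots> = 1/4"
    by (simp add: power_one_over)
  finally show "norm (\<bar>euler_coeff (Suc k)\<bar> * 4 ^ (Suc k * l)) \<le>
      1/3 * norm (\<bar>euler_coeff k\<bar> * 4 ^ (k * l))"
    by (simp add: mult_right_mono mult_left_mono)
qed simp

definition euler_moment :: "nat \<Rightarrow> real" where
  "euler_moment l = (\<Sum>k. euler_coeff k * 4 ^ (k * l))"

lemma summable_euler_moment: "summable (\<lambda>k. euler_coeff k * 4 ^ (k * l))"
  by (rule summable_rabs_cancel) (use summable_euler_coeff[of l] in \<open>simp add: abs_mult\<close>)

lemma euler_moment_sums: "(\<lambda>k. euler_coeff k * 4 ^ (k * l)) sums euler_moment l"
  unfolding euler_moment_def by (rule summable_sums[OF summable_euler_moment])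

text \<open>This is the functional equation P(4 w) = (1 - w) P(w) of Euler's product at
  \<open>w = 4 ^ l\<close>, read off from the recurrence of the coefficients. The factor is 0 at
  \<open>l = 0\<close>, which makes all later moments vanish.\<close>

lemma euler_moment_Suc: "euler_moment (Suc l) = (1 - 4 ^ l) * euler_moment l"
proof -
  let ?d = "\<lambda>k. euler_coeff k * 4 ^ (k * Suc l) - euler_coeff k * 4 ^ (k * l)"
  have *: "?d (Suc k) = - (4 ^ l) * (euler_coeff k * 4 ^ (k * l))" for k
  proof -
    have "?d (Suc k) = (euler_coeff (Suc k) * (1 - (1/4) ^ Suc k)) * 4 ^ (Suc k * Suc l)"
      by (simp add: algebra_simps power_add power_one_over del: euler_coeff.simps)
    also have "\<dots> = - (4 ^ l) * (euler_coeff k * 4 ^ (k * l))"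
      unfolding euler_coeff_Suc by (simp add: power_add power_one_over)
    finally show ?thesis .
  qed
  have "?d sums (euler_moment (Suc l) - euler_moment l)"
    by (intro sums_diff euler_moment_sums)
  then have "(\<lambda>k. ?d (Suc k)) sums (euler_moment (Suc l) - euler_moment l)"
    using sums_Suc_iff[of ?d] by (simp del: euler_coeff.simps(2))
  moreover have "(\<lambda>k. ?d (Suc k)) sums (- (4 ^ l) * euler_moment l)"
    unfolding * by (intro sums_mult euler_moment_sums)
  ultimately have "euler_moment (Suc l) - euler_moment l = - (4 ^ l) * euler_moment l"
    by (rule sums_unique2)
  then show ?thesis by (simp add: algebra_simps)
qed

lemma euler_moment_eq_0: "euler_moment (Suc l) = 0"
  by (induction l) (simp_all add: euler_moment_Suc)

text \<open>The terms after the leading 1 are bounded by powers of 1/3 and sum to at most 1/2. This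
  number is the constant that survives in \<open>tdiff_tdiff_flat_limit\<close> and is divided out
  at the end.\<close>

lemma euler_moment_0_neq_0: "euler_moment 0 \<noteq> 0"
proof -
  have b: "\<bar>euler_coeff k\<bar> \<le> (1/3) ^ k" for k
  proof (induction k)
    case (Suc k)
    have "\<bar>euler_coeff (Suc k)\<bar> \<le> (4/3) * (1/4) ^ Suc k * \<bar>euler_coeff k\<bar>"
      by (rule abs_euler_coeff_Suc)
    also have "\<dots> \<le> (4/3) * (1/4) * (1/3) ^ k"
      using power_decreasing[of 1 "Suc k" "1/4::real"] by (intro mult_mono Suc) auto
    finally show ?case by simp
  qed simp
  have s: "(\<lambda>k. (1/3::real) ^ Suc k) sums (1/2)"
    using sums_mult[OF geometric_sums[of "1/3::real"], of "1/3"] by simp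
  have "(\<lambda>k. euler_coeff (Suc k)) sums (euler_moment 0 - 1)"
    using euler_moment_sums[of 0] sums_Suc_iff[of euler_coeff] by (simp del: euler_coeff.simps(2))
  then have "euler_moment 0 - 1 = (\<Sum>k. euler_coeff (Suc k))"
    by (rule sums_unique)
  then have "\<bar>euler_moment 0 - 1\<bar> = norm (\<Sum>k. euler_coeff (Suc k))"
    by simp
  also have "\<dots> \<le> (\<Sum>k. (1/3) ^ Suc k)"
    by (rule norm_suminf_le) (use b s in \<open>simp_all add: sums_iff del: euler_coeff.simps power_Suc\<close>)
  finally show ?thesis using sums_unique[OF s] by auto
qed

section \<open>Functional calculus of the twisted difference operator\<close>

locale twisted_shift =
  fixes \<kappa> L :: real
  assumes abs_kappa: "\<bar>\<kappa>\<bar> = 1"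
begin

definition tdiff :: "(real \<Rightarrow> complex) \<Rightarrow> real \<Rightarrow> complex" where
  "tdiff F x = F x - of_real \<kappa> * F (x - L)"

text \<open>The Neumann series of the inverse of \<open>1 + e - \<kappa> * \<tau>\<close>, with
  \<open>\<tau>\<close> the translation by \<open>L\<close>. It converges because
  \<open>\<bar>\<kappa>\<bar> = 1\<close> and \<open>e > 0\<close>, and its norm is at most
  \<open>1 / e\<close> (\<open>bd_res\<close>).\<close>

definition res :: "real \<Rightarrow> (real \<Rightarrow> complex) \<Rightarrow> real \<Rightarrow> complex" where
  "res e F x = (\<Sum>n. of_real ((1 / (1 + e)) ^ Suc n * \<kappa> ^ n) * F (x - of_nat n * L))"

lemma bd_tdiff: "bd F C \<Longrightarrow> bd (tdiff F) (2 * C)"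
  using bd_diff[OF _ bd_scale[OF bd_translate[of F C L], of "of_real \<kappa>"], of F C] abs_kappa
  by (simp add: tdiff_def[abs_def] translate_def[abs_def])

lemma res_translate: "res e (translate a F) = translate a (res e F)"
  by (simp add: res_def translate_def fun_eq_iff algebra_simps)

context
  fixes F :: "real \<Rightarrow> complex" and C e :: real
  assumes F: "bd F C" and e: "0 < e"
begin

lemma bd_res_term: "bd (\<lambda>x. of_real ((1 / (1 + e)) ^ Suc n * \<kappa> ^ n) * F (x - of_nat n * L))
    ((1 / (1 + e)) ^ Suc n * C)"
proof -
  have "norm (complex_of_real ((1 / (1 + e)) ^ Suc n * \<kappa> ^ n)) = (1 / (1 + e)) ^ Suc n"
    using e by (simp only: norm_of_real abs_mult power_abs abs_kappa) simp
  then show ?thesis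
    using bd_scale[OF bd_translate[OF F, of "of_nat n * L"], of "of_real ((1 / (1 + e)) ^ Suc n * \<kappa> ^ n)"]
    by (simp only: translate_def)
qed

lemma res_const_sums: "(\<lambda>n. (1 / (1 + e)) ^ Suc n * C) sums (C / e)"
proof -
  have "(\<lambda>n. (1 / (1 + e)) ^ n) sums (1 / (1 - 1 / (1 + e)))"
    using e by (intro geometric_sums) auto
  from sums_mult2[OF sums_mult[OF this, of "1 / (1 + e)"], of C] show ?thesis
    using e by (simp add: field_simps)
qed

lemma summable_res: "summable (\<lambda>n. of_real ((1 / (1 + e)) ^ Suc n * \<kappa> ^ n) * F (x - of_nat n * L))"
  by (rule bd_suminf(2)[OF bd_res_term sums_summable[OF res_const_sums]])

lemma res_sums: "(\<lambda>n. of_real ((1 / (1 + e)) ^ Suc n * \<kappa> ^ n) * F (x - of_nat n * L)) sums res e F x"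
  unfolding res_def by (rule summable_sums[OF summable_res])

lemma bd_res: "bd (res e F) (C / e)"
  using bd_suminf(1)[OF bd_res_term sums_summable[OF res_const_sums]]
  by (simp only: sums_unique[OF res_const_sums, symmetric] res_def[abs_def])

lemma tdiff_res: "tdiff (res e F) = (\<lambda>x. F x - of_real e * res e F x)"
proof
  fix x
  let ?f = "\<lambda>x n. of_real ((1 / (1 + e)) ^ Suc n * \<kappa> ^ n) * F (x - of_nat n * L)"
  have *: "?f x (Suc n) = of_real \<kappa> / of_real (1 + e) * ?f (x - L) n" for n
    by (simp add: algebra_simps)
  have "(\<lambda>n. ?f x (Suc n)) sums (of_real \<kappa> / of_real (1 + e) * res e F (x - L))"
    unfolding * by (intro sums_mult res_sums)
  then have "?f x sums (of_real \<kappa> / of_real (1 + e) * res e F (x - L) + ?f x 0)"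
    by (rule sums_Suc)
  from sums_unique2[OF res_sums this]
  have eq: "res e F x = (of_real \<kappa> * res e F (x - L) + F x) / of_real (1 + e)"
    by (simp add: add_divide_distrib)
  have "of_real (1 + e) \<noteq> (0::complex)"
    using e unfolding of_real_eq_0_iff by linarith
  then have "of_real (1 + e) * res e F x = of_real \<kappa> * res e F (x - L) + F x"
    using eq by (metis nonzero_eq_divide_eq mult.commute)
  then show "tdiff (res e F) x = F x - of_real e * res e F x"
    by (simp add: tdiff_def algebra_simps)
qed

lemma res_tdiff: "res e (tdiff F) = tdiff (res e F)"
proof
  fix x
  have "(\<lambda>n. of_real ((1 / (1 + e)) ^ Suc n * \<kappa> ^ n) * F (x - of_nat n * L)
     - of_real \<kappa> * (of_real ((1 / (1 + e)) ^ Suc n * \<kappa> ^ n) * F ((x - L) - of_nat n * L))) sums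
     tdiff (res e F) x"
    unfolding tdiff_def by (intro sums_diff sums_mult res_sums)
  moreover have "of_real ((1 / (1 + e)) ^ Suc n * \<kappa> ^ n) * F (x - of_nat n * L)
     - of_real \<kappa> * (of_real ((1 / (1 + e)) ^ Suc n * \<kappa> ^ n) * F ((x - L) - of_nat n * L)) =
     of_real ((1 / (1 + e)) ^ Suc n * \<kappa> ^ n) * tdiff F (x - of_nat n * L)" for n
    by (simp add: tdiff_def algebra_simps)
  ultimately show "res e (tdiff F) x = tdiff (res e F) x"
    unfolding res_def[of e "tdiff F"] by (simp only: sums_iff)
qed

end

lemma res_add:
  assumes "bd F C" "bd G D" "0 < e"
  shows "res e (\<lambda>x. F x + G x) x = res e F x + res e G x"
  using sums_add[OF res_sums[OF assms(1,3), of x] res_sums[OF assms(2,3), of x]]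
  by (simp only: res_def[of e "\<lambda>x. F x + G x"] sums_iff distrib_left)

lemma res_scale:
  assumes "bd F C" "0 < e"
  shows "res e (\<lambda>x. c * F x) x = c * res e F x"
  using sums_mult[OF res_sums[OF assms, of x], of c]
  by (simp only: res_def[of e "\<lambda>x. c * F x"] sums_iff mult.left_commute[of c])

text \<open>
  Since \<open>res e\<close> is the inverse of \<open>tdiff + e\<close>, the vanishing moments \<open>euler_moment (Suc l)\<close> make \<open>flat m l\<close>
  divisible by \<open>tdiff\<close>: see \<open>tdiff_flat_Suc\<close>.
\<close>

definition flat :: "nat \<Rightarrow> nat \<Rightarrow> (real \<Rightarrow> complex) \<Rightarrow> real \<Rightarrow> complex" where
  "flat m l F x = (\<Sum>k. of_real (euler_coeff k * 4 ^ (k * l)) * res ((1/4) ^ (k + m)) F x)"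

text \<open>The factor \<open>4 ^ m\<close> and the raised exponent \<open>Suc l\<close> come from
  the norm \<open>4 ^ (k + m)\<close> of the resolvent at \<open>(1/4) ^ (k + m)\<close>.\<close>

definition flat_bound :: "nat \<Rightarrow> nat \<Rightarrow> real" where
  "flat_bound m l = 4 ^ m * (\<Sum>k. \<bar>euler_coeff k\<bar> * 4 ^ (k * Suc l))"

lemma flat_translate: "flat m l (translate a F) = translate a (flat m l F)"
  by (rule ext) (simp add: flat_def res_translate, simp add: flat_def translate_def)

lemma bd_flat_term:
  assumes "bd F C"
  shows "bd (\<lambda>x. of_real (euler_coeff k * 4 ^ (k * l)) * res ((1/4) ^ (k + m)) F x)
    (4 ^ m * (\<bar>euler_coeff k\<bar> * 4 ^ (k * Suc l)) * C)"
proof -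
  have "norm (complex_of_real (euler_coeff k * 4 ^ (k * l))) * (C / (1/4) ^ (k + m))
      = 4 ^ m * (\<bar>euler_coeff k\<bar> * 4 ^ (k * Suc l)) * C"
    by (simp only: norm_of_real abs_mult power_abs) (simp add: power_add power_one_over)
  then show ?thesis
    using bd_scale[OF bd_res[OF assms, of "(1/4) ^ (k + m)"], of "of_real (euler_coeff k * 4 ^ (k * l))"]
    by simp
qed

lemma bd_flat_sums:
  "(\<lambda>k. 4 ^ m * (\<bar>euler_coeff k\<bar> * 4 ^ (k * Suc l)) * C) sums (flat_bound m l * C)"
  unfolding flat_bound_def
  by (intro sums_mult sums_mult2 summable_sums summable_euler_coeff)

lemma moment_sums: "(\<lambda>k. complex_of_real (euler_coeff k * 4 ^ (k * l)) * c) sums (of_real (euler_moment l) * c)"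
  by (intro sums_mult2) (simp only: sums_of_real_iff euler_moment_sums)

context
  fixes F :: "real \<Rightarrow> complex" and C :: real
  assumes F: "bd F C"
begin

lemma bd_flat: "bd (flat m l F) (flat_bound m l * C)"
  using bd_suminf(1)[OF bd_flat_term[OF F] sums_summable[OF bd_flat_sums]]
  by (simp only: sums_unique[OF bd_flat_sums, symmetric] flat_def[abs_def])

lemma flat_sums: "(\<lambda>k. of_real (euler_coeff k * 4 ^ (k * l)) * res ((1/4) ^ (k + m)) F x) sums flat m l F x"
  unfolding flat_def
  by (rule summable_sums[OF bd_suminf(2)[OF bd_flat_term[OF F] sums_summable[OF bd_flat_sums]]])

lemma tdiff_flat_sums:
  "(\<lambda>k. of_real (euler_coeff k * 4 ^ (k * l)) * (F x - of_real ((1/4) ^ (k + m)) * res ((1/4) ^ (k + m)) F x))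
    sums tdiff (flat m l F) x"
proof -
  have "of_real (euler_coeff k * 4 ^ (k * l)) * (F x - of_real ((1/4) ^ (k + m)) * res ((1/4) ^ (k + m)) F x)
    = of_real (euler_coeff k * 4 ^ (k * l)) * res ((1/4) ^ (k + m)) F x
     - of_real \<kappa> * (of_real (euler_coeff k * 4 ^ (k * l)) * res ((1/4) ^ (k + m)) F (x - L))" for k
  proof -
    have "F x - of_real ((1/4) ^ (k + m)) * res ((1/4) ^ (k + m)) F x = tdiff (res ((1/4) ^ (k + m)) F) x"
      by (subst tdiff_res[OF F]) simp_all
    then show ?thesis by (simp only:) (simp add: tdiff_def algebra_simps)
  qed
  then show ?thesis
    unfolding tdiff_def by (simp only:) (intro sums_diff sums_mult flat_sums)
qed

text \<open>Each resolvent satisfies \<open>tdiff (res e F) = F - e * res e F\<close>. The copies of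
  \<open>F\<close> add up to \<open>euler_moment (Suc l) = 0\<close>, and the factors
  \<open>e = (1/4) ^ (k + m)\<close> lower the weight \<open>4 ^ (k * Suc l)\<close> to
  \<open>4 ^ (k * l)\<close>. Iteration exhibits \<open>flat m 0 F\<close> as a constant times the
  \<open>l\<close>-th power of \<open>tdiff\<close> applied to \<open>flat m l F\<close>, for every
  \<open>l\<close>.\<close>

lemma tdiff_flat_Suc: "tdiff (flat m (Suc l) F) = (\<lambda>x. - of_real ((1/4) ^ m) * flat m l F x)"
proof
  fix x
  have "of_real (euler_coeff k * 4 ^ (k * Suc l)) * (F x - of_real ((1/4) ^ (k + m)) * res ((1/4) ^ (k + m)) F x)
    = of_real (euler_coeff k * 4 ^ (k * Suc l)) * F x -
      of_real ((1/4) ^ m) * (of_real (euler_coeff k * 4 ^ (k * l)) * res ((1/4) ^ (k + m)) F x)" for k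
    by (simp add: algebra_simps power_add power_one_over)
  moreover have "(\<lambda>k. of_real (euler_coeff k * 4 ^ (k * Suc l)) * F x -
      of_real ((1/4) ^ m) * (of_real (euler_coeff k * 4 ^ (k * l)) * res ((1/4) ^ (k + m)) F x)) sums
     (of_real (euler_moment (Suc l)) * F x - of_real ((1/4) ^ m) * flat m l F x)"
    by (intro sums_diff moment_sums sums_mult flat_sums)
  ultimately show "tdiff (flat m (Suc l) F) x = - of_real ((1/4) ^ m) * flat m l F x"
    using sums_unique2[OF tdiff_flat_sums[of "Suc l" x m]] by (simp add: euler_moment_eq_0)
qed

text \<open>
  With \<open>s\<close> for \<open>tdiff\<close> and \<open>E m\<close> for the product of \<open>s / (s + (1/4) ^ k)\<close> over \<open>k \<ge> m\<close>,
  \<open>tdiff \<circ> flat m 0\<close> is a constant multiple of \<open>E m\<close>, and the lemma says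
  \<open>E (m + 1) = (s + (1/4) ^ m) / s * E m\<close>.
\<close>

lemma tdiff_flat_shift:
  "tdiff (flat (Suc m) 0 F) = (\<lambda>x. tdiff (flat m 0 F) x + of_real ((1/4) ^ m) * flat m 0 F x)"
proof
  fix x
  let ?b = "\<lambda>k. complex_of_real (euler_coeff k)" and ?R = "\<lambda>k. res ((1/4) ^ k) F x"
  let ?f = "\<lambda>k. ?b k * (F x - of_real ((1/4) ^ (k + m)) * ?R (k + m)) + of_real ((1/4) ^ m) * (?b k * ?R (k + m))"
  have "?f sums (tdiff (flat m 0 F) x + of_real ((1/4) ^ m) * flat m 0 F x)"
    using tdiff_flat_sums[of 0 x m] flat_sums[of 0 m x] by (intro sums_add sums_mult) simp_all
  moreover have "?f sums tdiff (flat (Suc m) 0 F) x"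
  proof -
    let ?G = "\<lambda>k. of_real (euler_coeff k * (1 - (1/4) ^ k)) * (of_real ((1/4) ^ m) * ?R (k + m))"
    let ?h = "\<lambda>k. ?b k * F x - ?b k * (F x - of_real ((1/4) ^ (k + Suc m)) * ?R (k + Suc m))"
    have f: "?f k = ?b k * F x + ?G k" for k
      by (simp add: algebra_simps power_add)
    \<comment> \<open>The factor \<open>1 - (1/4) ^ k\<close> removes the term with
      \<open>k = 0\<close>; for the others the recurrence of the coefficients turns index
      \<open>Suc k\<close> at level \<open>m\<close> into index \<open>k\<close> at level
      \<open>Suc m\<close>.\<close>
    have G: "?G (Suc k) = - ?h k" for k
      unfolding euler_coeff_Suc by (simp add: algebra_simps power_add)
    have b: "(\<lambda>k. ?b k * F x) sums (of_real (euler_moment 0) * F x)"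
      using moment_sums[of 0 "F x"] by simp
    then have "?h sums (of_real (euler_moment 0) * F x - tdiff (flat (Suc m) 0 F) x)"
      using tdiff_flat_sums[of 0 x "Suc m"] by (intro sums_diff) simp_all
    then have "(\<lambda>k. ?G (Suc k)) sums - (of_real (euler_moment 0) * F x - tdiff (flat (Suc m) 0 F) x)"
      unfolding G by (rule sums_minus)
    then have "?G sums - (of_real (euler_moment 0) * F x - tdiff (flat (Suc m) 0 F) x)"
      using sums_Suc_iff[of ?G] by (simp del: euler_coeff.simps(2))
    from sums_add[OF b this] show ?thesis
      unfolding f by simp
  qed
  ultimately show "tdiff (flat (Suc m) 0 F) x = tdiff (flat m 0 F) x + of_real ((1/4) ^ m) * flat m 0 F x"
    by (rule sums_unique2[symmetric])
qed

lemma flat_tdiff: "flat m l (tdiff F) = tdiff (flat m l F)"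
proof
  fix x
  have "(\<lambda>k. of_real (euler_coeff k * 4 ^ (k * l)) * res ((1/4) ^ (k + m)) F x -
      of_real \<kappa> * (of_real (euler_coeff k * 4 ^ (k * l)) * res ((1/4) ^ (k + m)) F (x - L)))
    sums tdiff (flat m l F) x"
    unfolding tdiff_def by (intro sums_diff sums_mult flat_sums)
  moreover have "of_real (euler_coeff k * 4 ^ (k * l)) * res ((1/4) ^ (k + m)) F x -
      of_real \<kappa> * (of_real (euler_coeff k * 4 ^ (k * l)) * res ((1/4) ^ (k + m)) F (x - L)) =
    of_real (euler_coeff k * 4 ^ (k * l)) * res ((1/4) ^ (k + m)) (tdiff F) x" for k
    by (subst res_tdiff[OF F]) (simp_all add: tdiff_def algebra_simps)
  ultimately show "flat m l (tdiff F) x = tdiff (flat m l F) x"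
    unfolding flat_def by (simp add: sums_iff)
qed

end

text \<open>On the range of \<open>tdiff\<close> the correction terms are small:
  \<open>e * tdiff (res e F) = e * (F - e * res e F)\<close> is bounded by \<open>2 * C * e\<close>,
  and every \<open>e\<close> that occurs is at most \<open>(1/4) ^ m\<close>. Without the outer
  \<open>tdiff\<close> the terms \<open>e * res e F\<close> would only be bounded.\<close>

lemma tdiff_tdiff_flat_limit:
  assumes F: "bd F C"
  shows "bd (\<lambda>x. of_real (euler_moment 0) * tdiff F x - tdiff (tdiff (flat m 0 F)) x)
    ((1/4) ^ m * (2 * C * (\<Sum>k. \<bar>euler_coeff k\<bar>)))"
proof -
  let ?g = "\<lambda>k x. of_real (euler_coeff k) * (of_real ((1/4) ^ (k + m)) * tdiff (res ((1/4) ^ (k + m)) F) x)"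
  have F': "bd (tdiff F) (2 * C)" using F by (rule bd_tdiff)
  have e: "(0::real) < (1/4) ^ (k + m)" for k by simp
  have C: "0 \<le> C" using F by (rule bd_nonneg)
  have b: "bd (?g k) (\<bar>euler_coeff k\<bar> * ((1/4) ^ m * (2 * C)))" for k
  proof -
    have "bd (\<lambda>x. of_real ((1/4) ^ (k + m)) * res ((1/4) ^ (k + m)) F x)
        (norm (complex_of_real ((1/4) ^ (k + m))) * (C / (1/4) ^ (k + m)))"
      by (intro bd_scale bd_res[OF F e])
    then have "bd (\<lambda>x. of_real ((1/4) ^ (k + m)) * res ((1/4) ^ (k + m)) F x) C"
      by (simp only: norm_of_real) simp
    from bd_diff[OF F this] have "bd (tdiff (res ((1/4) ^ (k + m)) F)) (2 * C)"
      unfolding tdiff_res[OF F e] by simp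
    from bd_scale[OF bd_scale[OF this, of "of_real ((1/4) ^ (k + m))"], of "of_real (euler_coeff k)"]
    have "bd (?g k) (\<bar>euler_coeff k\<bar> * ((1/4) ^ (k + m) * (2 * C)))"
      by (simp only: norm_of_real) simp
    moreover have "(1/4::real) ^ (k + m) \<le> (1/4) ^ m"
      by (intro power_decreasing) auto
    ultimately show ?thesis
      using C by (auto elim!: bd_mono intro!: mult_left_mono mult_right_mono)
  qed
  have s: "(\<lambda>k. \<bar>euler_coeff k\<bar> * ((1/4) ^ m * (2 * C))) sums ((1/4) ^ m * (2 * C * (\<Sum>k. \<bar>euler_coeff k\<bar>)))"
    using sums_mult2[OF summable_sums[OF summable_euler_coeff[of 0]], of "(1/4) ^ m * (2 * C)"]
    by (simp add: mult_ac)
  have "(\<Sum>k. ?g k x) = of_real (euler_moment 0) * tdiff F x - tdiff (tdiff (flat m 0 F)) x" for x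
  proof -
    have "(\<lambda>k. of_real (euler_coeff k) * tdiff F x - of_real (euler_coeff k) *
        (tdiff F x - of_real ((1/4) ^ (k + m)) * res ((1/4) ^ (k + m)) (tdiff F) x))
      sums (of_real (euler_moment 0) * tdiff F x - tdiff (flat m 0 (tdiff F)) x)"
      using moment_sums[of 0 "tdiff F x"] tdiff_flat_sums[OF F', of 0 x m] by (intro sums_diff) simp_all
    moreover have "of_real (euler_coeff k) * tdiff F x - of_real (euler_coeff k) *
        (tdiff F x - of_real ((1/4) ^ (k + m)) * res ((1/4) ^ (k + m)) (tdiff F) x) = ?g k x" for k
      unfolding res_tdiff[OF F e] by (simp add: algebra_simps)
    ultimately show ?thesis by (simp add: sums_iff flat_tdiff[OF F])
  qed
  with bd_suminf(1)[OF b sums_summable[OF s]] sums_unique[OF s] show ?thesis by simp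
qed

lemma flat_add:
  assumes "bd F C" "bd G D"
  shows "flat m l (\<lambda>x. F x + G x) x = flat m l F x + flat m l G x"
  using sums_add[OF flat_sums[OF assms(1), of l m x] flat_sums[OF assms(2), of l m x]]
  by (simp add: flat_def[of m l "\<lambda>x. F x + G x"] sums_iff distrib_left res_add[OF assms])

lemma flat_scale:
  assumes "bd F C"
  shows "flat m l (\<lambda>x. c * F x) x = c * flat m l F x"
  using sums_mult[OF flat_sums[OF assms, of l m x], of c]
  by (simp add: flat_def[of m l "\<lambda>x. c * F x"] sums_iff mult.left_commute[of c] res_scale[OF assms])

lemma flat_sum:
  assumes "finite I" "\<And>i. i \<in> I \<Longrightarrow> bd (F i) (C i)"
  shows "flat m l (\<lambda>x. \<Sum>i\<in>I. F i x) x = (\<Sum>i\<in>I. flat m l (F i) x)"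
  using assms
proof (induction I)
  case empty
  then show ?case using flat_scale[OF bd_zero, of m l 0 x] by simp
next
  case (insert i I)
  then show ?case using flat_add[of "F i" "C i" "\<lambda>x. \<Sum>i\<in>I. F i x" "\<Sum>i\<in>I. C i"] bd_sum[of I F C] by simp
qed

end

section \<open>Integer orbits contained in the closure of the subspace\<close>

context real_subspace
begin

text \<open>Integer translates are the right class here: below, the shift has integer length
  \<open>N\<close>, so it maps integer orbits into themselves and \<open>tdiff\<close>,
  \<open>res\<close> preserve the property.\<close>

definition null_orbit :: "(real \<Rightarrow> complex) \<Rightarrow> bool" where
  "null_orbit F \<longleftrightarrow> (\<forall>n::int. dst (translate (of_int n) F) = 0)"

lemma null_orbit_translate: "null_orbit F \<Longrightarrow> null_orbit (translate (of_int n) F)"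
  unfolding null_orbit_def translate_translate
  by (metis of_int_add)

lemma null_orbit_add:
  assumes "null_orbit F" "null_orbit G" "integrable lborel F" "integrable lborel G"
  shows "null_orbit (\<lambda>x. F x + G x)"
  unfolding null_orbit_def
proof
  fix n :: int
  have "translate (of_int n) (\<lambda>x. F x + G x) = (\<lambda>x. translate (of_int n) F x + translate (of_int n) G x)"
    by (simp add: translate_def)
  then show "dst (translate (of_int n) (\<lambda>x. F x + G x)) = 0"
    using dst_add_le[of "translate (of_int n) F" "translate (of_int n) G"] assms
      dst_nonneg[of "translate (of_int n) (\<lambda>x. F x + G x)"]
    by (auto simp: null_orbit_def)
qed

lemma null_orbit_scale:
  assumes "null_orbit F"
  shows "null_orbit (\<lambda>x. of_real c * F x)"
  unfolding null_orbit_def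
proof
  fix n :: int
  have "translate (of_int n) (\<lambda>x. of_real c * F x) = (\<lambda>x. of_real c * translate (of_int n) F x)"
    by (simp add: translate_def)
  then show "dst (translate (of_int n) (\<lambda>x. of_real c * F x)) = 0"
    using dst_scale_le[of c "translate (of_int n) F"] assms
      dst_nonneg[of "translate (of_int n) (\<lambda>x. of_real c * F x)"]
    by (auto simp: null_orbit_def)
qed

lemma null_orbit_limit:
  assumes F: "bd F C" and G: "\<And>k::nat. null_orbit (G k)" and b: "\<And>k. bd (\<lambda>x. F x - G k x) (c k)" and c: "c \<longlonglongrightarrow> 0"
  shows "null_orbit F"
  unfolding null_orbit_def
proof
  fix n :: int
  have "integrable lborel (\<lambda>x. F x - (F x - G k x))" for k
    using bd_integrable[OF F] bd_integrable[OF b[of k]] by (rule Bochner_Integration.integrable_diff)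
  then have i: "integrable lborel (G k)" for k by simp
  have "(\<lambda>k. nrm (\<lambda>x. translate (of_int n) F x - translate (of_int n) (G k) x)) \<longlonglongrightarrow> 0"
  proof (rule tendsto_sandwich[OF _ _ tendsto_const c])
    have "nrm (\<lambda>x. translate (of_int n) F x - translate (of_int n) (G k) x) \<le> c k" for k
      using bd_nrm[OF bd_translate[OF b[of k], of "of_int n"]] by (simp add: translate_def)
    then show "\<forall>\<^sub>F k in sequentially. nrm (\<lambda>x. translate (of_int n) F x - translate (of_int n) (G k) x) \<le> c k"
      by simp
  qed (simp add: nrm_nonneg)
  then show "dst (translate (of_int n) F) = 0"
    using G
    by (rule_tac dst_limit[where G = "\<lambda>k. translate (of_int n) (G k)"])
      (auto simp: null_orbit_def intro: bd_integrable[OF F] i)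
qed

end

locale twisted_subspace = real_subspace S + twisted_shift \<kappa> "real N"
  for S :: "(real \<Rightarrow> complex) set" and \<kappa> :: real and N :: nat
begin

lemma null_orbit_tdiff:
  assumes "null_orbit F" "integrable lborel F"
  shows "null_orbit (tdiff F)"
  using null_orbit_add[OF assms(1) null_orbit_scale[OF null_orbit_translate[OF assms(1), of "int N"], of "-\<kappa>"]]
    assms(2) integrable_translate[OF assms(2), of "real N"] by (simp add: translate_def tdiff_def[abs_def])

lemma null_orbit_res:
  assumes "null_orbit F" "bd F C" "0 < e"
  shows "null_orbit (res e F)"
  unfolding null_orbit_def
proof
  fix n :: int
  have F: "bd (translate (of_int n) F) C" using assms by (intro bd_translate)
  have "dst (\<lambda>x. of_real ((1 / (1 + e)) ^ Suc k * \<kappa> ^ k) * translate (of_int n) F (x - of_nat k * real N)) = 0" for k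
  proof -
    have "null_orbit (\<lambda>x. of_real ((1 / (1 + e)) ^ Suc k * \<kappa> ^ k) * translate (of_int (n + int k * int N)) F x)"
      by (intro null_orbit_scale null_orbit_translate assms)
    from this[unfolded null_orbit_def, rule_format, of 0] show ?thesis
      by (simp add: translate_def algebra_simps)
  qed
  from dst_suminf[OF bd_res_term[OF F assms(3)] sums_summable[OF res_const_sums[OF F assms(3)]] this]
  have "dst (res e (translate (of_int n) F)) = 0"
    unfolding res_def[abs_def] .
  then show "dst (translate (of_int n) (res e F)) = 0"
    by (simp only: res_translate)
qed

text \<open>\<open>res e (tdiff g)\<close> tends to \<open>g\<close> as \<open>e \<rightarrow> 0\<close> whenever \<open>g\<close> lies in the range of \<open>tdiff\<close>.\<close>

lemma null_orbit_cancel: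
  assumes g': "bd g' C" and J: "null_orbit (tdiff (tdiff g'))"
  shows "null_orbit (tdiff g')"
proof (rule null_orbit_limit)
  define e :: "nat \<Rightarrow> real" where "e k = 1 / real (Suc k)" for k
  have e: "0 < e k" for k by (simp add: e_def)
  have g: "bd (tdiff g') (2 * C)" using g' by (rule bd_tdiff)
  then show "bd (tdiff g') (2 * C)" .
  show "null_orbit (res (e k) (tdiff (tdiff g')))" for k
    by (rule null_orbit_res[OF J bd_tdiff[OF g] e])
  \<comment> \<open>The error is \<open>e * res e (tdiff g') = e * (g' - e * res e g')\<close>; its
    norm is at most \<open>2 * C * e\<close>, since \<open>e * res e\<close> has norm at most
    1.\<close>
  show "bd (\<lambda>x. tdiff g' x - res (e k) (tdiff (tdiff g')) x) (e k * (2 * C))" for k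
  proof -
    have "bd (\<lambda>x. of_real (e k) * res (e k) g' x) (norm (complex_of_real (e k)) * (C / e k))"
      by (intro bd_scale bd_res g' e)
    then have "bd (\<lambda>x. of_real (e k) * res (e k) g' x) C"
      using e[of k] by simp
    from bd_scale[OF bd_diff[OF g' this], of "of_real (e k)"]
    have "bd (\<lambda>x. of_real (e k) * (g' x - of_real (e k) * res (e k) g' x)) (e k * (2 * C))"
      using e[of k] by simp
    moreover have "res (e k) (tdiff (tdiff g')) = (\<lambda>x. tdiff g' x - of_real (e k) * res (e k) (tdiff g') x)"
      by (simp only: res_tdiff[OF g e] tdiff_res[OF g e])
    moreover have "res (e k) (tdiff g') = (\<lambda>x. g' x - of_real (e k) * res (e k) g' x)"
      by (simp only: res_tdiff[OF g' e] tdiff_res[OF g' e])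
    ultimately show ?thesis by simp
  qed
  have "e \<longlonglongrightarrow> 0" unfolding e_def by (intro LIMSEQ_Suc lim_1_over_n)
  from tendsto_mult_right[OF this, of "2 * C"] show "(\<lambda>k. e k * (2 * C)) \<longlonglongrightarrow> 0" by simp
qed

text \<open>The factors \<open>s / (s + (1/4) ^ k)\<close> hidden in \<open>flat\<close> are
  stripped off one at a time: \<open>tdiff_flat_shift\<close> gives
  \<open>tdiff (flat (Suc m) 0 W)\<close>, and cancelling \<open>tdiff\<close> gives
  \<open>flat (Suc m) 0 W\<close>. As \<open>m\<close> grows, only the constant
  \<open>euler_moment 0\<close> and a single \<open>tdiff\<close> remain.\<close>

lemma null_orbit_tdiff_of_flat:
  assumes W: "bd W C" and J: "null_orbit (flat 0 0 W)"
  shows "null_orbit (tdiff W)"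
proof -
  have J: "null_orbit (flat m 0 W)" for m
  proof (induction m)
    case (Suc m)
    have "null_orbit (tdiff (flat (Suc m) 0 W))"
      unfolding tdiff_flat_shift[OF W] using bd_integrable[OF bd_flat[OF W]] Suc
      by (intro null_orbit_add null_orbit_tdiff null_orbit_scale)
        (auto intro!: bd_integrable[OF bd_tdiff[OF bd_flat[OF W]]])
    \<comment> \<open>\<open>null_orbit_cancel\<close> requires \<open>flat (Suc m) 0 W\<close> to
      lie in the range of \<open>tdiff\<close>; \<open>G\<close> is a preimage, supplied by
      \<open>tdiff_flat_Suc\<close>.\<close>
    moreover define G where "G = (\<lambda>x. of_real (- (4 ^ Suc m)) * flat (Suc m) (Suc 0) W x)"
    have "bd G (4 ^ Suc m * (flat_bound (Suc m) (Suc 0) * C))"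
      using bd_scale[OF bd_flat[OF W], of "of_real (- (4 ^ Suc m))"]
      unfolding G_def norm_of_real abs_minus_cancel by simp
    moreover have "flat (Suc m) 0 W = tdiff G"
    proof
      fix x
      have "tdiff G x = of_real (- (4 ^ Suc m)) * tdiff (flat (Suc m) (Suc 0) W) x"
        by (simp add: G_def tdiff_def algebra_simps)
      then show "flat (Suc m) 0 W x = tdiff G x"
        by (simp add: tdiff_flat_Suc[OF W] power_one_over)
    qed
    ultimately show ?case using null_orbit_cancel by metis
  qed (rule J)
  have "null_orbit (\<lambda>x. of_real (euler_moment 0) * tdiff W x)"
  proof (rule null_orbit_limit[OF bd_scale[OF bd_tdiff[OF W]] _ tdiff_tdiff_flat_limit[OF W]])
    show "null_orbit (tdiff (tdiff (flat k 0 W)))" for k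
      using bd_integrable[OF bd_flat[OF W]] bd_integrable[OF bd_tdiff[OF bd_flat[OF W]]] J
      by (intro null_orbit_tdiff) auto
    have "(\<lambda>k. (1/4::real) ^ k * (2 * C * (\<Sum>k. \<bar>euler_coeff k\<bar>))) \<longlonglongrightarrow> 0 * (2 * C * (\<Sum>k. \<bar>euler_coeff k\<bar>))"
      by (intro tendsto_intros LIMSEQ_realpow_zero) auto
    then show "(\<lambda>k. (1/4::real) ^ k * (2 * C * (\<Sum>k. \<bar>euler_coeff k\<bar>))) \<longlonglongrightarrow> 0" by simp
  qed
  from null_orbit_scale[OF this, of "inverse (euler_moment 0)"] show ?thesis
    using euler_moment_0_neq_0 by (simp flip: mult.assoc of_real_mult)
qed

end

section \<open>Powers of the Cauchy kernel\<close>

lemma binomial_series: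
  fixes z :: complex
  assumes "norm z < 1"
  shows "(\<lambda>j. of_nat ((n + j) choose j) * z ^ j) sums (1 / (1 - z) ^ Suc n)"
proof -
  have "((- of_nat (Suc n)) gchoose j) * (- z) ^ j = of_nat ((n + j) choose j) * z ^ j" for j
  proof -
    have "(- of_nat (Suc n) :: complex) gchoose j = (-1) ^ j * of_nat ((n + j) choose j)"
      by (subst gbinomial_minus) (simp add: binomial_gbinomial)
    then show ?thesis by (simp add: power_minus[of z])
  qed
  moreover have "(1 - z) powr (- of_nat (Suc n)) = 1 / (1 - z) ^ Suc n"
    using assms by (subst powr_minus, subst powr_nat') (auto simp: divide_inverse)
  ultimately show ?thesis
    using gen_binomial_complex[of "-z" "- of_nat (Suc n)"] assms by simp
qed

lemma binomial_series_summable: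
  assumes "0 \<le> t" "t < (1::real)"
  shows "summable (\<lambda>j. real ((n + j) choose j) * t ^ j)"
proof -
  have "summable (\<lambda>j. complex_of_real (real ((n + j) choose j) * t ^ j))"
    using sums_summable[OF binomial_series[of "of_real t" n]] assms by simp
  then show ?thesis by (simp only: summable_complex_of_real)
qed

text \<open>The exponent starts at 2, the first integrable power. \<open>cauchy_ker 1 j\<close> is
  the \<open>W\<^sub>j\<close> of the overview; a general pole \<open>- \<i> * a\<close> is needed
  when the pole is moved along the imaginary axis.\<close>

definition cauchy_ker :: "real \<Rightarrow> nat \<Rightarrow> real \<Rightarrow> complex" where
  "cauchy_ker a j x = 1 / (of_real x + \<i> * of_real a) ^ (j + 2)"

lemma norm_add_ii: "\<bar>a\<bar> \<le> norm (of_real x + \<i> * of_real a)"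
  using abs_Im_le_cmod[of "of_real x + \<i> * of_real a"] by simp

lemma norm_add_ii_square: "norm (of_real x + \<i> * of_real a) ^ 2 = x\<^sup>2 + a\<^sup>2"
  by (simp add: cmod_def)

lemma add_ii_neq_0: "a \<noteq> 0 \<Longrightarrow> of_real x + \<i> * of_real a \<noteq> 0"
  using norm_add_ii[of a x] by auto

lemma integrable_inverse_square:
  assumes "a > 0"
  shows "integrable lborel (\<lambda>x::real. 1 / (x\<^sup>2 + a\<^sup>2))"
    and "(LINT x::real|lborel. 1 / (x\<^sup>2 + a\<^sup>2)) = pi / a"
proof -
  have 1: "((\<lambda>x. arctan (x / a) / a) has_real_derivative 1 / (x\<^sup>2 + a\<^sup>2)) (at x)" for x
  proof -
    have "((\<lambda>x. arctan (x / a) / a) has_real_derivative (1 / a) / (1 + (x / a)\<^sup>2) / a) (at x)"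
      using assms by (auto intro!: derivative_eq_intros simp: divide_inverse)
    moreover have "1 + (x / a)\<^sup>2 = (x\<^sup>2 + a\<^sup>2) / a\<^sup>2"
      using assms by (simp add: field_simps)
    ultimately show ?thesis
      using assms by (simp add: power2_eq_square)
  qed
  have 2: "((\<lambda>x. arctan (x / a) / a) \<longlongrightarrow> pi / (2 * a)) at_top"
  proof -
    have "LIM x at_top. inverse a * x :> at_top"
      using assms by (intro filterlim_tendsto_pos_mult_at_top[OF tendsto_const]) (auto intro: filterlim_ident)
    then have "LIM x at_top. x / a :> at_top"
      by (simp add: divide_inverse mult.commute)
    then have "((\<lambda>x. arctan (x / a)) \<longlongrightarrow> pi / 2) at_top"
      by (rule filterlim_compose[OF tendsto_arctan_at_top])
    from tendsto_divide[OF this tendsto_const[of a]] assms show ?thesis by simp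
  qed
  have 3: "((\<lambda>x. arctan (x / a) / a) \<longlongrightarrow> - pi / (2 * a)) at_bot"
  proof -
    have "((\<lambda>x. arctan ((- x) / a) / a) \<longlongrightarrow> - (pi / (2 * a))) at_top"
      using tendsto_minus[OF 2] by (simp add: arctan_minus)
    then show ?thesis
      by (subst filterlim_at_bot_mirror) simp
  qed
  have 4: "isCont (\<lambda>x. 1 / (x\<^sup>2 + a\<^sup>2)) x" for x
  proof -
    have "x\<^sup>2 + a\<^sup>2 \<noteq> 0" using assms by (simp add: add_nonneg_eq_0_iff)
    then show ?thesis by (intro continuous_intros) auto
  qed
  have 5: "AE x in lborel. -\<infinity> < ereal x \<longrightarrow> ereal x < \<infinity> \<longrightarrow> 0 \<le> 1 / (x\<^sup>2 + a\<^sup>2)"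
    by (intro always_eventually) auto
  have 6: "(((\<lambda>x. arctan (x / a) / a) \<circ> real_of_ereal) \<longlongrightarrow> - pi / (2 * a)) (at_right (-\<infinity>))"
    "(((\<lambda>x. arctan (x / a) / a) \<circ> real_of_ereal) \<longlongrightarrow> pi / (2 * a)) (at_left \<infinity>)"
    using 2 3 by (simp_all add: ereal_tendsto_simps)
  have "set_integrable lborel (einterval (-\<infinity>) \<infinity>) (\<lambda>x. 1 / (x\<^sup>2 + a\<^sup>2))"
    "(LBINT x=-\<infinity>..\<infinity>. 1 / (x\<^sup>2 + a\<^sup>2)) = pi / (2 * a) - (- pi / (2 * a))"
    using interval_integral_FTC_nonneg[OF _ 1 4 5 6] by auto
  then show "integrable lborel (\<lambda>x::real. 1 / (x\<^sup>2 + a\<^sup>2))"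
    "(LINT x::real|lborel. 1 / (x\<^sup>2 + a\<^sup>2)) = pi / a"
    by (simp_all add: set_integrable_def interval_lebesgue_integral_def set_lebesgue_integral_def)
qed

lemma norm_cauchy_ker_0: "norm (cauchy_ker a 0 x) = 1 / (x\<^sup>2 + a\<^sup>2)"
  by (simp add: cauchy_ker_def norm_divide norm_power norm_add_ii_square flip: power2_eq_square)

lemma measurable_cauchy_ker [measurable]: "cauchy_ker a j \<in> borel_measurable borel"
  unfolding cauchy_ker_def[abs_def] by measurable

definition ker_bound :: "real \<Rightarrow> real" where
  "ker_bound a = 1 / a\<^sup>2 + pi / a"

lemma bd_cauchy_ker_0:
  assumes "a > 0"
  shows "bd (cauchy_ker a 0) (ker_bound a)"
proof -
  have "integrable lborel (cauchy_ker a 0)"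
    using integrable_inverse_square(1)[OF assms]
    by (rule Bochner_Integration.integrable_bound) (auto simp: norm_cauchy_ker_0)
  moreover have "norm (cauchy_ker a 0 x) \<le> 1 / a\<^sup>2" for x
    using assms unfolding norm_cauchy_ker_0 by (intro frac_le) auto
  moreover have "nrm (cauchy_ker a 0) = pi / a"
    unfolding nrm_def norm_cauchy_ker_0 by (rule integrable_inverse_square(2)[OF assms])
  ultimately show ?thesis
    using assms unfolding bd_def ker_bound_def by (auto intro: add_increasing2)
qed

lemma bd_cauchy_ker:
  assumes "a > 0"
  shows "bd (cauchy_ker a j) ((1 / a) ^ j * ker_bound a)"
proof (rule bd_dominated[OF _ _ bd_cauchy_ker_0[OF assms]])
  show "norm (cauchy_ker a j x) \<le> (1 / a) ^ j * norm (cauchy_ker a 0 x)" for x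
  proof -
    have "norm (cauchy_ker a j x) = (1 / norm (of_real x + \<i> * of_real a)) ^ j * norm (cauchy_ker a 0 x)"
      by (simp add: cauchy_ker_def norm_divide norm_mult norm_power power_add power_one_over)
    also have "\<dots> \<le> (1 / a) ^ j * norm (cauchy_ker a 0 x)"
      using assms norm_add_ii[of a x] by (intro mult_right_mono power_mono frac_le) auto
    finally show ?thesis .
  qed
qed (use assms in auto)

text \<open>The shift \<open>r\<close> is complex: real \<open>r\<close> expands a translate,
  imaginary \<open>r\<close> a displacement of the pole.\<close>

definition taylor_term :: "real \<Rightarrow> nat \<Rightarrow> complex \<Rightarrow> nat \<Rightarrow> real \<Rightarrow> complex" where
  "taylor_term a k r j x = of_nat ((k + 1 + j) choose j) * r ^ j * cauchy_ker a (k + j) x"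

lemma taylor_sums:
  assumes "a > 0" "norm r < a"
  shows "(\<lambda>j. taylor_term a k r j x) sums (1 / (of_real x + \<i> * of_real a - r) ^ (k + 2))"
proof -
  define z where "z = of_real x + \<i> * of_real a"
  have z: "z \<noteq> 0" "norm r < norm z"
    using norm_add_ii[of a x] assms by (auto simp: z_def)
  have "(\<lambda>j. 1 / z ^ (k + 2) * (of_nat ((Suc k + j) choose j) * (r / z) ^ j)) sums
      (1 / z ^ (k + 2) * (1 / (1 - r / z) ^ Suc (Suc k)))"
    using z by (intro sums_mult binomial_series) (simp add: norm_divide)
  moreover have "1 / z ^ (k + 2) * (of_nat ((Suc k + j) choose j) * (r / z) ^ j) = taylor_term a k r j x" for j
    using z by (simp add: taylor_term_def cauchy_ker_def power_divide z_def[symmetric] power_add mult_ac)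
  moreover have "1 / z ^ (k + 2) * (1 / (1 - r / z) ^ Suc (Suc k)) = 1 / (z - r) ^ (k + 2)"
  proof -
    have "z ^ (k + 2) * (1 - r / z) ^ (k + 2) = (z - r) ^ (k + 2)"
      using z by (simp only: power_mult_distrib[symmetric]) (simp add: algebra_simps)
    then show ?thesis by (simp add: divide_simps)
  qed
  ultimately show ?thesis by (simp add: z_def)
qed

lemma bd_taylor_term:
  assumes "a > 0"
  shows "bd (taylor_term a k r j) (real ((k + 1 + j) choose j) * norm r ^ j * ((1 / a) ^ (k + j) * ker_bound a))"
  using bd_scale[OF bd_cauchy_ker[OF assms, of "k + j"], of "of_nat ((k + 1 + j) choose j) * r ^ j"]
  by (simp add: taylor_term_def[abs_def] norm_mult norm_power)

lemma summable_taylor_bound: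
  assumes "a > 0" "norm r < a"
  shows "summable (\<lambda>j. real ((k + 1 + j) choose j) * norm r ^ j * ((1 / a) ^ (k + j) * ker_bound a))"
proof -
  have "summable (\<lambda>j. real ((k + 1 + j) choose j) * (norm r / a) ^ j * ((1 / a) ^ k * ker_bound a))"
    using assms by (intro summable_mult2 binomial_series_summable) auto
  then show ?thesis by (simp add: power_divide power_add field_simps)
qed

lemma translate_cauchy_ker:
  "translate r (cauchy_ker a k) x = 1 / (of_real x + \<i> * of_real a - of_real r) ^ (k + 2)"
  by (simp add: translate_def cauchy_ker_def algebra_simps)

lemma translate_cauchy_ker_suminf:
  assumes "a > 0" "\<bar>r\<bar> < a"
  shows "translate r (cauchy_ker a k) = (\<lambda>x. \<Sum>j. taylor_term a k (of_real r) j x)"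
  using sums_unique[OF taylor_sums[OF assms(1), of "of_real r"]] assms(2)
  by (auto simp: translate_cauchy_ker fun_eq_iff)

text \<open>What matters is that the factor beside \<open>\<bar>r\<bar> ^ m\<close> depends only on
  \<open>g\<close> and \<open>m\<close>, so that it is uniform over all perturbations bounded by
  \<open>g\<close>.\<close>

lemma bd_translate_cauchy_ker_tail:
  assumes "\<bar>r\<bar> \<le> g" "0 < g" "g < 1"
  shows "bd (\<lambda>x. translate r (cauchy_ker 1 0) x - (\<Sum>i<m. taylor_term 1 0 (of_real r) i x))
    (\<bar>r\<bar> ^ m * (ker_bound 1 * (\<Sum>i. real (Suc (i + m)) * g ^ i)))"
proof -
  have r: "norm (complex_of_real r) < 1" using assms by simp
  let ?c = "\<lambda>j. real ((0 + 1 + j) choose j) * norm (complex_of_real r) ^ j * ((1 / 1) ^ (0 + j) * ker_bound 1)"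
  have "bd (\<lambda>x. translate r (cauchy_ker 1 0) x - (\<Sum>i<m. taylor_term 1 0 (of_real r) i x)) (\<Sum>i. ?c (i + m))"
    using assms bd_suminf_tail[OF bd_taylor_term[of 1 0 "of_real r"] summable_taylor_bound[OF _ r, of 0], of m]
    by (simp add: translate_cauchy_ker_suminf)
  moreover have "(\<Sum>i. ?c (i + m)) \<le> \<bar>r\<bar> ^ m * (ker_bound 1 * (\<Sum>i. real (Suc (i + m)) * g ^ i))"
  proof -
    have k: "0 \<le> ker_bound 1" by (simp add: ker_bound_def)
    have "summable (\<lambda>i. real ((1 + i) choose i) * g ^ i)"
      using assms by (intro binomial_series_summable) auto
    then have "summable (\<lambda>i. real (Suc i) * g ^ i + real m * g ^ i)"
      using assms by (intro summable_add summable_mult summable_geometric) auto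
    then have s: "summable (\<lambda>i. real (Suc (i + m)) * g ^ i)"
      by (simp add: algebra_simps)
    have "(\<Sum>i. ?c (i + m)) \<le> (\<Sum>i. \<bar>r\<bar> ^ m * (ker_bound 1 * (real (Suc (i + m)) * g ^ i)))"
    proof (intro suminf_le summable_mult s)
      show "summable (\<lambda>i. ?c (i + m))"
        using summable_taylor_bound[OF _ r, of 0] by (subst summable_iff_shift) simp
      show "?c (i + m) \<le> \<bar>r\<bar> ^ m * (ker_bound 1 * (real (Suc (i + m)) * g ^ i))" for i
      proof -
        have "?c (i + m) = \<bar>r\<bar> ^ m * (ker_bound 1 * (real (Suc (i + m)) * \<bar>r\<bar> ^ i))"
          by (simp add: power_add)
        also have "\<dots> \<le> \<bar>r\<bar> ^ m * (ker_bound 1 * (real (Suc (i + m)) * g ^ i))"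
          using assms k by (intro mult_left_mono power_mono) auto
        finally show ?thesis .
      qed
    qed
    also have "\<dots> = \<bar>r\<bar> ^ m * (ker_bound 1 * (\<Sum>i. real (Suc (i + m)) * g ^ i))"
      using s by (subst suminf_mult, intro summable_mult, assumption, subst suminf_mult) auto
    finally show ?thesis .
  qed
  ultimately show ?thesis by (rule bd_mono)
qed

section \<open>Exponentially small perturbations of the integers\<close>

locale perturbed_span = twisted_subspace S \<kappa> N
  for S :: "(real \<Rightarrow> complex) set" and \<kappa> :: real and N :: nat +
  fixes r :: "int \<Rightarrow> real" and \<gamma> :: real
  assumes gamma: "0 < \<gamma>" "\<gamma> < 1"
    and N: "4 * \<gamma> ^ N < (1 - \<gamma> ^ N)\<^sup>2"
    and r: "\<And>n. 0 < \<bar>r n\<bar> \<and> \<bar>r n\<bar> \<le> \<gamma> ^ nat \<bar>n\<bar>"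
    and dst_generator: "\<And>n. dst (translate (of_int n + r n) (flat 0 0 (cauchy_ker 1 0))) = 0"
begin

lemma bd_flat_ker: "bd (flat 0 l (cauchy_ker 1 j)) (flat_bound 0 l * ker_bound 1)"
  using bd_flat[OF bd_cauchy_ker[of 1 j]] by simp

text \<open>In the expansion of the translate by \<open>n + r n\<close> the sum has distance 0 by
  \<open>dst_generator\<close> and the terms below \<open>j\<close> have distance 0 by hypothesis,
  so term \<open>j\<close> is as close to \<open>S\<close> as the remainder, of order
  \<open>\<bar>r n\<bar> ^ Suc j\<close>. Dividing by the coefficient, which is nonzero because
  \<open>r n \<noteq> 0\<close>, leaves one power of \<open>\<bar>r n\<bar>\<close>.\<close>

lemma dst_flat_decay:
  assumes IH: "\<And>i. i < j \<Longrightarrow> null_orbit (flat 0 0 (cauchy_ker 1 i))"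
  shows "\<exists>C. \<forall>n. dst (translate (of_int n) (flat 0 0 (cauchy_ker 1 j))) \<le> C * \<gamma> ^ nat \<bar>n\<bar>"
proof -
  define B where "B = flat_bound 0 0 * (ker_bound 1 * (\<Sum>i. real (Suc (i + Suc j)) * \<gamma> ^ i))"
  define C where "C = max B (flat_bound 0 0 * ker_bound 1)"
  have "dst (translate (of_int n) (flat 0 0 (cauchy_ker 1 j))) \<le> C * \<gamma> ^ nat \<bar>n\<bar>" for n
  \<comment> \<open>For \<open>n = 0\<close> the hypothesis allows
    \<open>\<bar>r 0\<bar> = 1\<close>, the radius of convergence of the expansion. There the norm
    itself is used as the bound, which explains the maximum in \<open>C\<close>.\<close>
  proof (cases "n = 0")
    case True
    then show ?thesis
      using order_trans[OF dst_le_nrm bd_nrm[OF bd_flat_ker[of 0 j]]] by (simp add: C_def)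
  next
    case False
    define \<rho> where "\<rho> = r n"
    let ?\<tau> = "translate (of_int n)" and ?V = "flat 0 0"
    have "\<gamma> ^ nat \<bar>n\<bar> \<le> \<gamma> ^ 1"
      using gamma False by (intro power_decreasing) auto
    then have rho: "0 < \<bar>\<rho>\<bar>" "\<bar>\<rho>\<bar> \<le> \<gamma>" "\<bar>\<rho>\<bar> \<le> \<gamma> ^ nat \<bar>n\<bar>"
      using r[of n] by (auto simp: \<rho>_def)
    let ?T = "\<lambda>i. taylor_term 1 0 (of_real \<rho>) i"
    define R where "R = (\<lambda>x. translate \<rho> (cauchy_ker 1 0) x - (\<Sum>i<Suc j. ?T i x))"
    have R: "bd R (\<bar>\<rho>\<bar> ^ Suc j * (ker_bound 1 * (\<Sum>i. real (Suc (i + Suc j)) * \<gamma> ^ i)))"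
      unfolding R_def by (rule bd_translate_cauchy_ker_tail[OF rho(2) gamma])
    have VR: "bd (?\<tau> (?V R)) (\<bar>\<rho>\<bar> ^ Suc j * B)"
      using bd_translate[OF bd_flat[OF R, of 0 0], of "of_int n"] by (simp add: B_def mult_ac)
    have T: "bd (?T i) (real (Suc i) * \<bar>\<rho>\<bar> ^ i * ker_bound 1)" for i
      using bd_taylor_term[of 1 0 "of_real \<rho>" i] by simp
    have VT: "?V (?T i) x = of_real (real (Suc i) * \<rho> ^ i) * ?V (cauchy_ker 1 i) x" for i x
      using flat_scale[OF bd_cauchy_ker, of 1 0 0 "of_real (real (Suc i) * \<rho> ^ i)" i x]
      by (simp add: taylor_term_def[abs_def])
    let ?c = "real (Suc j) * \<rho> ^ j"
    let ?P = "\<lambda>x. \<Sum>i<j. of_real (real (Suc i) * \<rho> ^ i) * ?\<tau> (?V (cauchy_ker 1 i)) x"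
    have split: "?\<tau> (translate \<rho> (?V (cauchy_ker 1 0))) x =
        ?P x + of_real ?c * ?\<tau> (?V (cauchy_ker 1 j)) x + ?\<tau> (?V R) x" for x
    proof -
      have "translate \<rho> (cauchy_ker 1 0) = (\<lambda>x. (\<Sum>i<Suc j. ?T i x) + R x)"
        by (simp add: R_def)
      then have "translate \<rho> (?V (cauchy_ker 1 0)) y = (\<Sum>i<Suc j. ?V (?T i) y) + ?V R y" for y
        unfolding flat_translate[symmetric]
        using flat_add[OF bd_sum[of "{..<Suc j}", OF T] R] flat_sum[of "{..<Suc j}", OF _ T] by simp
      then show ?thesis
        by (simp add: VT translate_def)
    qed
    have intV: "integrable lborel (?\<tau> (?V (cauchy_ker 1 i)))" for i
      using bd_integrable[OF bd_flat_ker[of 0 i]] by auto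
    have P: "dst ?P = 0" "integrable lborel ?P"
    proof -
      have "dst ?P \<le> (\<Sum>i<j. dst (\<lambda>x. of_real (real (Suc i) * \<rho> ^ i) * ?\<tau> (?V (cauchy_ker 1 i)) x))"
        using intV by (intro dst_sum_le) auto
      also have "\<dots> \<le> (\<Sum>i<j. \<bar>real (Suc i) * \<rho> ^ i\<bar> * dst (?\<tau> (?V (cauchy_ker 1 i))))"
        by (intro sum_mono dst_scale_le)
      also have "\<dots> = 0" using IH by (simp add: null_orbit_def)
      finally show "dst ?P = 0" using dst_nonneg[of ?P] by simp
      show "integrable lborel ?P" using intV by auto
    qed
    let ?G = "translate (of_int n + \<rho>) (?V (cauchy_ker 1 0))"
    have G: "dst ?G = 0" "integrable lborel ?G"
      using dst_generator[of n] bd_integrable[OF bd_flat_ker[of 0 0]] by (auto simp: \<rho>_def)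
    have eq: "?\<tau> (?V (cauchy_ker 1 j)) = (\<lambda>x. of_real (1 / ?c) * ((?G x - ?P x) - ?\<tau> (?V R) x))"
    proof
      fix x
      have "?c \<noteq> 0" using rho by simp
      then show "?\<tau> (?V (cauchy_ker 1 j)) x = of_real (1 / ?c) * ((?G x - ?P x) - ?\<tau> (?V R) x)"
        using split[of x] unfolding translate_translate
        by (simp only: of_real_divide of_real_1) (simp add: field_simps del: of_nat_Suc)
    qed
    have "dst (?\<tau> (?V (cauchy_ker 1 j))) = dst (\<lambda>x. of_real (1 / ?c) * ((?G x - ?P x) - ?\<tau> (?V R) x))"
      by (rule arg_cong[OF eq])
    also have "\<dots> \<le> \<bar>1 / ?c\<bar> * dst (\<lambda>x. (?G x - ?P x) - ?\<tau> (?V R) x)"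
      by (rule dst_scale_le)
    also have "\<dots> \<le> \<bar>1 / ?c\<bar> * (\<bar>\<rho>\<bar> ^ Suc j * B)"
    proof (intro mult_left_mono)
      have "dst (\<lambda>x. (?G x - ?P x) - ?\<tau> (?V R) x) \<le> dst (\<lambda>x. ?G x - ?P x) + dst (?\<tau> (?V R))"
        using G P bd_integrable[OF VR] by (intro dst_diff_le) auto
      also have "dst (\<lambda>x. ?G x - ?P x) \<le> 0"
        using dst_diff_le[OF G(2) P(2)] G P by simp
      also have "dst (?\<tau> (?V R)) \<le> \<bar>\<rho>\<bar> ^ Suc j * B"
        by (rule order_trans[OF dst_le_nrm bd_nrm[OF VR]])
      finally show "dst (\<lambda>x. (?G x - ?P x) - ?\<tau> (?V R) x) \<le> \<bar>\<rho>\<bar> ^ Suc j * B" by simp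
    qed simp
    also have "\<dots> = \<bar>\<rho>\<bar> / real (Suc j) * B"
      using rho by (simp add: abs_mult power_abs field_simps del: of_nat_Suc)
    also have "\<dots> \<le> \<gamma> ^ nat \<bar>n\<bar> * B"
    proof (intro mult_right_mono)
      have "\<bar>\<rho>\<bar> / real (Suc j) \<le> \<bar>\<rho>\<bar> / 1" by (intro divide_left_mono) auto
      then show "\<bar>\<rho>\<bar> / real (Suc j) \<le> \<gamma> ^ nat \<bar>n\<bar>" using rho by simp
      have "0 \<le> \<bar>\<rho>\<bar> ^ Suc j * B" using VR by (rule bd_nonneg)
      moreover have "0 < \<bar>\<rho>\<bar> ^ Suc j" using rho by (intro zero_less_power)
      ultimately show "0 \<le> B" by (simp only: zero_le_mult_iff) linarith
    qed
    also have "\<dots> \<le> C * \<gamma> ^ nat \<bar>n\<bar>"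
      using gamma by (subst mult.commute, intro mult_right_mono) (auto simp: C_def)
    finally show ?thesis .
  qed
  then show ?thesis by blast
qed

lemma null_orbit_flat: "null_orbit (flat 0 0 (cauchy_ker 1 j))"
proof (induction j rule: less_induct)
  case (less j)
  then obtain C where C: "\<And>n. dst (translate (of_int n) (flat 0 0 (cauchy_ker 1 j))) \<le> C * \<gamma> ^ nat \<bar>n\<bar>"
    using dst_flat_decay[of j] by blast
  have C0: "0 \<le> C" using order_trans[OF dst_nonneg C[of 0]] by simp
  have k0: "\<kappa> \<noteq> 0" and kk: "\<bar>\<kappa> powi n\<bar> = 1" for n
    using abs_kappa by (auto simp: power_int_abs)
  show ?case
    unfolding null_orbit_def
  proof
    fix m :: int
    \<comment> \<open>The weight \<open>\<kappa> powi n\<close> turns \<open>tdiff\<close> into the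
      plain difference in \<open>n\<close>. Level \<open>k\<close> is the \<open>k\<close>-fold
      quotient by \<open>tdiff\<close> up to sign, and consecutive \<open>n\<close> are
      \<open>N\<close> apart on the integer orbit.\<close>
    define x where "x k n t = of_real (\<kappa> powi n) * translate (of_int m + of_int n * real N) (flat 0 k (cauchy_ker 1 j)) t"
      for k :: nat and n :: int and t :: real
    have bx: "bd (x k n) (flat_bound 0 k * ker_bound 1)" for k n
      using bd_scale[OF bd_translate[OF bd_flat_ker[of k j], of "of_int m + of_int n * real N"], of "of_real (\<kappa> powi n)"] kk[of n]
      unfolding x_def[abs_def] norm_of_real by simp
    have "dst (x 0 0) = 0"
    proof (rule dst_infinite_difference[where x = x and g = "\<gamma> ^ N" and M = "\<lambda>k. flat_bound 0 k * ker_bound 1"])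
      show "integrable lborel (x k n)" for k n by (rule bd_integrable[OF bx])
      show "dst (x k n) \<le> flat_bound 0 k * ker_bound 1" for k n
        by (rule order_trans[OF dst_le_nrm bd_nrm[OF bx]])
      have "N \<noteq> 0" using N by (intro notI) simp
      then show "0 < \<gamma> ^ N" "\<gamma> ^ N < 1" using gamma by (simp_all add: power_Suc_less_one power_strict_decreasing[of 0 N \<gamma>, simplified])
      show "4 * \<gamma> ^ N < (1 - \<gamma> ^ N)\<^sup>2" by (rule N)
      show "x k n t = x (Suc k) (n + 1) t - x (Suc k) n t" for k n t
      proof -
        define y where "y = t - (of_int m + of_int n * real N)"
        have "flat 0 k (cauchy_ker 1 j) y = of_real \<kappa> * flat 0 (Suc k) (cauchy_ker 1 j) (y - real N) - flat 0 (Suc k) (cauchy_ker 1 j) y"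
          using fun_cong[OF tdiff_flat_Suc[OF bd_cauchy_ker[of 1 j], of 0 k], of y]
          by (simp add: tdiff_def algebra_simps)
        then show ?thesis
          using k0 unfolding x_def translate_def
          by (simp add: y_def[symmetric] power_int_add_1 distrib_right diff_diff_eq[symmetric])
            (simp add: y_def algebra_simps, metis distrib_left mult.left_commute)
      qed
      \<comment> \<open>Along the progression \<open>m + n * N\<close> the decay rate per step is
        \<open>\<gamma> ^ N\<close>. The offset \<open>m\<close> costs the constant
        \<open>(1 / \<gamma>) ^ nat \<bar>m\<bar>\<close>, since \<open>\<bar>m + n * N\<bar> \<ge>
        N * \<bar>n\<bar> - \<bar>m\<bar>\<close>.\<close>
      show "dst (x 0 n) \<le> C * (1 / \<gamma>) ^ nat \<bar>m\<bar> * (\<gamma> ^ N) ^ nat \<bar>n\<bar>" for n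
      proof -
        have "dst (x 0 n) \<le> \<bar>\<kappa> powi n\<bar> * dst (translate (of_int (m + n * int N)) (flat 0 0 (cauchy_ker 1 j)))"
          unfolding x_def[abs_def] using dst_scale_le[of "\<kappa> powi n"] by simp
        also have "\<dots> \<le> C * \<gamma> ^ nat \<bar>m + n * int N\<bar>"
          using C[of "m + n * int N"] kk by simp
        also have "\<dots> \<le> C * ((1 / \<gamma>) ^ nat \<bar>m\<bar> * (\<gamma> ^ N) ^ nat \<bar>n\<bar>)"
        proof (intro mult_left_mono C0)
          have "\<gamma> ^ (nat \<bar>m\<bar> + nat \<bar>m + n * int N\<bar>) \<le> \<gamma> ^ (N * nat \<bar>n\<bar>)"
          proof (intro power_decreasing)
            have "\<bar>n * int N\<bar> \<le> \<bar>m\<bar> + \<bar>m + n * int N\<bar>" by linarith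
            then have "int (N * nat \<bar>n\<bar>) \<le> int (nat \<bar>m\<bar> + nat \<bar>m + n * int N\<bar>)"
              by (simp add: abs_mult mult.commute)
            then show "N * nat \<bar>n\<bar> \<le> nat \<bar>m\<bar> + nat \<bar>m + n * int N\<bar>"
              by (simp only: of_nat_le_iff)
          qed (use gamma in auto)
          then show "\<gamma> ^ nat \<bar>m + n * int N\<bar> \<le> (1 / \<gamma>) ^ nat \<bar>m\<bar> * (\<gamma> ^ N) ^ nat \<bar>n\<bar>"
            using gamma by (simp add: power_add power_mult power_divide field_simps)
        qed
        finally show ?thesis by (simp add: mult_ac)
      qed
    qed
    then show "dst (translate (of_int m) (flat 0 0 (cauchy_ker 1 j))) = 0"
      by (simp add: x_def[abs_def])
  qed
qed

lemma null_orbit_tdiff_ker: "null_orbit (tdiff (cauchy_ker 1 j))"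
  using null_orbit_tdiff_of_flat[OF bd_cauchy_ker[of 1 j] null_orbit_flat] by simp

end

context real_subspace
begin

text \<open>The expansion in the translation parameter converges only up to 1, the distance of the
  pole from the real line. Hence \<open>x\<close> is reached in \<open>n\<close> steps of length
  \<open>\<bar>x\<bar> / n < 1\<close>, and each step needs all \<open>j\<close> at once because the
  expansion of one kernel involves all higher ones.\<close>

lemma dst_translate_cauchy_ker:
  assumes "\<And>j. dst (cauchy_ker 1 j) = 0"
  shows "dst (translate x (cauchy_ker 1 j)) = 0"
proof -
  have step: "dst (translate (y + r) (cauchy_ker 1 j)) = 0"
    if "\<And>j. dst (translate y (cauchy_ker 1 j)) = 0" "\<bar>r\<bar> < 1" for y r j
  proof -
    have r: "norm (complex_of_real r) < 1" using that by simp
    have "translate (y + r) (cauchy_ker 1 j) = translate y (\<lambda>x. \<Sum>i. taylor_term 1 j (of_real r) i x)"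
      using translate_cauchy_ker_suminf[of 1 r j] that by (simp add: translate_translate flip: translate_translate)
    also have "\<dots> = (\<lambda>x. \<Sum>i. translate y (taylor_term 1 j (of_real r) i) x)"
      by (simp add: translate_def)
    finally have eq: "translate (y + r) (cauchy_ker 1 j) = (\<lambda>x. \<Sum>i. translate y (taylor_term 1 j (of_real r) i) x)" .
    show ?thesis
      unfolding eq
    proof (rule dst_suminf[OF bd_translate[OF bd_taylor_term] summable_taylor_bound[OF _ r]])
      fix i
      let ?c = "real ((j + 1 + i) choose i) * r ^ i"
      have "translate y (taylor_term 1 j (of_real r) i) = (\<lambda>x. of_real ?c * translate y (cauchy_ker 1 (j + i)) x)"
        by (simp add: translate_def taylor_term_def)
      then have "dst (translate y (taylor_term 1 j (of_real r) i)) \<le> \<bar>?c\<bar> * dst (translate y (cauchy_ker 1 (j + i)))"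
        using dst_scale_le[of ?c] by metis
      then show "dst (translate y (taylor_term 1 j (of_real r) i)) = 0"
        using that(1)[of "j + i"] dst_nonneg[of "translate y (taylor_term 1 j (of_real r) i)"] by simp
    qed auto
  qed
  obtain n :: nat where n: "\<bar>x\<bar> < n" using reals_Archimedean2 by blast
  have "dst (translate (real k * (x / n)) (cauchy_ker 1 j)) = 0" for k j
  proof (induction k arbitrary: j)
    case (Suc k)
    have "\<bar>x / n\<bar> < 1" using n by (simp add: field_simps)
    from step[OF Suc this] show ?case by (simp add: algebra_simps add_divide_distrib)
  qed (simp add: assms)
  from this[of n] show ?thesis using n by simp
qed

end

section \<open>Continuity of translations and convolutions\<close>

text \<open>Fubini's theorem together with Minkowski's integral inequality; all estimates of
  convolutions below rest on it.\<close>

lemma nrm_integral_le: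
  fixes K :: "real \<Rightarrow> real \<Rightarrow> complex"
  assumes meas: "(\<lambda>(x, y). K x y) \<in> borel_measurable (borel \<Otimes>\<^sub>M borel)"
    and int: "\<And>y. integrable lborel (\<lambda>x. K x y)"
    and int2: "integrable lborel (\<lambda>y. nrm (\<lambda>x. K x y))"
  shows "integrable lborel (\<lambda>x. LINT y|lborel. K x y)"
    and "nrm (\<lambda>x. LINT y|lborel. K x y) \<le> (LINT y|lborel. nrm (\<lambda>x. K x y))"
    and "(LINT x|lborel. LINT y|lborel. K x y) = (LINT y|lborel. LINT x|lborel. K x y)"
proof -
  let ?f = "\<lambda>y x. K x y"
  have m: "(\<lambda>(y, x). K x y) \<in> borel_measurable (lborel \<Otimes>\<^sub>M lborel)"
    using measurable_compose[OF measurable_Pair[OF measurable_snd measurable_fst] meas]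
    by (simp add: case_prod_unfold cong: measurable_cong_sets sets_pair_measure_cong)
  have I: "integrable (lborel \<Otimes>\<^sub>M lborel) (\<lambda>(y, x). K x y)"
    using int int2 by (intro lborel_pair.Fubini_integrable m) (auto simp: nrm_def)
  show 1: "integrable lborel (\<lambda>x. LINT y|lborel. K x y)"
    using lborel_pair.integrable_snd[OF I] .
  have N: "integrable (lborel \<Otimes>\<^sub>M lborel) (\<lambda>(y, x). norm (K x y))"
    using integrable_norm[OF I] by (simp add: case_prod_unfold)
  have "nrm (\<lambda>x. LINT y|lborel. K x y) \<le> (LINT x|lborel. LINT y|lborel. norm (K x y))"
    unfolding nrm_def using 1 lborel_pair.integrable_snd[OF N]
    by (intro integral_mono) auto
  also have "\<dots> = (LINT y|lborel. LINT x|lborel. norm (K x y))"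
    using lborel_pair.integral_fst[OF N] lborel_pair.integral_snd[OF N] by simp
  finally show "nrm (\<lambda>x. LINT y|lborel. K x y) \<le> (LINT y|lborel. nrm (\<lambda>x. K x y))"
    by (simp add: nrm_def)
  show "(LINT x|lborel. LINT y|lborel. K x y) = (LINT y|lborel. LINT x|lborel. K x y)"
    using lborel_pair.integral_fst[OF I] lborel_pair.integral_snd[OF I] by simp
qed

lemma nrm_dominated_limit:
  assumes "\<And>x. (\<lambda>i. s i x) \<longlonglongrightarrow> F x" "\<And>i x. norm (s i x) \<le> 2 * norm (F x)"
    "integrable lborel F" "\<And>i::nat. integrable lborel (s i)"
  shows "(\<lambda>i. nrm (\<lambda>x. F x - s i x)) \<longlonglongrightarrow> 0"
proof -
  have "(\<lambda>i. LINT x|lborel. norm (F x - s i x)) \<longlonglongrightarrow> (LINT x|(lborel::real measure). 0)"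
  proof (rule integral_dominated_convergence[where w = "\<lambda>x. 3 * norm (F x)"])
    show "AE x in lborel. (\<lambda>i. norm (F x - s i x)) \<longlonglongrightarrow> 0"
    proof (intro always_eventually allI)
      fix x
      have "(\<lambda>i. norm (F x - s i x)) \<longlonglongrightarrow> norm (F x - F x)" by (intro tendsto_intros assms)
      then show "(\<lambda>i. norm (F x - s i x)) \<longlonglongrightarrow> 0" by simp
    qed
    show "AE x in lborel. norm (norm (F x - s i x)) \<le> 3 * norm (F x)" for i
    proof (intro always_eventually allI)
      fix x show "norm (norm (F x - s i x)) \<le> 3 * norm (F x)"
        using norm_triangle_ineq4[of "F x" "s i x"] assms(2)[of i x] by simp
    qed
  qed (use assms in auto)
  then show ?thesis by (simp add: nrm_def)
qed

definition L1_continuous :: "(real \<Rightarrow> complex) \<Rightarrow> bool" where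
  "L1_continuous F \<longleftrightarrow> ((\<lambda>t. nrm (\<lambda>x. translate t F x - F x)) \<longlongrightarrow> 0) (at 0)"

lemma L1_continuousI:
  assumes "\<And>e. e > 0 \<Longrightarrow> \<exists>d>0. \<forall>t. \<bar>t\<bar> < d \<longrightarrow> nrm (\<lambda>x. translate t F x - F x) \<le> e"
  shows "L1_continuous F"
  unfolding L1_continuous_def
proof (rule LIM_I)
  fix e :: real assume "0 < e"
  then obtain d where "d > 0" "\<forall>t. \<bar>t\<bar> < d \<longrightarrow> nrm (\<lambda>x. translate t F x - F x) \<le> e / 2"
    using assms[of "e/2"] by auto
  moreover have "x < e" if "x \<le> e / 2" for x :: real using that \<open>0 < e\<close> by simp
  ultimately show "\<exists>s>0. \<forall>x. x \<noteq> 0 \<and> norm (x - 0) < s \<longrightarrow> norm (nrm (\<lambda>xa. translate x F xa - F xa) - 0) < e"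
    by (intro exI[of _ d]) (auto simp: nrm_nonneg)
qed

lemma L1_continuousD:
  assumes "L1_continuous F" "e > 0"
  obtains d where "d > 0" "\<And>t. \<bar>t\<bar> < d \<Longrightarrow> nrm (\<lambda>x. translate t F x - F x) < e"
proof -
  obtain d where d: "d > 0" "\<And>t. t \<noteq> 0 \<and> \<bar>t\<bar> < d \<Longrightarrow> nrm (\<lambda>x. translate t F x - F x) < e"
    using LIM_D[OF assms(1)[unfolded L1_continuous_def] assms(2)] by (auto simp: nrm_nonneg)
  show ?thesis
  proof (rule that[OF d(1)])
    fix t :: real assume "\<bar>t\<bar> < d"
    with d(2)[of t] assms(2) show "nrm (\<lambda>x. translate t F x - F x) < e"
      by (cases "t = 0") auto
  qed
qed

lemma L1_continuous_closed:
  assumes F: "integrable lborel F" and G: "\<And>i::nat. integrable lborel (G i)" "\<And>i. L1_continuous (G i)"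
    and lim: "(\<lambda>i. nrm (\<lambda>x. F x - G i x)) \<longlonglongrightarrow> 0"
  shows "L1_continuous F"
proof (rule L1_continuousI)
  fix e :: real assume e: "e > 0"
  obtain i where i: "nrm (\<lambda>x. F x - G i x) < e / 3"
    using LIMSEQ_D[OF lim, of "e/3"] e by (auto simp: nrm_nonneg)
  obtain d where d: "d > 0" "\<And>t. \<bar>t\<bar> < d \<Longrightarrow> nrm (\<lambda>x. translate t (G i) x - G i x) < e / 3"
    using L1_continuousD[OF G(2)[of i], of "e/3"] e by auto
  show "\<exists>d>0. \<forall>t. \<bar>t\<bar> < d \<longrightarrow> nrm (\<lambda>x. translate t F x - F x) \<le> e"
  proof (intro exI[of _ d] conjI allI impI d(1))
    fix t :: real assume t: "\<bar>t\<bar> < d"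
    let ?D = "\<lambda>x. F x - G i x"
    have D: "integrable lborel ?D" using F G by auto
    have "nrm (\<lambda>x. translate t F x - F x) = nrm (\<lambda>x. (translate t ?D x - ?D x) + (translate t (G i) x - G i x))"
      by (simp add: translate_def)
    also have "\<dots> \<le> nrm (\<lambda>x. translate t ?D x - ?D x) + nrm (\<lambda>x. translate t (G i) x - G i x)"
      using D F G by (intro nrm_add_le Bochner_Integration.integrable_diff integrable_translate) auto
    also have "nrm (\<lambda>x. translate t ?D x - ?D x) \<le> nrm (translate t ?D) + nrm ?D"
      using D by (intro nrm_diff_le integrable_translate) auto
    finally show "nrm (\<lambda>x. translate t F x - F x) \<le> e"
      using i d(2)[OF t] by (simp add: nrm_translate)
  qed
qed

text \<open>By regularity \<open>A\<close> lies between a compact \<open>T\<close> and an open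
  \<open>U\<close> with small differences. Translates of \<open>T\<close> by less than the distance
  \<open>d\<close> stay in \<open>U\<close>, so the indicators of \<open>A\<close> and of its
  translate can differ only on \<open>A - T\<close>, \<open>U - A\<close> and their
  translates.\<close>

lemma L1_continuous_indicator:
  assumes A: "A \<in> sets borel" "A \<subseteq> {-b..b::real}"
  shows "L1_continuous (\<lambda>x. indicator A x *\<^sub>R c)"
proof (rule L1_continuousI)
  fix e :: real assume e: "e > 0"
  \<comment> \<open>Four exceptional sets of measure at most \<open>\<eta>\<close> contribute; the
    \<open>+ 1\<close> covers \<open>c = 0\<close>.\<close>
  define \<eta> where "\<eta> = e / (4 * (norm c + 1))"
  have eta: "\<eta> > 0" using e unfolding \<eta>_def by (intro divide_pos_pos mult_pos_pos add_nonneg_pos) auto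
  obtain U where U: "open U" "A \<subseteq> U" "emeasure lborel (U - A) < ennreal \<eta>"
    using outer_regular_lborel[of A \<eta>] A eta by auto
  obtain T where T: "closed T" "T \<subseteq> A" "emeasure lebesgue (A - T) < ennreal \<eta>"
    by (rule sets_lebesgue_inner_closed[OF _ eta, of A]) (use A in simp)
  have Tb: "T \<in> sets borel" "U \<in> sets borel" using T U by auto
  have "compact T" using T A bounded_subset[of "{-b..b}" T] by (auto simp: compact_eq_bounded_closed)
  then obtain d where d: "d > 0" "(\<Union>x\<in>T. ball x d) \<subseteq> U"
    using compact_subset_open_imp_ball_epsilon_subset[of T U] T U by auto
  let ?p = "\<lambda>x. indicator (A - T) x + indicator (U - A) x :: real"
  have mT: "emeasure lborel (A - T) < ennreal \<eta>"
    using T A Tb by (simp add: emeasure_completion)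
  have ip: "integrable lborel (\<lambda>x. indicator (A - T) x :: real)" "integrable lborel (\<lambda>x. indicator (U - A) x :: real)"
    using A Tb U mT by (auto intro!: integrable_real_indicator simp: less_top[symmetric] intro: order_less_trans)
  have p: "integrable lborel ?p" using ip by auto
  have "(LINT x|lborel. ?p x) \<le> 2 * \<eta>"
  proof -
    have "measure lborel (A - T) \<le> \<eta>" "measure lborel (U - A) \<le> \<eta>"
      using mT U eta by (auto simp: measure_def intro!: enn2real_leI)
    then show ?thesis using ip by simp
  qed
  moreover have "integrable lborel (\<lambda>x. ?p (x - t))" "(LINT x|lborel. ?p (x - t)) = (LINT x|lborel. ?p x)" for t
    using lborel_integrable_real_affine[OF p, of 1 "-t"] lborel_integral_real_affine[of 1 ?p "-t"] by simp_all
  ultimately have pt: "integrable lborel (\<lambda>x. ?p (x - t) + ?p x)" "(LINT x|lborel. ?p (x - t) + ?p x) \<le> 4 * \<eta>" for t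
    using p by (auto intro: order_trans simp del: integral_indicator)
  show "\<exists>d>0. \<forall>t. \<bar>t\<bar> < d \<longrightarrow> nrm (\<lambda>x. translate t (\<lambda>x. indicator A x *\<^sub>R c) x - indicator A x *\<^sub>R c) \<le> e"
  proof (intro exI[of _ d] conjI allI impI d(1))
    fix t :: real assume t: "\<bar>t\<bar> < d"
    have TU: "x - t \<in> T \<Longrightarrow> x \<in> U" "x \<in> T \<Longrightarrow> x - t \<in> U" for x
      using d(2) t by (force simp: dist_real_def ball_def)+
    have le: "norm (translate t (\<lambda>x. indicator A x *\<^sub>R c) x - indicator A x *\<^sub>R c) \<le> norm c * (?p (x - t) + ?p x)" for x
      using TU[of x] T U by (auto simp: translate_def indicator_def)
    have "nrm (\<lambda>x. translate t (\<lambda>x. indicator A x *\<^sub>R c) x - indicator A x *\<^sub>R c) \<le> (LINT x|lborel. norm c * (?p (x - t) + ?p x))"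
      unfolding nrm_def
    proof (rule integral_mono[OF _ _ le])
      show "integrable lborel (\<lambda>x. norm c * (?p (x - t) + ?p x))" using pt(1) by (rule integrable_mult_right)
      then show "integrable lborel (\<lambda>x. norm (translate t (\<lambda>x. indicator A x *\<^sub>R c) x - indicator A x *\<^sub>R c))"
        by (rule Bochner_Integration.integrable_bound)
          (use A le in \<open>auto simp: translate_def intro!: borel_measurable_norm borel_measurable_diff\<close>)
    qed
    also have "\<dots> = norm c * (LINT x|lborel. ?p (x - t) + ?p x)" by (rule integral_mult_right_zero)
    also have "\<dots> \<le> norm c * (4 * \<eta>)" using pt(2) by (intro mult_left_mono) auto
    also have "\<dots> \<le> e"
      using e by (simp add: \<eta>_def field_simps add_pos_nonneg)
    finally show "nrm (\<lambda>x. translate t (\<lambda>x. indicator A x *\<^sub>R c) x - indicator A x *\<^sub>R c) \<le> e" .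
  qed
qed

lemma L1_continuous:
  assumes "integrable lborel F"
  shows "L1_continuous F"
  using assms
proof (induction F rule: integrable_induct)
  case (base A c)
  have i: "integrable lborel (\<lambda>x. indicator B x *\<^sub>R c)" if "B \<in> sets borel" "B \<subseteq> A" for B
    using base that by (intro integrable_scaleR_left integrable_real_indicator)
      (auto intro: le_less_trans[OF emeasure_mono])
  show ?case
  proof (rule L1_continuous_closed[OF i _ L1_continuous_indicator nrm_dominated_limit])
    show "integrable lborel (\<lambda>x. indicator (A \<inter> {-real n..real n}) x *\<^sub>R c)" for n
      using base by (intro i) auto
    show "integrable lborel (\<lambda>x. indicator (A \<inter> {-real n..real n}) x *\<^sub>R c)" for n
      using base by (intro i) auto
    show "(\<lambda>n. indicator (A \<inter> {-real n..real n}) x *\<^sub>R c) \<longlonglongrightarrow> indicator A x *\<^sub>R c" for x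
    proof (rule tendsto_eventually)
      obtain n0 :: nat where "\<bar>x\<bar> \<le> n0" using real_arch_simple by blast
      then show "\<forall>\<^sub>F n in sequentially. indicator (A \<inter> {-real n..real n}) x *\<^sub>R c = indicator A x *\<^sub>R c"
        by (intro eventually_sequentiallyI[of n0]) (auto simp: indicator_def)
    qed
    show "integrable lborel (\<lambda>x. indicator A x *\<^sub>R c)"
      using base by (intro i) auto
    show "norm (indicator (A \<inter> {-real n..real n}) x *\<^sub>R c) \<le> 2 * norm (indicator A x *\<^sub>R c)" for n x
      by (simp add: indicator_def)
  qed (use base in auto)
next
  case (add f g)
  show ?case
  proof (rule L1_continuousI)
    fix e :: real assume e: "e > 0"
    obtain d where d: "d > 0" "\<And>t. \<bar>t\<bar> < d \<Longrightarrow> nrm (\<lambda>x. translate t f x - f x) < e / 2"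
      using L1_continuousD[OF add.IH(1), of "e/2"] e by auto
    obtain d' where d': "d' > 0" "\<And>t. \<bar>t\<bar> < d' \<Longrightarrow> nrm (\<lambda>x. translate t g x - g x) < e / 2"
      using L1_continuousD[OF add.IH(2), of "e/2"] e by auto
    have "nrm (\<lambda>x. translate t (\<lambda>x. f x + g x) x - (f x + g x)) \<le>
        nrm (\<lambda>x. translate t f x - f x) + nrm (\<lambda>x. translate t g x - g x)" for t
      using nrm_add_le[of "\<lambda>x. translate t f x - f x" "\<lambda>x. translate t g x - g x"]
        add.hyps integrable_translate[OF add.hyps(1), of t] integrable_translate[OF add.hyps(2), of t]
      by (simp add: translate_def algebra_simps)
    then show "\<exists>d>0. \<forall>t. \<bar>t\<bar> < d \<longrightarrow> nrm (\<lambda>x. translate t (\<lambda>x. f x + g x) x - (f x + g x)) \<le> e"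
      using d d' by (intro exI[of _ "min d d'"]) (fastforce intro: order_trans)
  qed
next
  case (lim f s)
  then show ?case
    by (intro L1_continuous_closed[OF _ _ _ nrm_dominated_limit[of s f]]) auto
qed

section \<open>Convolution with an integrable function\<close>

definition conv :: "(real \<Rightarrow> complex) \<Rightarrow> (real \<Rightarrow> complex) \<Rightarrow> real \<Rightarrow> complex" where
  "conv U k x = (LINT y|lborel. U y * k (x - y))"

lemma integrable_conv:
  fixes U k :: "real \<Rightarrow> complex"
  assumes U: "integrable lborel U" and k: "k \<in> borel_measurable borel" "\<And>x. norm (k x) \<le> C"
  shows "integrable lborel (\<lambda>y. U y * k (x - y))"
proof (rule Bochner_Integration.integrable_bound)
  show "integrable lborel (\<lambda>y. of_real C * U y)" using U by auto
  have [measurable]: "U \<in> borel_measurable borel" "k \<in> borel_measurable borel"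
    using borel_measurable_integrable[OF U] k by simp_all
  show "(\<lambda>y. U y * k (x - y)) \<in> borel_measurable lborel" by measurable
  have "norm (U y * k (x - y)) \<le> norm (of_real C * U y)" for y
    using mult_left_mono[OF k(2)[of "x - y"], of "norm (U y)"] order_trans[OF norm_ge_zero k(2)[of 0]]
    by (simp add: norm_mult mult.commute)
  then show "AE y in lborel. norm (U y * k (x - y)) \<le> norm (of_real C * U y)" by simp
qed

lemma bd_measurable: "bd k C \<Longrightarrow> k \<in> borel_measurable borel"
  using borel_measurable_integrable[OF bd_integrable] by simp

lemma bd_conv:
  assumes U: "integrable lborel U" and k: "bd k C"
  shows "bd (conv U k) (nrm U * C)"
proof -
  have [measurable]: "U \<in> borel_measurable borel" "k \<in> borel_measurable borel"
    using borel_measurable_integrable[OF U] bd_measurable[OF k] by simp_all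
  have m: "(\<lambda>(x, y). U y * k (x - y)) \<in> borel_measurable (borel \<Otimes>\<^sub>M borel)"
    by measurable
  have n: "nrm (\<lambda>x. U y * k (x - y)) = norm (U y) * nrm k" for y
    using nrm_scale[of "U y" "translate y k"] by (simp add: nrm_translate) (simp add: translate_def)
  have i: "integrable lborel (\<lambda>x. U y * k (x - y))" for y
    using integrable_translate[OF bd_integrable[OF k], of y] by (auto simp: translate_def)
  have i2: "integrable lborel (\<lambda>y. nrm (\<lambda>x. U y * k (x - y)))"
    unfolding n using U by auto
  note * = nrm_integral_le[OF m i i2]
  have "nrm (conv U k) \<le> (LINT y|lborel. norm (U y) * nrm k)"
    using *(2) unfolding n conv_def[abs_def] .
  also have "\<dots> = nrm U * nrm k"
    by (simp add: nrm_def)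
  also have "\<dots> \<le> nrm U * C"
    using bd_nrm[OF k] nrm_nonneg by (intro mult_left_mono) auto
  finally have 1: "nrm (conv U k) \<le> nrm U * C" .
  have "norm (conv U k x) \<le> nrm U * C" for x
  proof -
    have "norm (conv U k x) \<le> (LINT y|lborel. norm (U y * k (x - y)))"
      unfolding conv_def by (rule integral_norm_bound)
    also have "\<dots> \<le> (LINT y|lborel. norm (U y) * C)"
      using U integrable_norm[OF integrable_conv[OF U bd_measurable[OF k] bd_norm[OF k], of x]]
      by (intro integral_mono) (auto simp: norm_mult intro!: mult_left_mono bd_norm[OF k])
    also have "\<dots> = nrm U * C" by (simp add: nrm_def)
    finally show ?thesis .
  qed
  with 1 show ?thesis
    using *(1) by (simp add: bd_def conv_def[abs_def])
qed

lemma conv_scale_left: "conv (\<lambda>y. c * U y) k x = c * conv U k x"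
  by (simp add: conv_def mult.assoc)

lemma conv_scale_right: "conv U (\<lambda>x. c * k x) x = conv (\<lambda>y. c * U y) k x"
  by (simp add: conv_def mult_ac)

lemma conv_add_right:
  assumes "integrable lborel U" "k \<in> borel_measurable borel" "\<And>x. norm (k x) \<le> C"
    "l \<in> borel_measurable borel" "\<And>x. norm (l x) \<le> D"
  shows "conv U (\<lambda>x. k x + l x) x = conv U k x + conv U l x"
  unfolding conv_def distrib_left using assms
  by (intro Bochner_Integration.integral_add integrable_conv)

lemma conv_diff_right:
  assumes "integrable lborel U" "k \<in> borel_measurable borel" "\<And>x. norm (k x) \<le> C"
    "l \<in> borel_measurable borel" "\<And>x. norm (l x) \<le> D"
  shows "conv U (\<lambda>x. k x - l x) x = conv U k x - conv U l x"
  unfolding conv_def right_diff_distrib using assms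
  by (intro Bochner_Integration.integral_diff integrable_conv)

lemma conv_add_left:
  assumes "integrable lborel U" "integrable lborel V" "k \<in> borel_measurable borel" "\<And>x. norm (k x) \<le> C"
  shows "conv (\<lambda>y. U y + V y) k x = conv U k x + conv V k x"
  unfolding conv_def distrib_right using assms
  by (intro Bochner_Integration.integral_add integrable_conv)

lemma conv_cnj: "conv (\<lambda>y. cnj (U y)) k x = cnj (conv U (\<lambda>x. cnj (k x)) x)"
  unfolding conv_def by (subst Bochner_Integration.integral_cnj[symmetric]) simp

lemma conv_suminf:
  assumes U: "integrable lborel U" and b: "\<And>j::nat. bd (G j) (C j)" and s: "summable C"
  shows "conv U (\<lambda>x. \<Sum>j. G j x) x = (\<Sum>j. conv U (G j) x)"
proof -
  have i: "integrable lborel (\<lambda>y. U y * G j (x - y))" for j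
    by (rule integrable_conv[OF U bd_measurable[OF b] bd_norm[OF b]])
  have le: "norm (U y * G j (x - y)) \<le> norm (U y) * C j" for j y
    unfolding norm_mult by (intro mult_left_mono bd_norm[OF b]) simp
  have "(LINT y|lborel. (\<Sum>j. U y * G j (x - y))) = (\<Sum>j. LINT y|lborel. U y * G j (x - y))"
  proof (rule integral_suminf[OF i])
    show "AE y in lborel. summable (\<lambda>j. norm (U y * G j (x - y)))"
      using le by (intro always_eventually allI summable_comparison_test'[OF summable_mult[OF s]]) auto
    show "summable (\<lambda>j. LINT y|lborel. norm (U y * G j (x - y)))"
    proof (rule summable_comparison_test'[OF summable_mult[OF s, of "nrm U"]])
      fix j
      have "(LINT y|lborel. norm (U y * G j (x - y))) \<le> (LINT y|lborel. norm (U y) * C j)"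
        using U i le by (intro integral_mono) auto
      then show "norm (LINT y|lborel. norm (U y * G j (x - y))) \<le> nrm U * C j"
        by (simp add: nrm_def)
    qed
  qed
  moreover have "(\<Sum>j. U y * G j (x - y)) = U y * (\<Sum>j. G j (x - y))" for y
    by (rule suminf_mult[OF bd_suminf(2)[OF b s]])
  ultimately show ?thesis by (simp add: conv_def)
qed

text \<open>The convolution is approximated by Riemann sums with mesh \<open>1 / (n + 1)\<close> on \<open>[-n, n)\<close>.\<close>

lemma (in real_subspace) dst_conv_real:
  fixes g :: "real \<Rightarrow> real"
  assumes g: "integrable lborel g" and k: "bd k C" and z: "\<And>y. dst (translate y k) = 0"
  shows "dst (conv (\<lambda>y. of_real (g y)) k) = 0"
proof (rule dst_limit)
  define q where "q n y = \<lfloor>y * real (Suc n)\<rfloor>" for n y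
  define I where "I n = {- int (n * Suc n)..<int (n * Suc n)}" for n
  define K where "K n y x = (if q n y \<in> I n then of_real (g y) * translate (of_int (q n y) / real (Suc n)) k x else 0)"
    for n y x
  \<comment> \<open>The coefficient of a grid translate is the integral of \<open>g\<close> over its
    cell. It is real because \<open>g\<close> is, as \<open>dst\<close> tolerates only real
    multiples.\<close>
  define c where "c n m = (LINT y|lborel. g y * indicator {y. q n y = m} y)" for n m
  let ?G = "\<lambda>n x. \<Sum>m\<in>I n. of_real (c n m) * translate (of_int m / real (Suc n)) k x"
  let ?U = "\<lambda>y. complex_of_real (g y)"
  have U: "integrable lborel ?U" using g by auto
  have [measurable]: "g \<in> borel_measurable borel" "k \<in> borel_measurable borel"
    using borel_measurable_integrable[OF g] bd_measurable[OF k] by simp_all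
  have [measurable]: "q n \<in> measurable borel (count_space UNIV)" for n
    unfolding q_def by measurable
  have kt: "integrable lborel (translate y k)" for y
    using bd_integrable[OF k] by auto
  show "integrable lborel (conv ?U k)" by (rule bd_integrable[OF bd_conv[OF U k]])
  show iG: "integrable lborel (?G n)" for n using kt by auto
  show "dst (?G n) = 0" for n
  proof -
    have "dst (?G n) \<le> (\<Sum>m\<in>I n. dst (\<lambda>x. of_real (c n m) * translate (of_int m / real (Suc n)) k x))"
      using kt by (intro dst_sum_le) auto
    also have "\<dots> \<le> (\<Sum>m\<in>I n. \<bar>c n m\<bar> * dst (translate (of_int m / real (Suc n)) k))"
      by (intro sum_mono dst_scale_le)
    also have "\<dots> = 0" by (simp add: z)
    finally show ?thesis using dst_nonneg[of "?G n"] by simp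
  qed
  have G: "?G n x = (LINT y|lborel. K n y x)" for n x
  proof -
    have ig: "integrable lborel (\<lambda>y. g y * indicator {y. q n y = m} y)" for m
      using g by (intro integrable_mult_indicator[of _ _ g, simplified mult.commute[of "indicator _ _"] real_scaleR_def]) auto
    have "K n y x = (\<Sum>m\<in>I n. of_real (g y * indicator {y. q n y = m} y) * translate (of_int m / real (Suc n)) k x)" for y
    proof -
      have "(\<Sum>m\<in>I n. of_real (g y * indicator {y. q n y = m} y) * translate (of_int m / real (Suc n)) k x) =
        (\<Sum>m\<in>I n. if m = q n y then of_real (g y) * translate (of_int (q n y) / real (Suc n)) k x else 0)"
        by (intro sum.cong) (auto simp: indicator_def)
      also have "\<dots> = K n y x"
        by (simp add: K_def I_def)
      finally show ?thesis by simp
    qed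
    then have "(LINT y|lborel. K n y x) =
        (\<Sum>m\<in>I n. (LINT y|lborel. of_real (g y * indicator {y. q n y = m} y) * translate (of_int m / real (Suc n)) k x))"
      using ig by (simp only:) (intro Bochner_Integration.integral_sum integrable_mult_left integrable_of_real)
    also have "\<dots> = ?G n x"
      unfolding c_def by (simp only: integral_mult_left_zero integral_complex_of_real)
    finally show ?thesis by simp
  qed
  let ?D = "\<lambda>n x y. ?U y * k (x - y) - K n y x"
  \<comment> \<open>\<open>W n y\<close> is the L1-error made by rounding the single point
    \<open>y\<close>. It tends to 0 by continuity of translation and is dominated by twice the norm
    of \<open>g y\<close> times \<open>k\<close>, so its integral tends to 0; that integral bounds
    the error of the Riemann sum.\<close>
  define W where "W n y = nrm (\<lambda>x. ?D n x y)" for n y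
  have Kint: "integrable lborel (\<lambda>x. K n y x)" for n y
    using kt by (cases "q n y \<in> I n") (simp_all add: K_def del: of_nat_Suc)
  have kyint: "integrable lborel (\<lambda>x. ?U y * k (x - y))" for y
    using kt[of y] by (auto simp: translate_def)
  have Dint: "integrable lborel (\<lambda>x. ?D n x y)" for n y
    using kyint Kint by (rule Bochner_Integration.integrable_diff)
  have Dm [measurable]: "(\<lambda>(x, y). ?D n x y) \<in> borel_measurable (borel \<Otimes>\<^sub>M borel)" for n
    unfolding K_def translate_def by measurable
  have Wm [measurable]: "W n \<in> borel_measurable borel" for n
  proof -
    have "(\<lambda>(y, x). norm (?D n x y)) \<in> borel_measurable (borel \<Otimes>\<^sub>M lborel)"
      using measurable_compose[OF measurable_Pair[OF measurable_snd measurable_fst] Dm[of n]]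
      by (simp add: case_prod_unfold cong: measurable_cong_sets sets_pair_measure_cong)
    from lborel.borel_measurable_lebesgue_integral[OF this] show ?thesis
      by (simp add: W_def[abs_def] nrm_def)
  qed
  have nk: "nrm (\<lambda>x. ?U y * k (x - y)) = \<bar>g y\<bar> * nrm k" for y
    using nrm_scale[of "?U y" "translate y k"] by (simp add: nrm_translate) (simp add: translate_def)
  have Wle: "W n y \<le> 2 * (\<bar>g y\<bar> * nrm k)" for n y
  proof -
    have "W n y \<le> nrm (\<lambda>x. ?U y * k (x - y)) + nrm (\<lambda>x. K n y x)"
      unfolding W_def by (rule nrm_diff_le[OF kyint Kint])
    also have "nrm (\<lambda>x. K n y x) \<le> \<bar>g y\<bar> * nrm k"
      by (cases "q n y \<in> I n") (simp_all add: K_def nrm_scale nrm_translate nrm_nonneg)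
    finally show ?thesis by (simp add: nk mult.commute)
  qed
  have W0: "0 \<le> W n y" for n y by (simp add: W_def nrm_nonneg)
  have Wlim: "(\<lambda>n. W n y) \<longlonglongrightarrow> 0" for y
  proof (rule LIMSEQ_I)
    fix e :: real assume e: "e > 0"
    then have "e / (\<bar>g y\<bar> + 1) > 0" by simp
    then obtain d where d: "d > 0" "\<And>t. \<bar>t\<bar> < d \<Longrightarrow> nrm (\<lambda>x. translate t k x - k x) < e / (\<bar>g y\<bar> + 1)"
      using L1_continuousD[OF L1_continuous[OF bd_integrable[OF k]]] by metis
    obtain n0 :: nat where n0: "\<bar>y\<bar> + 1 / d + 1 < n0" using reals_Archimedean2 by blast
    show "\<exists>n0. \<forall>n\<ge>n0. norm (W n y - 0) < e"
    proof (intro exI[of _ n0] allI impI)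
      fix n assume n: "n0 \<le> n"
      \<comment> \<open>The grid point at or just below \<open>y\<close>, hence at distance less
        than \<open>1 / real (Suc n)\<close>.\<close>
      define \<phi> where "\<phi> = of_int (q n y) / real (Suc n)"
      have y: "\<bar>y\<bar> < real n" using n n0 d(1) by (smt (verit) of_nat_mono divide_pos_pos)
      have "- int (n * Suc n) \<le> q n y" "q n y < int (n * Suc n)"
      proof -
        have "of_int (- int (n * Suc n)) \<le> y * real (Suc n)"
          using mult_right_mono[of "- real n" y "real (Suc n)"] y by (simp add: algebra_simps)
        then show "- int (n * Suc n) \<le> q n y" unfolding q_def by (simp only: le_floor_iff)
        have "y * real (Suc n) < of_int (int (n * Suc n))"
          using mult_strict_right_mono[of y "real n" "real (Suc n)"] y by (simp add: algebra_simps)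
        then show "q n y < int (n * Suc n)" unfolding q_def by (simp only: floor_less_iff)
      qed
      then have q: "q n y \<in> I n" by (simp add: I_def)
      have f: "of_int (q n y) \<le> y * real (Suc n)" "y * real (Suc n) < of_int (q n y) + 1"
        unfolding q_def by linarith+
      have "y - \<phi> = (y * real (Suc n) - of_int (q n y)) / real (Suc n)"
        by (simp add: \<phi>_def diff_divide_distrib del: of_nat_Suc)
      moreover have "\<dots> < 1 / real (Suc n)" "0 \<le> \<dots>"
        using f by (intro divide_strict_right_mono divide_nonneg_pos; simp)+
      ultimately have "0 \<le> y - \<phi>" "y - \<phi> < 1 / real (Suc n)"
        by simp_all
      moreover have "1 / real (Suc n) \<le> d"
      proof -
        have "1 / d < real (Suc n)" using n n0 by (smt (verit) of_nat_mono of_nat_Suc abs_ge_zero)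
        then show ?thesis using d(1) by (simp add: field_simps del: of_nat_Suc)
      qed
      ultimately have t: "\<bar>y - \<phi>\<bar> < d" by simp
      have "(\<lambda>x. ?D n x y) = (\<lambda>x. ?U y * translate \<phi> (\<lambda>x. translate (y - \<phi>) k x - k x) x)"
        using q by (simp add: K_def \<phi>_def translate_def algebra_simps)
      then have "W n y = \<bar>g y\<bar> * nrm (\<lambda>x. translate (y - \<phi>) k x - k x)"
        unfolding W_def using nrm_scale[of "?U y"] by (simp add: nrm_translate)
      also have "\<dots> \<le> \<bar>g y\<bar> * (e / (\<bar>g y\<bar> + 1))"
        using d(2)[OF t] by (intro mult_left_mono) auto
      also have "\<dots> < e"
        using e by (simp add: field_simps)
      finally show "norm (W n y - 0) < e" using W0[of n y] by simp
    qed
  qed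
  have Wint: "integrable lborel (W n)" for n
  proof (rule Bochner_Integration.integrable_bound)
    show "integrable lborel (\<lambda>y. 2 * (\<bar>g y\<bar> * nrm k))" using g by auto
    show "AE y in lborel. norm (W n y) \<le> norm (2 * (\<bar>g y\<bar> * nrm k))"
      using Wle W0 nrm_nonneg[of k] by (intro always_eventually allI) (simp add: abs_mult)
  qed simp
  have lim: "(\<lambda>n. LINT y|lborel. W n y) \<longlonglongrightarrow> (LINT y|(lborel::real measure). 0)"
    by (rule integral_dominated_convergence[where w = "\<lambda>y. 2 * (\<bar>g y\<bar> * nrm k)"])
      (use g Wlim Wle W0 in auto)
  show "(\<lambda>n. nrm (\<lambda>x. conv ?U k x - ?G n x)) \<longlonglongrightarrow> 0"
  proof (rule tendsto_sandwich[OF _ _ tendsto_const])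
    show "(\<lambda>n. LINT y|lborel. W n y) \<longlonglongrightarrow> 0" using lim by simp
    have "nrm (\<lambda>x. conv ?U k x - ?G n x) \<le> (LINT y|lborel. W n y)" for n
    proof -
      have Ki: "integrable lborel (\<lambda>y. K n y x)" for x
      proof (rule Bochner_Integration.integrable_bound)
        show "integrable lborel (\<lambda>y. of_real C * ?U y)" using U by auto
        show "(\<lambda>y. K n y x) \<in> borel_measurable lborel" unfolding K_def translate_def by measurable
        show "AE y in lborel. norm (K n y x) \<le> norm (of_real C * ?U y)"
          using bd_norm[OF k] bd_nonneg[OF k]
          by (intro always_eventually allI) (auto simp: K_def norm_mult translate_def mult.commute[of C] intro!: mult_left_mono)
      qed
      have "conv ?U k x - ?G n x = (LINT y|lborel. ?D n x y)" for x
        unfolding conv_def G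
        by (rule Bochner_Integration.integral_diff[symmetric, OF integrable_conv[OF U bd_measurable[OF k] bd_norm[OF k]] Ki])
      then show ?thesis
        using nrm_integral_le(2)[OF Dm Dint, of n] Wint[of n] by (simp add: W_def[abs_def])
    qed
    then show "\<forall>\<^sub>F n in sequentially. nrm (\<lambda>x. conv ?U k x - ?G n x) \<le> (LINT y|lborel. W n y)" by simp
  qed (simp add: nrm_nonneg)
qed

section \<open>Functions with one-sided spectrum\<close>

definition ft :: "(real \<Rightarrow> complex) \<Rightarrow> real \<Rightarrow> complex" where
  "ft F \<zeta> = (LINT x|lborel. F x * exp (\<i> * of_real x * of_real \<zeta>))"

text \<open>With the sign \<open>+ \<i>\<close> in the exponent these are the boundary values of the
  Hardy space of the upper half-plane; the spectrum of \<open>cnj U\<close> is then in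
  \<open>\<zeta> \<ge> 0\<close>.\<close>

definition hardy :: "(real \<Rightarrow> complex) \<Rightarrow> bool" where
  "hardy U \<longleftrightarrow> integrable lborel U \<and> (\<forall>\<zeta>>0. ft U \<zeta> = 0)"

lemma hardy_integrable: "hardy U \<Longrightarrow> integrable lborel U"
  and hardy_ft: "hardy U \<Longrightarrow> \<zeta> > 0 \<Longrightarrow> ft U \<zeta> = 0"
  by (auto simp: hardy_def)

lemma ft_integrable:
  assumes "integrable lborel F"
  shows "integrable lborel (\<lambda>x. F x * exp (\<i> * of_real x * of_real \<zeta>))"
proof (rule Bochner_Integration.integrable_bound[OF assms])
  have [measurable]: "F \<in> borel_measurable borel"
    using borel_measurable_integrable[OF assms] by simp
  show "(\<lambda>x. F x * exp (\<i> * of_real x * of_real \<zeta>)) \<in> borel_measurable lborel" by measurable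
qed (auto simp: norm_mult)

lemma norm_ft_le: "norm (ft F \<zeta>) \<le> nrm F"
  unfolding ft_def nrm_def
  by (rule order_trans[OF integral_norm_bound]) (simp add: norm_mult)

lemma ft_add:
  "integrable lborel F \<Longrightarrow> integrable lborel G \<Longrightarrow> ft (\<lambda>x. F x + G x) \<zeta> = ft F \<zeta> + ft G \<zeta>"
  unfolding ft_def distrib_right by (intro Bochner_Integration.integral_add ft_integrable)

lemma ft_diff:
  "integrable lborel F \<Longrightarrow> integrable lborel G \<Longrightarrow> ft (\<lambda>x. F x - G x) \<zeta> = ft F \<zeta> - ft G \<zeta>"
  unfolding ft_def left_diff_distrib by (intro Bochner_Integration.integral_diff ft_integrable)

lemma ft_scale: "ft (\<lambda>x. c * F x) \<zeta> = c * ft F \<zeta>"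
  by (simp add: ft_def mult.assoc)

lemma ft_cnj: "ft (\<lambda>x. cnj (F x)) \<zeta> = cnj (ft F (- \<zeta>))"
  unfolding ft_def by (subst Bochner_Integration.integral_cnj[symmetric]) (simp add: exp_cnj)

lemma ft_translate: "ft (translate a F) \<zeta> = exp (\<i> * of_real a * of_real \<zeta>) * ft F \<zeta>"
proof -
  let ?G = "\<lambda>x. F x * exp (\<i> * of_real x * of_real \<zeta>)"
  have "ft (translate a F) \<zeta> = (LINT x|lborel. exp (\<i> * of_real a * of_real \<zeta>) * translate a ?G x)"
    unfolding ft_def translate_def
    by (intro Bochner_Integration.integral_cong) (auto simp: algebra_simps simp flip: exp_add)
  then show ?thesis by (simp add: integral_translate ft_def)
qed

lemma ft_suminf:
  assumes b: "\<And>j::nat. bd (G j) (C j)" and s: "summable C"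
  shows "(\<lambda>j. ft (G j) \<zeta>) sums ft (\<lambda>x. \<Sum>j. G j x) \<zeta>"
proof -
  have i: "integrable lborel (\<lambda>x. G j x * exp (\<i> * of_real x * of_real \<zeta>))" for j
    by (rule ft_integrable[OF bd_integrable[OF b]])
  have "(\<lambda>j. LINT x|lborel. G j x * exp (\<i> * of_real x * of_real \<zeta>)) sums
      (LINT x|lborel. (\<Sum>j. G j x * exp (\<i> * of_real x * of_real \<zeta>)))"
  proof (rule sums_integral[OF i])
    show "AE x in lborel. summable (\<lambda>j. norm (G j x * exp (\<i> * of_real x * of_real \<zeta>)))"
      using bd_norm[OF b] by (intro always_eventually allI summable_comparison_test'[OF s]) (auto simp: norm_mult)
    show "summable (\<lambda>j. LINT x|lborel. norm (G j x * exp (\<i> * of_real x * of_real \<zeta>)))"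
      using bd_nrm[OF b] by (intro summable_comparison_test'[OF s]) (auto simp: norm_mult nrm_def)
  qed
  then show ?thesis
    unfolding ft_def by (simp only: suminf_mult2[OF bd_suminf(2)[OF b s]])
qed

lemma hardy_add: "hardy U \<Longrightarrow> hardy V \<Longrightarrow> hardy (\<lambda>x. U x + V x)"
  by (simp add: hardy_def ft_add)

lemma hardy_scale: "hardy U \<Longrightarrow> hardy (\<lambda>x. c * U x)"
  by (simp add: hardy_def ft_scale)

lemma hardy_translate: "hardy U \<Longrightarrow> hardy (translate a U)"
  by (auto simp: hardy_def ft_translate)

lemma hardy_suminf:
  assumes "\<And>j::nat. bd (G j) (C j)" "summable C" "\<And>j. hardy (G j)"
  shows "hardy (\<lambda>x. \<Sum>j. G j x)"
  unfolding hardy_def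
proof (intro conjI allI impI)
  show "integrable lborel (\<lambda>x. \<Sum>j. G j x)"
    by (rule bd_integrable[OF bd_suminf(1)[OF assms(1,2)]])
  fix \<zeta> :: real assume "\<zeta> > 0"
  then have "(\<lambda>j. 0) sums ft (\<lambda>x. \<Sum>j. G j x) \<zeta>"
    using ft_suminf[OF assms(1,2), of \<zeta>] hardy_ft[OF assms(3)] by simp
  then show "ft (\<lambda>x. \<Sum>j. G j x) \<zeta> = 0"
    using sums_unique2 sums_zero by blast
qed

lemma powser_coeff_eq_0:
  fixes a :: "nat \<Rightarrow> complex"
  assumes "s > 0" "\<And>x. x \<noteq> 0 \<Longrightarrow> norm x < s \<Longrightarrow> (\<lambda>n. a n * x ^ n) sums 0"
  shows "a n = 0"
  using assms(2)
proof (induction n arbitrary: a)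
  case 0
  have "((\<lambda>x::complex. 0) \<longlongrightarrow> a 0) (at 0)"
    by (rule powser_limit_0_strong[OF assms(1)]) (use 0 in auto)
  then show ?case by (simp add: tendsto_const_iff)
next
  case (Suc n)
  have "((\<lambda>x::complex. 0) \<longlongrightarrow> a 0) (at 0)"
    by (rule powser_limit_0_strong[OF assms(1)]) (use Suc in auto)
  then have a0: "a 0 = 0" by (simp add: tendsto_const_iff)
  show ?case
  proof (rule Suc.IH)
    fix x :: complex assume x: "x \<noteq> 0" "norm x < s"
    from sums_split_initial_segment[OF Suc.prems[OF x], of 1] a0
    have "(\<lambda>n. a (Suc n) * x ^ n * x) sums 0" by (simp add: mult_ac)
    from sums_divide[OF this, of x] x show "(\<lambda>n. a (Suc n) * x ^ n) sums 0" by simp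
  qed
qed

lemma laplace_exp:
  fixes s :: complex
  assumes "Re s > 0"
  shows "integrable lborel (\<lambda>t. indicator {0<..} t *\<^sub>R exp (- s * of_real t))"
    and "(LINT t|lborel. indicator {0<..} t *\<^sub>R exp (- s * of_real t)) = 1 / s"
proof -
  define \<sigma> where "\<sigma> = Re s"
  have sg: "\<sigma> > 0" "s \<noteq> 0" using assms by (auto simp: \<sigma>_def)
  have e0: "((\<lambda>t::real. exp (- \<sigma> * t)) \<longlongrightarrow> 0) at_top"
  proof -
    have "LIM t at_top. \<sigma> * t :> at_top"
      using sg by (intro filterlim_tendsto_pos_mult_at_top[OF tendsto_const]) (auto intro: filterlim_ident)
    then have "LIM t at_top. - \<sigma> * t :> at_bot" by (simp add: filterlim_uminus_at_top)
    then show ?thesis by (rule filterlim_compose[OF exp_at_bot])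
  qed
  have "set_integrable lborel (einterval 0 \<infinity>) (\<lambda>t. exp (- \<sigma> * t))"
  proof (rule interval_integral_FTC_nonneg)
    show "DERIV (\<lambda>t. - exp (- \<sigma> * t) / \<sigma>) t :> exp (- \<sigma> * t)" for t
      using sg by (auto intro!: derivative_eq_intros)
    show "(((\<lambda>t. - exp (- \<sigma> * t) / \<sigma>) \<circ> real_of_ereal) \<longlongrightarrow> - exp (- \<sigma> * 0) / \<sigma>) (at_right 0)"
      unfolding zero_ereal_def ereal_tendsto_simps
      by (intro tendsto_intros) (use sg in auto)
    show "(((\<lambda>t. - exp (- \<sigma> * t) / \<sigma>) \<circ> real_of_ereal) \<longlongrightarrow> - 0 / \<sigma>) (at_left \<infinity>)"
      unfolding ereal_tendsto_simps
      by (intro tendsto_divide tendsto_minus e0 tendsto_const) (use sg in auto)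
  qed auto
  moreover have E: "einterval 0 \<infinity> = {0<..}" by (auto simp: einterval_def zero_ereal_def)
  ultimately have i: "integrable lborel (\<lambda>t. indicator {0<..} t *\<^sub>R exp (- \<sigma> * t))"
    by (simp add: set_integrable_def)
  show I: "integrable lborel (\<lambda>t. indicator {0<..} t *\<^sub>R exp (- s * of_real t))"
    by (rule Bochner_Integration.integrable_bound[OF i]) (auto simp: \<sigma>_def)
  have ne: "norm (- exp (- s * of_real t) / s) = exp (- \<sigma> * t) / norm s" for t
    by (simp add: norm_divide \<sigma>_def)
  have "(LBINT t=0..\<infinity>. exp (- s * of_real t)) = 0 - (- exp (- s * of_real 0) / s)"
  proof (rule interval_integral_FTC_integrable)
    show "((\<lambda>t. - exp (- s * of_real t) / s) has_vector_derivative exp (- s * of_real t)) (at t)" for t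
      using sg by (auto intro!: derivative_eq_intros has_vector_derivative_real_field)
    show "isCont (\<lambda>t. exp (- s * of_real t)) t" for t :: real by (intro continuous_intros)
    show "set_integrable lborel (einterval 0 \<infinity>) (\<lambda>t. exp (- s * of_real t))"
      using I by (simp add: set_integrable_def E)
    show "(((\<lambda>t. - exp (- s * of_real t) / s) \<circ> real_of_ereal) \<longlongrightarrow> - exp (- s * of_real 0) / s) (at_right 0)"
      unfolding zero_ereal_def ereal_tendsto_simps
      by (intro tendsto_intros) (use sg in auto)
    show "(((\<lambda>t. - exp (- s * of_real t) / s) \<circ> real_of_ereal) \<longlongrightarrow> 0) (at_left \<infinity>)"
      unfolding ereal_tendsto_simps
    proof (rule tendsto_norm_zero_cancel)
      show "((\<lambda>t. norm (- exp (- s * of_real t) / s)) \<longlongrightarrow> 0) at_top"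
        unfolding ne using tendsto_divide[OF e0 tendsto_const[of "norm s"]] sg by simp
    qed
  qed auto
  then show "(LINT t|lborel. indicator {0<..} t *\<^sub>R exp (- s * of_real t)) = 1 / s"
    by (simp add: interval_lebesgue_integral_def set_lebesgue_integral_def E)
qed

text \<open>Here \<open>1 / (z - y)\<close> is the Laplace transform of \<open>\<lambda>t. \<i> * exp (\<i> * y * t)\<close> at \<open>\<i> * z\<close>.\<close>

lemma hardy_cauchy_eq_0:
  assumes U: "hardy U" and z: "Im z < 0"
  shows "(LINT y|lborel. U y / (z - of_real y)) = 0"
proof -
  have [measurable]: "U \<in> borel_measurable borel"
    using borel_measurable_integrable[OF hardy_integrable[OF U]] by simp
  define K where "K y t = U y * (indicator {0<..} t *\<^sub>R exp (- (\<i> * (z - of_real y)) * of_real t))" for y t :: real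
  define e where "e t = indicator {0<..} t * exp (Im z * t)" for t :: real
  have nK: "norm (K y t) = norm (U y) * e t" for y t
    by (simp add: K_def e_def norm_mult abs_mult indicator_def)
  have m: "(\<lambda>(y, t). K y t) \<in> borel_measurable (borel \<Otimes>\<^sub>M borel)"
    unfolding K_def by measurable
  have i1: "integrable lborel (\<lambda>y. K y t)" for t
  proof (rule Bochner_Integration.integrable_bound)
    show "integrable lborel (\<lambda>y. of_real (e t) * U y)" using hardy_integrable[OF U] by auto
    show "(\<lambda>y. K y t) \<in> borel_measurable lborel" unfolding K_def by measurable
    show "AE y in lborel. norm (K y t) \<le> norm (of_real (e t) * U y)"
      unfolding nK by (simp add: e_def norm_mult)
  qed
  have ie: "integrable lborel e"
    using integrable_norm[OF laplace_exp(1)[of "of_real (- Im z)"]] z by (simp add: e_def[abs_def])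
  have "nrm (\<lambda>y. K y t) = nrm U * e t" for t
    unfolding nrm_def nK by simp
  then have i2: "integrable lborel (\<lambda>t. nrm (\<lambda>y. K y t))"
    using ie by simp
  have 1: "(LINT y|lborel. LINT t|lborel. K y t) = (LINT t|lborel. LINT y|lborel. K y t)"
    by (rule nrm_integral_le(3)[OF m i1 i2])
  have 2: "(LINT y|lborel. K y t) = 0" for t
  proof (cases "t > 0")
    case True
    have "K y t = exp (- (\<i> * z * of_real t)) * (U y * exp (\<i> * of_real y * of_real t))" for y
      using True by (simp add: K_def algebra_simps flip: exp_add)
    then have "(LINT y|lborel. K y t) = exp (- (\<i> * z * of_real t)) * ft U t"
      by (simp add: ft_def)
    then show ?thesis using hardy_ft[OF U True] by simp
  qed (simp add: K_def)
  have 3: "(LINT y|lborel. LINT t|lborel. K y t) = (LINT y|lborel. (1 / \<i>) * (U y / (z - of_real y)))"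
  proof (intro Bochner_Integration.integral_cong refl)
    fix y :: real
    have "Re (\<i> * (z - of_real y)) > 0" using z by simp
    from laplace_exp(2)[OF this] show "(LINT t|lborel. K y t) = (1 / \<i>) * (U y / (z - of_real y))"
      unfolding K_def integral_mult_right_zero by (simp add: divide_inverse)
  qed
  show ?thesis
    using 1 unfolding 2 3 integral_mult_right_zero by simp
qed

text \<open>The Cauchy integral vanishes at every point \<open>z - r\<close> with
  \<open>norm r < a\<close>, as all of them are in the lower half-plane. Expanding in powers of
  \<open>r\<close> and comparing coefficients replaces differentiation under the integral
  sign.\<close>

lemma hardy_cauchy_power_eq_0:
  assumes U: "hardy U" and a: "a > 0"
  shows "(LINT y|lborel. U y / (of_real x - \<i> * of_real a - of_real y) ^ Suc n) = 0"
proof (rule powser_coeff_eq_0[OF a, where n = n and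
    a = "\<lambda>n. LINT y|lborel. U y / (of_real x - \<i> * of_real a - of_real y) ^ Suc n"])
  fix r :: complex assume r: "r \<noteq> 0" "norm r < a"
  define z where "z = of_real x - \<i> * of_real a"
  have zy: "norm r < norm (z - of_real y)" "a \<le> norm (z - of_real y)" "z - of_real y \<noteq> 0" for y
    using abs_Im_le_cmod[of "z - of_real y"] r a by (auto simp: z_def)
  have [measurable]: "U \<in> borel_measurable borel"
    using borel_measurable_integrable[OF hardy_integrable[OF U]] by simp
  let ?f = "\<lambda>n y. U y / (z - of_real y) ^ Suc n * r ^ n"
  have le: "norm (?f n y) \<le> norm (U y) * ((1 / a) * (norm r / a) ^ n)" for n y
  proof -
    have "norm (?f n y) = norm (U y) * norm r ^ n * (1 / norm (z - of_real y)) ^ Suc n"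
      by (simp add: norm_mult norm_divide norm_power power_one_over)
    also have "\<dots> \<le> norm (U y) * norm r ^ n * (1 / a) ^ Suc n"
      using zy[of y] a by (intro mult_left_mono power_mono frac_le) auto
    finally show ?thesis by (simp add: power_divide)
  qed
  have i: "integrable lborel (?f n)" for n
    by (rule Bochner_Integration.integrable_bound[where f = "\<lambda>y. norm (U y) * ((1 / a) * (norm r / a) ^ n)"])
      (use hardy_integrable[OF U] le a in \<open>auto simp: abs_mult\<close>)
  have s: "summable (\<lambda>n. (1 / a) * (norm r / a) ^ n)"
    using r a by (intro summable_mult summable_geometric) auto
  have "(\<lambda>n. LINT y|lborel. ?f n y) sums (LINT y|lborel. (\<Sum>n. ?f n y))"
  proof (rule sums_integral[OF i])
    show "AE y in lborel. summable (\<lambda>n. norm (?f n y))"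
      using le by (intro always_eventually allI summable_comparison_test'[OF summable_mult[OF s]]) auto
    show "summable (\<lambda>n. LINT y|lborel. norm (?f n y))"
    proof (rule summable_comparison_test'[OF summable_mult[OF s, of "nrm U"]])
      fix n
      have "(LINT y|lborel. norm (?f n y)) \<le> (LINT y|lborel. norm (U y) * ((1 / a) * (norm r / a) ^ n))"
        using hardy_integrable[OF U] i le by (intro integral_mono) auto
      then show "norm (LINT y|lborel. norm (?f n y)) \<le> nrm U * ((1 / a) * (norm r / a) ^ n)"
        by (simp add: nrm_def)
    qed
  qed
  moreover have "(\<Sum>n. ?f n y) = U y / ((z - r) - of_real y)" for y
  proof -
    have "(\<lambda>n. (r / (z - of_real y)) ^ n) sums (1 / (1 - r / (z - of_real y)))"
      using zy[of y] by (intro geometric_sums) (simp add: norm_divide)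
    from sums_mult[OF this, of "U y / (z - of_real y)"]
    have "(\<lambda>n. ?f n y) sums (U y / (z - of_real y) * (1 / (1 - r / (z - of_real y))))"
      by (simp add: power_divide)
    moreover have "(z - of_real y) * (1 - r / (z - of_real y)) = (z - r) - of_real y"
      using zy[of y] by (simp add: field_simps)
    ultimately show ?thesis by (simp add: sums_iff)
  qed
  moreover have "(LINT y|lborel. U y / ((z - r) - of_real y)) = 0"
    using abs_Im_le_cmod[of r] r by (intro hardy_cauchy_eq_0[OF U]) (auto simp: z_def)
  ultimately have "(\<lambda>n. LINT y|lborel. ?f n y) sums 0"
    by simp
  then show "(\<lambda>n. (LINT y|lborel. U y / (of_real x - \<i> * of_real a - of_real y) ^ Suc n) * r ^ n) sums 0"
    by (simp only: z_def integral_mult_left_zero)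
qed

lemma hardy_conv_eq_0:
  assumes "hardy U" "a > 0"
  shows "conv U (\<lambda>x. 1 / (of_real x - \<i> * of_real a) ^ Suc n) x = 0"
  using hardy_cauchy_power_eq_0[OF assms, of x n] by (simp add: conv_def algebra_simps)

text \<open>Integration by parts: the derivative of \<open>cauchy_ker a j\<close> is
  \<open>- (j + 2)\<close> times \<open>cauchy_ker a (Suc j)\<close>.\<close>

lemma ft_cauchy_ker_Suc:
  assumes "a > 0"
  shows "of_nat (j + 2) * ft (cauchy_ker a (Suc j)) \<zeta> = \<i> * of_real \<zeta> * ft (cauchy_ker a j) \<zeta>"
proof -
  let ?E = "\<lambda>x. exp (\<i> * of_real x * of_real \<zeta>)"
  let ?F = "\<lambda>x. cauchy_ker a j x * ?E x"
  let ?f = "\<lambda>x. \<i> * of_real \<zeta> * (cauchy_ker a j x * ?E x) - of_nat (j + 2) * (cauchy_ker a (Suc j) x * ?E x)"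
  have nz: "of_real x + \<i> * of_real a \<noteq> 0" for x using add_ii_neq_0 assms by auto
  have D: "(?F has_vector_derivative ?f x) (at x)" for x
  proof -
    have "((\<lambda>z. (1 / (z + \<i> * of_real a) ^ (j + 2)) * exp (\<i> * z * of_real \<zeta>)) has_field_derivative ?f x) (at (of_real x))"
    proof -
      define w where "w = of_real x + \<i> * of_real a"
      have w: "w \<noteq> 0" using nz by (simp add: w_def)
      have "((\<lambda>z. z + \<i> * of_real a) has_field_derivative 1) (at (of_real x))"
        by (auto intro!: derivative_eq_intros)
      from DERIV_power[OF this, of "j + 2"]
      have "((\<lambda>z. (z + \<i> * of_real a) ^ (j + 2)) has_field_derivative of_nat (j + 2) * (1 * w ^ (j + 2 - 1))) (at (of_real x))"
        by (simp add: w_def)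
      from DERIV_divide[OF DERIV_const[of 1] this]
      have "((\<lambda>z. 1 / (z + \<i> * of_real a) ^ (j + 2)) has_field_derivative
          (0 * w ^ (j + 2) - 1 * (of_nat (j + 2) * (1 * w ^ (j + 2 - 1)))) / (w ^ (j + 2) * w ^ (j + 2))) (at (of_real x))"
        using w by (simp add: w_def)
      moreover have "(0 * w ^ (j + 2) - 1 * (of_nat (j + 2) * (1 * w ^ (j + 2 - 1)))) / (w ^ (j + 2) * w ^ (j + 2))
          = - of_nat (j + 2) / w ^ (Suc j + 2)"
        using w by (simp add: divide_simps)
      ultimately have d: "((\<lambda>z. 1 / (z + \<i> * of_real a) ^ (j + 2)) has_field_derivative - of_nat (j + 2) / w ^ (Suc j + 2)) (at (of_real x))"
        by simp
      show ?thesis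
      proof -
        have "((\<lambda>z. exp (\<i> * z * of_real \<zeta>)) has_field_derivative \<i> * of_real \<zeta> * ?E x) (at (of_real x))"
          by (auto intro!: derivative_eq_intros)
        from DERIV_mult[OF d this] show ?thesis
          by (rule DERIV_cong) (simp add: cauchy_ker_def divide_inverse algebra_simps flip: w_def)
      qed
    qed
    from has_vector_derivative_real_field[OF this] show ?thesis
      by (simp add: cauchy_ker_def o_def)
  qed
  have i: "integrable lborel (\<lambda>x. cauchy_ker a j x * ?E x)" for j
    by (rule ft_integrable[OF bd_integrable[OF bd_cauchy_ker[OF assms]]])
  have I: "integrable lborel ?f" using i[of j] i[of "Suc j"] by auto
  have c: "isCont (cauchy_ker a j) x" for j x
    unfolding cauchy_ker_def using nz[of x] by (intro continuous_intros) auto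
  \<comment> \<open>The boundary terms: one of the \<open>j + 2\<close> factors of the denominator
    supplies \<open>1 / \<bar>x\<bar>\<close>, the others are bounded by
    \<open>1 / a\<close>.\<close>
  have lim: "(?F \<longlongrightarrow> 0) F'" if "filterlim (\<lambda>x::real. \<bar>x\<bar>) at_top F'" for F'
  proof (rule tendsto_norm_zero_cancel, rule tendsto_sandwich[OF _ _ tendsto_const])
    have "((\<lambda>x. inverse \<bar>x\<bar>) \<longlongrightarrow> 0) F'"
      by (rule filterlim_compose[OF tendsto_inverse_0_at_top[OF filterlim_ident] that])
    from tendsto_mult_left[OF this, of "(1 / a) ^ Suc j"]
    show "((\<lambda>x. (1 / a) ^ Suc j * inverse \<bar>x\<bar>) \<longlongrightarrow> 0) F'" by simp
    have "norm (?F x) \<le> (1 / a) ^ Suc j * inverse \<bar>x\<bar>" if "x \<noteq> 0" for x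
    proof -
      have "\<bar>x\<bar> \<le> norm (of_real x + \<i> * of_real a)"
        using abs_Re_le_cmod[of "of_real x + \<i> * of_real a"] by simp
      then have "(1 / norm (of_real x + \<i> * of_real a)) ^ Suc j * (1 / norm (of_real x + \<i> * of_real a)) \<le> (1 / a) ^ Suc j * (1 / \<bar>x\<bar>)"
        using norm_add_ii[of a x] assms that by (intro mult_mono power_mono frac_le) auto
      then show ?thesis
        by (simp add: cauchy_ker_def norm_mult norm_divide norm_power norm_inverse power_inverse power_one_over divide_inverse mult_ac)
    qed
    moreover have "\<forall>\<^sub>F x in F'. x \<noteq> 0"
      using eventually_compose_filterlim[OF eventually_gt_at_top[of 0] that] by eventually_elim auto
    ultimately show "\<forall>\<^sub>F x in F'. norm (?F x) \<le> (1 / a) ^ Suc j * inverse \<bar>x\<bar>"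
      by (auto elim: eventually_mono)
  qed simp
  have "(LBINT x=-\<infinity>..\<infinity>. ?f x) = 0 - 0"
  proof (rule interval_integral_FTC_integrable[where F = ?F])
    show "isCont ?f x" for x using c by (intro continuous_intros) auto
    show "set_integrable lborel (einterval (-\<infinity>) \<infinity>) ?f"
      using I by (simp add: set_integrable_def)
    show "((?F \<circ> real_of_ereal) \<longlongrightarrow> 0) (at_right (-\<infinity>))"
      unfolding ereal_tendsto_simps
      by (intro lim filterlim_at_top_mono[OF filterlim_uminus_at_top_at_bot] always_eventually allI) simp
    show "((?F \<circ> real_of_ereal) \<longlongrightarrow> 0) (at_left \<infinity>)"
      unfolding ereal_tendsto_simps
      by (intro lim filterlim_at_top_mono[OF filterlim_ident] always_eventually allI) simp
  qed (use D in auto)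
  then have "(LINT x|lborel. ?f x) = 0"
    by (simp add: interval_lebesgue_integral_def set_lebesgue_integral_def)
  then show ?thesis
    using i[of j] i[of "Suc j"] by (simp add: ft_def)
qed

lemma ft_cauchy_ker:
  assumes "a > 0"
  shows "ft (cauchy_ker a m) \<zeta> = (\<i> * of_real \<zeta>) ^ m / fact (Suc m) * ft (cauchy_ker a 0) \<zeta>"
proof (induction m)
  case (Suc m)
  have "ft (cauchy_ker a (Suc m)) \<zeta> = \<i> * of_real \<zeta> * ft (cauchy_ker a m) \<zeta> / of_nat (m + 2)"
  proof -
    have "(of_nat (m + 2) :: complex) \<noteq> 0" unfolding of_nat_eq_0_iff by simp
    then show ?thesis
      unfolding ft_cauchy_ker_Suc[OF assms, of m \<zeta>, symmetric] by (simp del: of_nat_add)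
  qed
  then show ?case
    unfolding Suc by (simp add: algebra_simps)
qed simp

lemma cauchy_ker_eq_suminf:
  assumes "a > 0" "\<bar>a' - a\<bar> < a"
  shows "cauchy_ker a' k = (\<lambda>x. \<Sum>j. taylor_term a k (\<i> * of_real (a - a')) j x)"
proof
  fix x
  have "norm (\<i> * complex_of_real (a - a')) < a"
    using assms by (simp only: norm_mult norm_of_real) simp
  from sums_unique[OF taylor_sums[OF assms(1) this, of k x]]
  show "cauchy_ker a' k x = (\<Sum>j. taylor_term a k (\<i> * of_real (a - a')) j x)"
    by (simp add: cauchy_ker_def algebra_simps)
qed

text \<open>The Taylor series in the pole is transformed term by term. Since the \<open>j\<close>-th
  kernel contributes \<open>(\<i> * \<zeta>) ^ j / fact (Suc j)\<close> and the binomial factor is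
  \<open>Suc j\<close>, the exponential series appears.\<close>

lemma ft_cauchy_ker_shift:
  assumes "a > 0" "\<bar>a' - a\<bar> < a"
  shows "ft (cauchy_ker a' 0) \<zeta> = exp (of_real (\<zeta> * (a' - a))) * ft (cauchy_ker a 0) \<zeta>"
proof -
  let ?r = "\<i> * complex_of_real (a - a')"
  have r: "norm ?r < a" using assms by (simp only: norm_mult norm_of_real) simp
  have "(\<lambda>j. ft (taylor_term a 0 ?r j) \<zeta>) sums ft (cauchy_ker a' 0) \<zeta>"
    unfolding cauchy_ker_eq_suminf[OF assms]
    by (rule ft_suminf[OF bd_taylor_term[OF assms(1)] summable_taylor_bound[OF assms(1) r]])
  moreover have "ft (taylor_term a 0 ?r j) \<zeta> = of_real (\<zeta> * (a' - a)) ^ j /\<^sub>R fact j * ft (cauchy_ker a 0) \<zeta>" for j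
  proof -
    have "ft (taylor_term a 0 ?r j) \<zeta> = of_nat (Suc j) * ?r ^ j * ft (cauchy_ker a j) \<zeta>"
      by (simp add: taylor_term_def[abs_def] ft_scale)
    also have "\<dots> = (?r * (\<i> * of_real \<zeta>)) ^ j * (of_nat (Suc j) / fact (Suc j)) * ft (cauchy_ker a 0) \<zeta>"
      unfolding ft_cauchy_ker[OF assms(1), of j] power_mult_distrib by simp
    also have "?r * (\<i> * of_real \<zeta>) = of_real (\<zeta> * (a' - a))"
      by (simp add: algebra_simps)
    also have "of_nat (Suc j) / fact (Suc j) = (1 / fact j :: complex)"
      by (simp add: divide_simps del: of_nat_Suc)
    finally show ?thesis by (simp add: scaleR_conv_of_real divide_inverse)
  qed
  moreover have "(\<lambda>j. of_real (\<zeta> * (a' - a)) ^ j /\<^sub>R fact j * ft (cauchy_ker a 0) \<zeta>) sums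
      (exp (of_real (\<zeta> * (a' - a))) * ft (cauchy_ker a 0) \<zeta>)"
    by (intro sums_mult2 exp_converges)
  ultimately show ?thesis using sums_unique2 by simp
qed

text \<open>No contour integral is used. Moving the pole away from the real line multiplies the
  Fourier transform at \<open>\<zeta> > 0\<close> by a growing exponential, whereas the L1-norms of
  the kernels stay bounded; so the transform is 0.\<close>

lemma hardy_cauchy_ker: "hardy (cauchy_ker 1 0)"
  unfolding hardy_def
proof (intro conjI allI impI)
  show "integrable lborel (cauchy_ker 1 0)" by (rule bd_integrable[OF bd_cauchy_ker_0]) simp
  fix \<zeta> :: real assume z: "\<zeta> > 0"
  let ?J = "\<lambda>a. ft (cauchy_ker a 0) \<zeta>"
  \<comment> \<open>Increments of 1/2 satisfy the restriction \<open>\<bar>a' - a\<bar> < a\<close>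
    of the shift lemma from \<open>a = 1\<close> on.\<close>
  have J: "norm (?J (1 + real n / 2)) = exp (\<zeta> / 2) ^ n * norm (?J 1)" for n
  proof (induction n)
    case (Suc n)
    have "?J (1 + real (Suc n) / 2) = exp (of_real (\<zeta> * (1 / 2))) * ?J (1 + real n / 2)"
      using ft_cauchy_ker_shift[of "1 + real n / 2" "1 + real (Suc n) / 2" \<zeta>]
      by (simp add: field_simps)
    then show ?case
      by (simp only: norm_mult norm_exp_eq_Re Suc) simp
  qed simp
  have le: "exp (\<zeta> / 2) ^ n * norm (?J 1) \<le> ker_bound 1" for n
  proof -
    have a: "1 \<le> 1 + real n / 2" by simp
    have "exp (\<zeta> / 2) ^ n * norm (?J 1) \<le> nrm (cauchy_ker (1 + real n / 2) 0)"
      unfolding J[symmetric] by (rule norm_ft_le)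
    also have "\<dots> \<le> ker_bound (1 + real n / 2)"
      by (rule bd_nrm[OF bd_cauchy_ker_0]) (use a in linarith)
    also have "\<dots> \<le> ker_bound 1"
      unfolding ker_bound_def by (intro add_mono frac_le one_le_power) auto
    finally show ?thesis .
  qed
  show "?J 1 = 0"
  proof (rule ccontr)
    assume "?J 1 \<noteq> 0"
    moreover have "1 < exp (\<zeta> / 2)" using z by simp
    ultimately obtain n where "ker_bound 1 / norm (?J 1) < exp (\<zeta> / 2) ^ n"
      using real_arch_pow by blast
    with \<open>?J 1 \<noteq> 0\<close> le[of n] show False by (simp add: field_simps)
  qed
qed

section \<open>Poisson kernels\<close>

definition poisson_kernel :: "real \<Rightarrow> real \<Rightarrow> real" where
  "poisson_kernel a x = a / (pi * (x\<^sup>2 + a\<^sup>2))"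

definition poisson :: "real \<Rightarrow> real \<Rightarrow> complex" where
  "poisson a x = of_real (poisson_kernel a x)"

lemma measurable_poisson [measurable]: "poisson a \<in> borel_measurable borel"
  unfolding poisson_def[abs_def] poisson_kernel_def by measurable

lemma poisson_kernel_1: "poisson_kernel 1 x = (1 / pi) * (1 / (x\<^sup>2 + 1\<^sup>2))"
  by (simp add: poisson_kernel_def)

lemma norm_poisson_1: "norm (poisson 1 x) = poisson_kernel 1 x"
  unfolding poisson_def norm_of_real by (simp add: poisson_kernel_1)

lemma integrable_poisson_1: "integrable lborel (poisson 1)"
  unfolding poisson_def[abs_def] poisson_kernel_1
  by (intro integrable_of_real integrable_mult_right integrable_inverse_square) auto

lemma integral_poisson_kernel_1: "(LINT x|lborel. poisson_kernel 1 x) = 1"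
  unfolding poisson_kernel_1 integral_mult_right_zero
  using integrable_inverse_square(2)[of 1] by simp

lemma integral_poisson_1: "(LINT x|lborel. poisson 1 x) = 1"
  by (simp add: poisson_def integral_poisson_kernel_1)

lemma nrm_poisson_1: "nrm (poisson 1) = 1"
  by (simp add: nrm_def norm_poisson_1 integral_poisson_kernel_1)

lemma poisson_scale:
  assumes "a > 0"
  shows "of_real a * poisson a (a * s) = poisson 1 s"
proof -
  have "a * poisson_kernel a (a * s) = (a * a) / (pi * (a * a * (s\<^sup>2 + 1)))"
    by (simp add: poisson_kernel_def power2_eq_square algebra_simps)
  also have "\<dots> = poisson_kernel 1 s"
    using assms by (simp add: poisson_kernel_def)
  finally show ?thesis by (simp add: poisson_def flip: of_real_mult)
qed

lemma norm_poisson_le: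
  assumes "a > 0" shows "norm (poisson a x) \<le> 1 / (pi * a)"
proof -
  have "a / (pi * (x\<^sup>2 + a\<^sup>2)) \<le> a / (pi * a\<^sup>2)"
    using assms by (intro divide_left_mono mult_left_mono mult_pos_pos add_nonneg_pos) auto
  also have "\<dots> = 1 / (pi * a)" using assms by (simp add: power2_eq_square)
  finally show ?thesis
    using assms by (simp add: poisson_def poisson_kernel_def del: of_real_divide)
qed

lemma poisson_eq_scaled:
  assumes "a > 0"
  shows "poisson a x = of_real (1 / a) * poisson 1 (0 + (1 / a) * x)"
  using poisson_scale[OF assms, of "x / a"] assms by (simp add: field_simps)

lemma integrable_poisson:
  assumes "a > 0"
  shows "integrable lborel (poisson a)"
  unfolding poisson_eq_scaled[OF assms, abs_def] using assms
  by (intro integrable_mult_right lborel_integrable_real_affine integrable_poisson_1) auto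

lemma bd_poisson: "a > 0 \<Longrightarrow> bd (poisson a) (1 / (pi * a) + nrm (poisson a))"
  using integrable_poisson norm_poisson_le nrm_nonneg[of "poisson a"]
  by (auto simp: bd_def intro: order_trans[OF norm_poisson_le])

text \<open>The exponent 1 is the missing index -1 of \<open>cauchy_ker\<close>. It is bounded but
  not integrable, so only differences of poles are expanded in L1; the Poisson kernel is a multiple
  of its imaginary part.\<close>

definition pole :: "real \<Rightarrow> real \<Rightarrow> complex" where
  "pole a x = 1 / (of_real x + \<i> * of_real a)"

lemma measurable_pole [measurable]: "pole a \<in> borel_measurable borel"
  unfolding pole_def[abs_def] by measurable

lemma measurable_cnj_pole [measurable]: "(\<lambda>x. cnj (pole a x)) \<in> borel_measurable borel"
  unfolding pole_def complex_cnj_divide complex_cnj_add complex_cnj_mult by simp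

lemma norm_pole_le: "a > 0 \<Longrightarrow> norm (pole a x) \<le> 1 / a"
  using norm_add_ii[of a x] by (simp add: pole_def norm_divide frac_le)

lemma poisson_eq_pole:
  assumes "a > 0"
  shows "poisson a x = (1 / (2 * pi * \<i>)) * (cnj (pole a x) - pole a x)"
proof -
  have nz: "of_real x + \<i> * of_real a \<noteq> 0" "of_real x - \<i> * of_real a \<noteq> 0"
    using add_ii_neq_0[of a x] add_ii_neq_0[of "-a" x] assms by auto
  have "(of_real x + \<i> * of_real a) * (of_real x - \<i> * of_real a) = of_real (x\<^sup>2 + a\<^sup>2)"
    by (simp add: algebra_simps power2_eq_square)
  moreover have "cnj (pole a x) - pole a x = 2 * \<i> * of_real a / ((of_real x + \<i> * of_real a) * (of_real x - \<i> * of_real a))"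
    using nz by (simp add: pole_def field_simps)
  ultimately have "cnj (pole a x) - pole a x = 2 * \<i> * of_real a / of_real (x\<^sup>2 + a\<^sup>2)"
    by simp
  then show ?thesis
    by (simp add: poisson_def poisson_kernel_def)
qed

lemma conv_poisson:
  assumes U: "integrable lborel U" and a: "a > 0"
  shows "conv U (poisson a) x = (1 / (2 * pi * \<i>)) * (conv U (\<lambda>x. cnj (pole a x)) x - conv U (pole a) x)"
proof -
  have "conv U (poisson a) x = conv U (\<lambda>x. (1 / (2 * pi * \<i>)) * (cnj (pole a x) - pole a x)) x"
    unfolding conv_def poisson_eq_pole[OF a] ..
  also have "\<dots> = (1 / (2 * pi * \<i>)) * conv U (\<lambda>x. cnj (pole a x) - pole a x) x"
    unfolding conv_scale_right conv_scale_left ..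
  also have "conv U (\<lambda>x. cnj (pole a x) - pole a x) x = conv U (\<lambda>x. cnj (pole a x)) x - conv U (pole a) x"
    using norm_pole_le[OF a] by (intro conv_diff_right[OF U]) auto
  finally show ?thesis .
qed

lemma hardy_conv_cnj_pole: "hardy U \<Longrightarrow> a > 0 \<Longrightarrow> conv U (\<lambda>x. cnj (pole a x)) x = 0"
  using hardy_conv_eq_0[of U a 0 x] by (simp add: pole_def)

lemma hardy_conv_poisson:
  "hardy U \<Longrightarrow> a > 0 \<Longrightarrow> conv U (poisson a) x = - (1 / (2 * pi * \<i>)) * conv U (pole a) x"
  by (simp add: conv_poisson hardy_integrable hardy_conv_cnj_pole)

text \<open>The substitution \<open>y = x - a n * s\<close> makes the kernel independent of
  \<open>n\<close>: the error is an average of \<open>translate (a n * s) U - U\<close> against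
  \<open>poisson 1\<close>, to which continuity of translation and dominated convergence
  apply.\<close>

lemma conv_poisson_approx:
  fixes a :: "nat \<Rightarrow> real"
  assumes U: "integrable lborel U" and a: "\<And>n. a n > 0" "a \<longlonglongrightarrow> 0"
  shows "(\<lambda>n. nrm (\<lambda>x. conv U (poisson (a n)) x - U x)) \<longlonglongrightarrow> 0"
proof -
  have [measurable]: "U \<in> borel_measurable borel" using borel_measurable_integrable[OF U] by simp
  let ?\<omega> = "\<lambda>t. nrm (\<lambda>x. translate t U x - U x)"
  let ?K = "\<lambda>n x s. poisson 1 s * (U (x - a n * s) - U x)"
  have Ut: "integrable lborel (translate t U)" for t using U by auto
  have Km [measurable]: "(\<lambda>(x, s). ?K n x s) \<in> borel_measurable (borel \<Otimes>\<^sub>M borel)" for n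
    by measurable
  have Kint: "integrable lborel (\<lambda>x. ?K n x s)" for n s
    using Ut[of "a n * s"] U by (auto simp: translate_def)
  have KW: "nrm (\<lambda>x. ?K n x s) = norm (poisson 1 s) * ?\<omega> (a n * s)" for n s
    unfolding nrm_scale by (simp add: translate_def)
  have Wm [measurable]: "(\<lambda>s. norm (poisson 1 s) * ?\<omega> (a n * s)) \<in> borel_measurable borel" for n
  proof -
    have "(\<lambda>(s, x). norm (?K n x s)) \<in> borel_measurable (borel \<Otimes>\<^sub>M lborel)"
      using measurable_compose[OF measurable_Pair[OF measurable_snd measurable_fst] Km[of n]]
      by (simp add: case_prod_unfold cong: measurable_cong_sets sets_pair_measure_cong)
    from lborel.borel_measurable_lebesgue_integral[OF this] show ?thesis
      unfolding KW[symmetric] by (simp add: nrm_def)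
  qed
  have w2: "?\<omega> t \<le> 2 * nrm U" for t
    using nrm_diff_le[OF Ut U, of t] by (simp add: nrm_translate)
  have ip: "integrable lborel (\<lambda>s. norm (poisson 1 s) * (2 * nrm U))"
    using integrable_norm[OF integrable_poisson_1] by auto
  have Wle: "norm (norm (poisson 1 s) * ?\<omega> (a n * s)) \<le> norm (poisson 1 s) * (2 * nrm U)" for n s
    using w2[of "a n * s"] nrm_nonneg by (simp add: abs_mult mult_left_mono)
  have Wint: "integrable lborel (\<lambda>s. norm (poisson 1 s) * ?\<omega> (a n * s))" for n
    by (rule Bochner_Integration.integrable_bound[OF ip]) (use Wle in \<open>auto intro: order_trans[OF _ abs_ge_self]\<close>)
  have lim: "(\<lambda>n. LINT s|lborel. norm (poisson 1 s) * ?\<omega> (a n * s)) \<longlonglongrightarrow> (LINT s|(lborel::real measure). 0)"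
  proof (rule integral_dominated_convergence[OF _ _ ip])
    show "AE s in lborel. (\<lambda>n. norm (poisson 1 s) * ?\<omega> (a n * s)) \<longlonglongrightarrow> 0"
    proof (intro always_eventually allI)
      fix s
      have "(\<lambda>n. ?\<omega> (a n * s)) \<longlonglongrightarrow> 0"
      proof (rule LIMSEQ_I)
        fix e :: real assume "e > 0"
        then obtain d where d: "d > 0" "\<And>t. \<bar>t\<bar> < d \<Longrightarrow> ?\<omega> t < e"
          using L1_continuousD[OF L1_continuous[OF U]] by metis
        have "(\<lambda>n. a n * s) \<longlonglongrightarrow> 0" using tendsto_mult_left_zero[OF a(2)] .
        from LIMSEQ_D[OF this d(1)] obtain n0 where "\<And>n. n \<ge> n0 \<Longrightarrow> \<bar>a n * s\<bar> < d" by auto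
        then show "\<exists>n0. \<forall>n\<ge>n0. norm (?\<omega> (a n * s) - 0) < e"
          using d(2) by (intro exI[of _ n0]) (simp add: nrm_nonneg)
      qed
      then show "(\<lambda>n. norm (poisson 1 s) * ?\<omega> (a n * s)) \<longlonglongrightarrow> 0"
        by (rule tendsto_mult_right_zero)
    qed
  qed (use Wle in auto)
  show ?thesis
  proof (rule tendsto_sandwich[OF _ _ tendsto_const])
    show "(\<lambda>n. LINT s|lborel. norm (poisson 1 s) * ?\<omega> (a n * s)) \<longlonglongrightarrow> 0" using lim by simp
    have "nrm (\<lambda>x. conv U (poisson (a n)) x - U x) \<le> (LINT s|lborel. norm (poisson 1 s) * ?\<omega> (a n * s))" for n
    proof -
      have cv: "integrable lborel (\<lambda>s. poisson 1 s * U (x - a n * s))"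
        "(LINT s|lborel. poisson 1 s * U (x - a n * s)) = conv U (poisson (a n)) x" for x
      proof -
        let ?f = "\<lambda>y. U y * poisson (a n) (x - y)"
        have i: "integrable lborel ?f"
          using norm_poisson_le[OF a(1)] by (intro integrable_conv[OF U]) auto
        have eq: "poisson 1 s * U (x - a n * s) = of_real (a n) * ?f (x + - a n * s)" for s
          using poisson_scale[OF a(1)[of n], of s] by (simp add: mult_ac)
        show "integrable lborel (\<lambda>s. poisson 1 s * U (x - a n * s))"
          unfolding eq using a(1)[of n] i
          by (intro integrable_mult_right lborel_integrable_real_affine) auto
        show "(LINT s|lborel. poisson 1 s * U (x - a n * s)) = conv U (poisson (a n)) x"
          unfolding eq conv_def
          using lborel_integral_real_affine[of "- a n" ?f x] a(1)[of n]
          by (simp add: scaleR_conv_of_real)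
      qed
      have "conv U (poisson (a n)) x - U x = (LINT s|lborel. ?K n x s)" for x
      proof -
        have "(LINT s|lborel. ?K n x s) = (LINT s|lborel. poisson 1 s * U (x - a n * s)) - (LINT s|lborel. poisson 1 s * U x)"
          unfolding right_diff_distrib using integrable_poisson_1 by (intro Bochner_Integration.integral_diff cv) auto
        then show ?thesis by (simp add: cv integral_poisson_1)
      qed
      then show ?thesis
        using nrm_integral_le(2)[OF Km Kint, of n] Wint[of n] unfolding KW by simp
    qed
    then show "\<forall>\<^sub>F n in sequentially. nrm (\<lambda>x. conv U (poisson (a n)) x - U x) \<le> (LINT s|lborel. norm (poisson 1 s) * ?\<omega> (a n * s))"
      by simp
  qed (simp add: nrm_nonneg)
qed

text \<open>Because \<open>U\<close> has integral 0, \<open>poisson (a n) x\<close> may be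
  subtracted from the kernel. By scaling, the L1-size of the difference is that of
  \<open>translate (y / a n) (poisson 1) - poisson 1\<close>, and \<open>y / a n\<close> tends to
  0.\<close>

lemma conv_poisson_vanish:
  fixes a :: "nat \<Rightarrow> real"
  assumes U: "integrable lborel U" "(LINT y|lborel. U y) = 0"
    and a: "\<And>n. a n > 0" "(\<lambda>n. 1 / a n) \<longlonglongrightarrow> 0"
  shows "(\<lambda>n. nrm (conv U (poisson (a n)))) \<longlonglongrightarrow> 0"
proof -
  have [measurable]: "U \<in> borel_measurable borel" using borel_measurable_integrable[OF U(1)] by simp
  let ?\<omega> = "\<lambda>t. nrm (\<lambda>x. translate t (poisson 1) x - poisson 1 x)"
  let ?K = "\<lambda>n x y. U y * (poisson (a n) (x - y) - poisson (a n) x)"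
  have Km [measurable]: "(\<lambda>(x, y). ?K n x y) \<in> borel_measurable (borel \<Otimes>\<^sub>M borel)" for n
    by measurable
  note eq = poisson_eq_scaled[OF a(1)]
  note ip = integrable_poisson[OF a(1)]
  have Pt: "integrable lborel (translate t (poisson 1))" for t
    using integrable_poisson_1 by auto
  have Kint: "integrable lborel (\<lambda>x. ?K n x y)" for n y
    using integrable_translate[OF ip, of y n] ip[of n] by (auto simp: translate_def)
  have KW: "nrm (\<lambda>x. ?K n x y) = norm (U y) * ?\<omega> (y / a n)" for n y
  proof -
    have "?\<omega> (y / a n) = (LINT x|lborel. norm (translate (y / a n) (poisson 1) x - poisson 1 x))"
      by (simp add: nrm_def)
    also have "\<dots> = \<bar>1 / a n\<bar> * (LINT x|lborel. norm (translate (y / a n) (poisson 1) (0 + 1 / a n * x) - poisson 1 (0 + 1 / a n * x)))"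
      using a(1)[of n] lborel_integral_real_affine[of "1 / a n" "\<lambda>x. norm (translate (y / a n) (poisson 1) x - poisson 1 x)" 0]
      by simp
    also have "\<dots> = (LINT x|lborel. norm (poisson (a n) (x - y) - poisson (a n) x))"
      unfolding integral_mult_right_zero[symmetric] eq right_diff_distrib[symmetric] norm_mult norm_of_real
      using a(1)[of n] by (simp add: translate_def diff_divide_distrib)
    finally show ?thesis unfolding nrm_scale by (simp add: nrm_def)
  qed
  have Wm [measurable]: "(\<lambda>y. norm (U y) * ?\<omega> (y / a n)) \<in> borel_measurable borel" for n
  proof -
    have "(\<lambda>(y, x). norm (?K n x y)) \<in> borel_measurable (borel \<Otimes>\<^sub>M lborel)"
      using measurable_compose[OF measurable_Pair[OF measurable_snd measurable_fst] Km[of n]]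
      by (simp add: case_prod_unfold cong: measurable_cong_sets sets_pair_measure_cong)
    from lborel.borel_measurable_lebesgue_integral[OF this] show ?thesis
      unfolding KW[symmetric] by (simp add: nrm_def)
  qed
  have w2: "?\<omega> t \<le> 2" for t
    using nrm_diff_le[OF Pt integrable_poisson_1, of t] by (simp add: nrm_translate nrm_poisson_1)
  have iu: "integrable lborel (\<lambda>y. norm (U y) * 2)"
    using integrable_norm[OF U(1)] by auto
  have Wle: "norm (norm (U y) * ?\<omega> (y / a n)) \<le> norm (U y) * 2" for n y
    using w2[of "y / a n"] nrm_nonneg by (simp add: abs_mult mult_left_mono)
  have Wint: "integrable lborel (\<lambda>y. norm (U y) * ?\<omega> (y / a n))" for n
    by (rule Bochner_Integration.integrable_bound[OF iu]) (use Wle in \<open>auto intro: order_trans[OF _ abs_ge_self]\<close>)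
  have lim: "(\<lambda>n. LINT y|lborel. norm (U y) * ?\<omega> (y / a n)) \<longlonglongrightarrow> (LINT y|(lborel::real measure). 0)"
  proof (rule integral_dominated_convergence[OF _ _ iu])
    show "AE y in lborel. (\<lambda>n. norm (U y) * ?\<omega> (y / a n)) \<longlonglongrightarrow> 0"
    proof (intro always_eventually allI)
      fix y
      have "(\<lambda>n. ?\<omega> (y / a n)) \<longlonglongrightarrow> 0"
      proof (rule LIMSEQ_I)
        fix e :: real assume "e > 0"
        then obtain d where d: "d > 0" "\<And>t. \<bar>t\<bar> < d \<Longrightarrow> ?\<omega> t < e"
          using L1_continuousD[OF L1_continuous[OF integrable_poisson_1]] by metis
        have "(\<lambda>n. y / a n) \<longlonglongrightarrow> 0" using tendsto_mult_right_zero[OF a(2), of y] by simp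
        from LIMSEQ_D[OF this d(1)] obtain n0 where "\<And>n. n \<ge> n0 \<Longrightarrow> \<bar>y / a n\<bar> < d" by auto
        then show "\<exists>n0. \<forall>n\<ge>n0. norm (?\<omega> (y / a n) - 0) < e"
          using d(2) by (intro exI[of _ n0]) (simp add: nrm_nonneg)
      qed
      then show "(\<lambda>n. norm (U y) * ?\<omega> (y / a n)) \<longlonglongrightarrow> 0"
        by (rule tendsto_mult_right_zero)
    qed
  qed (use Wle in auto)
  show ?thesis
  proof (rule tendsto_sandwich[OF _ _ tendsto_const])
    show "(\<lambda>n. LINT y|lborel. norm (U y) * ?\<omega> (y / a n)) \<longlonglongrightarrow> 0" using lim by simp
    have "nrm (conv U (poisson (a n))) \<le> (LINT y|lborel. norm (U y) * ?\<omega> (y / a n))" for n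
    proof -
      have "conv U (poisson (a n)) x = (LINT y|lborel. ?K n x y)" for x
      proof -
        have "integrable lborel (\<lambda>y. U y * poisson (a n) (x - y))"
          using norm_poisson_le[OF a(1)] by (intro integrable_conv[OF U(1)]) auto
        then have "(LINT y|lborel. ?K n x y) = conv U (poisson (a n)) x - (LINT y|lborel. U y * poisson (a n) x)"
          unfolding right_diff_distrib conv_def using U(1) by (intro Bochner_Integration.integral_diff) auto
        then show ?thesis by (simp add: U(2))
      qed
      then have "conv U (poisson (a n)) = (\<lambda>x. LINT y|lborel. ?K n x y)" by blast
      then show ?thesis
        using nrm_integral_le(2)[OF Km Kint, of n] Wint[of n] unfolding KW by simp
    qed
    then show "\<forall>\<^sub>F n in sequentially. nrm (conv U (poisson (a n))) \<le> (LINT y|lborel. norm (U y) * ?\<omega> (y / a n))"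
      by simp
  qed (simp add: nrm_nonneg)
qed

text \<open>The integral is the limit of \<open>ft U \<zeta>\<close> as \<open>\<zeta>\<close>
  decreases to 0. It provides the mean zero that \<open>conv_poisson_vanish\<close> needs.\<close>

lemma hardy_integral_eq_0:
  assumes "hardy U"
  shows "(LINT y|lborel. U y) = 0"
proof -
  have U: "integrable lborel U" using assms by (rule hardy_integrable)
  have [measurable]: "U \<in> borel_measurable borel" using borel_measurable_integrable[OF U] by simp
  have "(\<lambda>n. ft U (1 / real (Suc n))) \<longlonglongrightarrow> (LINT y|lborel. U y)"
    unfolding ft_def
  proof (rule integral_dominated_convergence[OF _ _ integrable_norm[OF U]])
    show "AE y in lborel. (\<lambda>n. U y * exp (\<i> * of_real y * of_real (1 / real (Suc n)))) \<longlonglongrightarrow> U y"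
    proof (intro always_eventually allI)
      fix y
      have "(\<lambda>n. U y * exp (\<i> * of_real y * of_real (1 / real (Suc n)))) \<longlonglongrightarrow> U y * exp (\<i> * of_real y * of_real 0)"
        by (intro tendsto_intros LIMSEQ_Suc lim_1_over_n)
      then show "(\<lambda>n. U y * exp (\<i> * of_real y * of_real (1 / real (Suc n)))) \<longlonglongrightarrow> U y" by simp
    qed
  qed (auto simp: norm_mult simp del: of_nat_Suc)
  moreover have "ft U (1 / real (Suc n)) = 0" for n
    using hardy_ft[OF assms] by simp
  ultimately show ?thesis by (simp add: LIMSEQ_const_iff)
qed

text \<open>Both \<open>U\<close> and its conjugate are \<open>hardy\<close>, so both halves of the
  Poisson kernel annihilate \<open>U\<close>, and \<open>U\<close> is the limit of its Poisson
  integrals. This uniqueness makes the choice of the Hilbert transform irrelevant for the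
  norm.\<close>

lemma nrm_eq_0_of_ft:
  assumes U: "integrable lborel U" and z: "\<And>\<zeta>. \<zeta> \<noteq> 0 \<Longrightarrow> ft U \<zeta> = 0"
  shows "nrm U = 0"
proof -
  have h: "hardy U" "hardy (\<lambda>x. cnj (U x))"
    using U z by (auto simp: hardy_def ft_cnj)
  have "conv U (poisson a) x = 0" if "a > 0" for a x
  proof -
    have "conv U (pole a) x = cnj (conv (\<lambda>x. cnj (U x)) (\<lambda>x. cnj (pole a x)) x)"
      by (simp add: conv_cnj)
    then show ?thesis
      by (simp add: hardy_conv_poisson[OF h(1) that] hardy_conv_cnj_pole[OF h(2) that])
  qed
  then have "nrm (\<lambda>x. conv U (poisson (1 / real (Suc n))) x - U x) = nrm U" for n
    by (simp add: nrm_def)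
  then have "(\<lambda>n::nat. nrm U) \<longlonglongrightarrow> 0"
    using conv_poisson_approx[OF U, of "\<lambda>n. 1 / real (Suc n)"] LIMSEQ_Suc[OF lim_1_over_n] by simp
  then show ?thesis by (simp add: LIMSEQ_const_iff)
qed

section \<open>Density\<close>

context real_subspace
begin

text \<open>The statement carried along while the pole moves. All \<open>j\<close> and all
  \<open>U\<close> occur together because one expansion uses every power of the kernel and changes
  \<open>U\<close>; the poles are compared with the fixed reference at 1, which cancels in the
  end.\<close>

definition null_on :: "real \<Rightarrow> bool" where
  "null_on a \<longleftrightarrow> (\<forall>U j. hardy U \<longrightarrow> dst (conv U (cauchy_ker a j)) = 0) \<and>
     (\<forall>U. hardy U \<longrightarrow> integrable lborel (conv U (\<lambda>x. pole a x - pole 1 x)) \<and>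
       dst (conv U (\<lambda>x. pole a x - pole 1 x)) = 0)"

text \<open>
  The span is only real, but \<open>conv U (cauchy_ker 1 j)\<close> is also the convolution with the real function
  \<open>2 Re U\<close>, because \<open>cnj U\<close> contributes \<open>0\<close>.
\<close>

lemma null_on_1:
  assumes "\<And>j. dst (cauchy_ker 1 j) = 0"
  shows "null_on 1"
proof -
  have "dst (conv U (cauchy_ker 1 j)) = 0" if U: "hardy U" for U j
  proof -
    have iU: "integrable lborel U" using U by (rule hardy_integrable)
    have k: "bd (cauchy_ker 1 j) (ker_bound 1)" using bd_cauchy_ker[of 1 j] by simp
    have r: "complex_of_real (2 * Re (U y)) = U y + cnj (U y)" for y
      by (simp add: complex_add_cnj)
    have "conv (\<lambda>y. complex_of_real (2 * Re (U y))) (cauchy_ker 1 j) = conv U (cauchy_ker 1 j)"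
    proof
      fix x
      have "conv (\<lambda>y. cnj (U y)) (cauchy_ker 1 j) x = cnj (conv U (\<lambda>x. 1 / (of_real x - \<i> * of_real 1) ^ Suc (Suc j)) x)"
        unfolding conv_cnj by (simp add: cauchy_ker_def)
      then have "conv (\<lambda>y. cnj (U y)) (cauchy_ker 1 j) x = 0"
        using hardy_conv_eq_0[OF U, of 1 "Suc j" x] by simp
      then show "conv (\<lambda>y. complex_of_real (2 * Re (U y))) (cauchy_ker 1 j) x = conv U (cauchy_ker 1 j) x"
        unfolding r using conv_add_left[OF iU _ bd_measurable[OF k] bd_norm[OF k], of "\<lambda>y. cnj (U y)" x] iU
        by simp
    qed
    moreover have "dst (conv (\<lambda>y. complex_of_real (2 * Re (U y))) (cauchy_ker 1 j)) = 0"
      using iU by (intro dst_conv_real[OF _ k dst_translate_cauchy_ker[OF assms]]) auto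
    ultimately show ?thesis by simp
  qed
  moreover have "conv U (\<lambda>x. pole 1 x - pole 1 x) = (\<lambda>x. 0)" for U
    by (simp add: conv_def fun_eq_iff)
  ultimately show ?thesis by (simp add: null_on_def dst_mem[OF zero])
qed

lemma pole_diff_suminf:
  assumes "a > 0" "\<bar>a' - a\<bar> < a"
  shows "pole a' x - pole a x = (\<Sum>j. (\<i> * of_real (a - a')) ^ Suc j * cauchy_ker a j x)"
proof -
  define z where "z = of_real x + \<i> * of_real a"
  define r where "r = \<i> * complex_of_real (a - a')"
  have nr: "norm r < a" using assms unfolding r_def by (simp only: norm_mult norm_of_real) simp
  then have z: "z \<noteq> 0" "norm r < norm z" "z - r \<noteq> 0"
    using norm_add_ii[of a x] assms by (auto simp: z_def)
  have "(\<lambda>j. (r / z) ^ j) sums (1 / (1 - r / z))"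
    using z by (intro geometric_sums) (simp add: norm_divide)
  from sums_mult[OF this, of "r / z\<^sup>2"]
  have "(\<lambda>j. r ^ Suc j * cauchy_ker a j x) sums (r / z\<^sup>2 * (1 / (1 - r / z)))"
    by (simp add: cauchy_ker_def power_divide power2_eq_square mult_ac flip: z_def)
  moreover have "r / z\<^sup>2 * (1 / (1 - r / z)) = 1 / (z - r) - 1 / z"
  proof -
    have "1 - r / z = (z - r) / z" using z by (simp add: field_simps)
    then show ?thesis using z by (simp add: field_simps power2_eq_square)
  qed
  moreover have "pole a' x = 1 / (z - r)" "pole a x = 1 / z"
    by (simp_all add: pole_def z_def r_def algebra_simps)
  ultimately show ?thesis by (simp add: sums_iff r_def)
qed

lemma null_on_step:
  assumes n: "null_on a" and a: "a > 0" "\<bar>a' - a\<bar> < a"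
  shows "null_on a'"
  unfolding null_on_def
proof (intro conjI allI impI)
  define r where "r = \<i> * complex_of_real (a - a')"
  have r: "norm r < a" using a unfolding r_def by (simp only: norm_mult norm_of_real) simp
  fix U assume U: "hardy U"
  note iU = hardy_integrable[OF U]
  \<comment> \<open>The coefficients of the expansion are powers of an imaginary number, while
    distance 0 is stable only under real multiples. They are absorbed into \<open>U\<close>, since
    \<open>c * U\<close> is again \<open>hardy\<close>.\<close>
  have z: "dst (conv U (\<lambda>x. c * cauchy_ker a j x)) = 0" for c j
    using n hardy_scale[OF U, of c] by (simp add: conv_scale_right[abs_def] null_on_def)
  show "dst (conv U (cauchy_ker a' k)) = 0" for k
  proof -
    have "conv U (cauchy_ker a' k) = (\<lambda>x. \<Sum>j. conv U (taylor_term a k r j) x)"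
      unfolding cauchy_ker_eq_suminf[OF a] r_def[symmetric]
      using conv_suminf[OF iU bd_taylor_term[OF a(1)] summable_taylor_bound[OF a(1) r]] by blast
    moreover have "dst (\<lambda>x. \<Sum>j. conv U (taylor_term a k r j) x) = 0"
      by (rule dst_suminf[OF bd_conv[OF iU bd_taylor_term[OF a(1)]] summable_mult[OF summable_taylor_bound[OF a(1) r]]])
        (simp add: taylor_term_def[abs_def] z)
    ultimately show ?thesis by simp
  qed
  have b: "bd (\<lambda>x. r ^ Suc j * cauchy_ker a j x) (norm r ^ Suc j * ((1 / a) ^ j * ker_bound a))" for j
    using bd_scale[OF bd_cauchy_ker[OF a(1), of j], of "r ^ Suc j"] by (simp add: norm_mult norm_power)
  have s: "summable (\<lambda>j. norm r ^ Suc j * ((1 / a) ^ j * ker_bound a))"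
  proof -
    have "summable (\<lambda>j. norm r * ((norm r / a) ^ j * ker_bound a))"
      using r a by (intro summable_mult summable_mult2 summable_geometric) auto
    then show ?thesis by (simp add: power_divide mult.assoc)
  qed
  have d: "dst (conv U (\<lambda>x. pole a' x - pole a x)) = 0"
    "integrable lborel (conv U (\<lambda>x. pole a' x - pole a x))"
  proof -
    have "conv U (\<lambda>x. pole a' x - pole a x) = (\<lambda>x. \<Sum>j. conv U (\<lambda>x. r ^ Suc j * cauchy_ker a j x) x)"
      unfolding pole_diff_suminf[OF a] r_def[symmetric] using conv_suminf[OF iU b s] by blast
    moreover have "dst (\<lambda>x. \<Sum>j. conv U (\<lambda>x. r ^ Suc j * cauchy_ker a j x) x) = 0"
      by (rule dst_suminf[OF bd_conv[OF iU b] summable_mult[OF s] z])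
    moreover have "integrable lborel (\<lambda>x. \<Sum>j. conv U (\<lambda>x. r ^ Suc j * cauchy_ker a j x) x)"
      by (rule bd_integrable[OF bd_suminf(1)[OF bd_conv[OF iU b] summable_mult[OF s]]])
    ultimately show "dst (conv U (\<lambda>x. pole a' x - pole a x)) = 0"
      "integrable lborel (conv U (\<lambda>x. pole a' x - pole a x))" by simp_all
  qed
  have a': "a' > 0" using a by linarith
  have "conv U (\<lambda>x. pole a' x - pole 1 x) = (\<lambda>x. conv U (\<lambda>x. pole a' x - pole a x) x + conv U (\<lambda>x. pole a x - pole 1 x) x)"
  proof
    fix x
    have le: "norm (pole b x - pole c x) \<le> 1 / b + 1 / c" if "b > 0" "c > 0" for b c x
      by (rule order_trans[OF norm_triangle_ineq4]) (use norm_pole_le that in \<open>auto intro: add_mono\<close>)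
    have "conv U (\<lambda>x. (pole a' x - pole a x) + (pole a x - pole 1 x)) x =
        conv U (\<lambda>x. pole a' x - pole a x) x + conv U (\<lambda>x. pole a x - pole 1 x) x"
      by (rule conv_add_right[OF iU _ le[OF a' a(1)] _ le[OF a(1) zero_less_one]]) simp_all
    then show "conv U (\<lambda>x. pole a' x - pole 1 x) x = conv U (\<lambda>x. pole a' x - pole a x) x + conv U (\<lambda>x. pole a x - pole 1 x) x"
      by simp
  qed
  moreover have "integrable lborel (conv U (\<lambda>x. pole a x - pole 1 x))" "dst (conv U (\<lambda>x. pole a x - pole 1 x)) = 0"
    using n U by (auto simp: null_on_def)
  ultimately show "integrable lborel (conv U (\<lambda>x. pole a' x - pole 1 x))"
    "dst (conv U (\<lambda>x. pole a' x - pole 1 x)) = 0"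
    using d dst_add_le[OF d(2), of "conv U (\<lambda>x. pole a x - pole 1 x)"]
      dst_nonneg[of "conv U (\<lambda>x. pole a' x - pole 1 x)"] by auto
qed

lemma dst_hardy:
  assumes ker: "\<And>j. dst (cauchy_ker 1 j) = 0" and U: "hardy U"
  shows "dst U = 0"
proof -
  note iU = hardy_integrable[OF U]
  \<comment> \<open>One step allows \<open>\<bar>a' - a\<bar> < a\<close> strictly: halving is
    admissible, doubling is not, hence the ratio 3/2 for the growing sequence.\<close>
  define p q :: "nat \<Rightarrow> real" where "p n = (1/2) ^ n" and "q n = (3/2) ^ n" for n
  have p: "p n > 0" and q: "q n > 0" for n by (simp_all add: p_def q_def)
  have np: "null_on (p n)" for n
  proof (induction n)
    case (Suc n)
    from null_on_step[OF this p] show ?case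
      using p[of n] by (simp add: p_def)
  qed (simp add: p_def null_on_1[OF ker])
  have nq: "null_on (q n)" for n
  proof (induction n)
    case (Suc n)
    from null_on_step[OF this q] show ?case
      using q[of n] by (simp add: q_def)
  qed (simp add: q_def null_on_1[OF ker])
  define c where "c = 1 / (2 * pi * \<i>)"
  let ?A = "\<lambda>a. conv U (poisson a)" and ?V = "\<lambda>y. c * U y"
  have V: "hardy ?V" using U by (rule hardy_scale)
  note iV = hardy_integrable[OF V]
  have A: "?A a x = - conv ?V (\<lambda>x. pole a x - pole 1 x) x - conv ?V (pole 1) x" if "a > 0" for a x
  proof -
    have "conv ?V (\<lambda>x. pole a x - pole 1 x) x = conv ?V (pole a) x - conv ?V (pole 1) x"
      using norm_pole_le that by (intro conv_diff_right[OF iV _ norm_pole_le _ norm_pole_le]) auto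
    moreover have "?A a x = - c * conv U (pole a) x"
      using hardy_conv_poisson[OF U that, of x] by (simp add: c_def)
    ultimately show ?thesis
      unfolding conv_scale_left by simp
  qed
  have "dst U \<le> nrm (\<lambda>x. ?A (p n) x - U x) + nrm (?A (q n))" for n
  proof -
    let ?D = "\<lambda>a. conv ?V (\<lambda>x. pole a x - pole 1 x)"
    have D: "integrable lborel (?D (p n))" "dst (?D (p n)) = 0" "integrable lborel (?D (q n))" "dst (?D (q n)) = 0"
      using np[of n] nq[of n] V by (auto simp: null_on_def)
    \<comment> \<open>The reference pole at 1 cancels, so \<open>?E\<close> is the difference of the
      two Poisson integrals and has distance 0.\<close>
    let ?E = "\<lambda>x. ?D (q n) x - ?D (p n) x"
    have E: "?E x = ?A (p n) x - ?A (q n) x" for x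
      using A[OF p] A[OF q] by simp
    have iA: "integrable lborel (?A a)" if "a > 0" for a
      by (rule bd_integrable[OF bd_conv[OF iU bd_poisson[OF that]]])
    have "dst ?E = 0"
      using dst_diff_le[OF D(3,1)] D dst_nonneg[of ?E] by simp
    then have "dst U \<le> nrm (\<lambda>x. U x - ?E x)"
      using dst_triangle[OF iU, of ?E] D by simp
    also have "\<dots> = nrm (\<lambda>x. (?A (p n) x - U x) - ?A (q n) x)"
      unfolding E nrm_def by (subst norm_minus_commute) (simp add: algebra_simps)
    also have "\<dots> \<le> nrm (\<lambda>x. ?A (p n) x - U x) + nrm (?A (q n))"
      using iU iA[OF p] iA[OF q] by (intro nrm_diff_le) auto
    finally show ?thesis .
  qed
  moreover have "(\<lambda>n. nrm (\<lambda>x. ?A (p n) x - U x) + nrm (?A (q n))) \<longlonglongrightarrow> 0 + 0"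
  proof (intro tendsto_add conv_poisson_approx[OF iU p] conv_poisson_vanish[OF iU hardy_integral_eq_0[OF U] q])
    show "p \<longlonglongrightarrow> 0" unfolding p_def by (intro LIMSEQ_realpow_zero) auto
    have "(\<lambda>n. 1 / q n) = (\<lambda>n. (2/3) ^ n)" by (simp add: q_def power_one_over[symmetric] power_divide)
    then show "(\<lambda>n. 1 / q n) \<longlonglongrightarrow> 0" by (simp add: LIMSEQ_realpow_zero)
  qed
  ultimately have "dst U \<le> 0 + 0"
    by (intro LIMSEQ_le_const[where X = "\<lambda>n. nrm (\<lambda>x. ?A (p n) x - U x) + nrm (?A (q n))"]) auto
  then show ?thesis using dst_nonneg[of U] by simp
qed

end

section \<open>From the real span of Hardy functions to density in \<open>H1\<close>\<close>

inductive_set real_span :: "(real \<Rightarrow> complex) set \<Rightarrow> (real \<Rightarrow> complex) set" for G where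
  zero: "(\<lambda>x. 0) \<in> real_span G"
| step: "s \<in> real_span G \<Longrightarrow> g \<in> G \<Longrightarrow> (\<lambda>x. s x + of_real c * g x) \<in> real_span G"

lemma real_span_base: "g \<in> G \<Longrightarrow> g \<in> real_span G"
  using real_span.step[OF real_span.zero, of g G 1] by simp

lemma real_subspace_real_span:
  assumes "\<And>g. g \<in> G \<Longrightarrow> integrable lborel g"
  shows "real_subspace (real_span G)"
proof
  show "(\<lambda>x. 0) \<in> real_span G" by (rule real_span.zero)
  show "(\<lambda>x. f x + g x) \<in> real_span G" if "f \<in> real_span G" "g \<in> real_span G" for f g
    using that(2)
  proof induction
    case (step s g c)
    from real_span.step[OF step.IH step.hyps(2), of c] show ?case by (simp add: add.assoc)
  qed (simp add: that)
  show "(\<lambda>x. of_real c * f x) \<in> real_span G" if "f \<in> real_span G" for f c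
    using that
  proof induction
    case (step s g d)
    from real_span.step[OF step.IH step.hyps(2), of "c * d"] show ?case by (simp add: algebra_simps)
  qed (simp add: real_span.zero)
  show "integrable lborel f" if "f \<in> real_span G" for f
    using that by induction (use assms in auto)
qed

text \<open>Links the definitions, stated for Lebesgue measure, with the Borel setting of the proof:
  real and imaginary parts are changed on null sets, which affects neither transform nor
  norm.\<close>

lemma L1_borel_representative:
  assumes "f \<in> L1"
  obtains f' where "integrable lborel f'" "AE x in lebesgue. f x = f' x"
    "\<And>\<zeta>. fourier f \<zeta> = ft f' \<zeta>" "L1_norm f = nrm f'"
proof -
  have f: "integrable lebesgue f" using assms by (simp add: L1_def)
  then have [measurable]: "f \<in> borel_measurable lebesgue" by (rule borel_measurable_integrable)
  obtain u where u: "u \<in> borel_measurable lborel" "AE x in lborel. Re (f x) = u x"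
    using completion_ex_borel_measurable_real[of "\<lambda>x. Re (f x)" lborel] by auto
  obtain v where v: "v \<in> borel_measurable lborel" "AE x in lborel. Im (f x) = v x"
    using completion_ex_borel_measurable_real[of "\<lambda>x. Im (f x)" lborel] by auto
  have [measurable]: "u \<in> borel_measurable borel" "v \<in> borel_measurable borel" using u v by auto
  define f' where "f' x = Complex (u x) (v x)" for x
  have f'm [measurable]: "f' \<in> borel_measurable borel"
    unfolding f'_def[abs_def] Complex_eq by measurable
  have f'm2 [measurable]: "f' \<in> borel_measurable lebesgue"
    by (rule measurable_completion) simp
  have "AE x in lborel. f x = f' x"
    using u(2) v(2) by eventually_elim (simp add: f'_def complex_eq_iff)
  then have ae: "AE x in lebesgue. f x = f' x" by (rule AE_completion)
  have "integrable lebesgue f'"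
    using f ae by (subst integrable_cong_AE[symmetric, of f]) auto
  then have i: "integrable lborel f'"
    using integrable_completion[of f' lborel] by simp
  have F: "fourier f \<zeta> = ft f' \<zeta>" for \<zeta>
  proof -
    have m: "(\<lambda>x. exp (\<i> * of_real x * of_real \<zeta>)) \<in> borel_measurable lebesgue"
      by (rule measurable_completion) simp
    have "fourier f \<zeta> = (LINT x|lebesgue. f' x * exp (\<i> * of_real x * of_real \<zeta>))"
      unfolding fourier_def using ae m by (intro integral_cong_AE borel_measurable_times) auto
    also have "\<dots> = ft f' \<zeta>"
      unfolding ft_def by (intro integral_completion) simp
    finally show ?thesis .
  qed
  have "L1_norm f = (LINT x|lebesgue. norm (f' x))"
    unfolding L1_norm_def using ae by (intro integral_cong_AE) auto
  also have "\<dots> = nrm f'"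
    unfolding nrm_def by (intro integral_completion) simp
  finally show ?thesis using that[OF i ae F] by blast
qed

lemma borel_L1:
  assumes "integrable lborel f"
  shows "f \<in> L1" "fourier f \<zeta> = ft f \<zeta>" "L1_norm f = nrm f"
proof -
  have [measurable]: "f \<in> borel_measurable borel" using borel_measurable_integrable[OF assms] by simp
  show "f \<in> L1" using assms by (simp add: L1_def integrable_completion)
  show "fourier f \<zeta> = ft f \<zeta>" unfolding fourier_def ft_def by (intro integral_completion) simp
  show "L1_norm f = nrm f" unfolding L1_norm_def nrm_def by (intro integral_completion) simp
qed

lemma L1_add: "f \<in> L1 \<Longrightarrow> g \<in> L1 \<Longrightarrow> (\<lambda>x. f x + g x) \<in> L1"
  and L1_scale: "f \<in> L1 \<Longrightarrow> (\<lambda>x. c * f x) \<in> L1"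
  by (auto simp: L1_def)

lemma fourier_integrable:
  assumes "f \<in> L1"
  shows "integrable lebesgue (\<lambda>x. f x * exp (\<i> * of_real x * of_real \<zeta>))"
proof (rule Bochner_Integration.integrable_bound)
  show "integrable lebesgue f" using assms by (simp add: L1_def)
  moreover have "(\<lambda>x. exp (\<i> * of_real x * of_real \<zeta>)) \<in> borel_measurable lebesgue"
    by (rule measurable_completion) simp
  ultimately show "(\<lambda>x. f x * exp (\<i> * of_real x * of_real \<zeta>)) \<in> borel_measurable lebesgue"
    by (intro borel_measurable_times) auto
qed (auto simp: norm_mult)

lemma fourier_add: "f \<in> L1 \<Longrightarrow> g \<in> L1 \<Longrightarrow> fourier (\<lambda>x. f x + g x) \<zeta> = fourier f \<zeta> + fourier g \<zeta>"
  unfolding fourier_def distrib_right by (intro Bochner_Integration.integral_add fourier_integrable)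

lemma fourier_scale: "fourier (\<lambda>x. c * f x) \<zeta> = c * fourier f \<zeta>"
  by (simp add: fourier_def mult.assoc)

lemma is_Hilbert_transform_add:
  assumes "f \<in> L1" "g \<in> L1" "is_Hilbert_transform f k" "is_Hilbert_transform g l"
  shows "is_Hilbert_transform (\<lambda>x. f x + g x) (\<lambda>x. k x + l x)"
  using assms by (auto simp: is_Hilbert_transform_def fourier_add L1_add distrib_left)

lemma is_Hilbert_transform_scale:
  assumes "is_Hilbert_transform f k"
  shows "is_Hilbert_transform (\<lambda>x. c * f x) (\<lambda>x. c * k x)"
  using assms by (auto simp: is_Hilbert_transform_def fourier_scale L1_scale)

lemma L1_diff: "f \<in> L1 \<Longrightarrow> g \<in> L1 \<Longrightarrow> (\<lambda>x. f x - g x) \<in> L1"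
  by (auto simp: L1_def)

lemma is_Hilbert_transform_diff:
  assumes "f \<in> L1" "g \<in> L1" "is_Hilbert_transform f k" "is_Hilbert_transform g l"
  shows "is_Hilbert_transform (\<lambda>x. f x - g x) (\<lambda>x. k x - l x)"
  using is_Hilbert_transform_add[OF assms(1) L1_scale[OF assms(2), of "-1"] assms(3)
    is_Hilbert_transform_scale[OF assms(4), of "-1"]] by simp

lemma subspace_H1: "cfun.subspace H1"
proof (rule cfun.subspaceI)
  have "is_Hilbert_transform (\<lambda>x. 0) (\<lambda>x. 0)"
    by (simp add: is_Hilbert_transform_def L1_def fourier_def)
  then show "0 \<in> H1" by (auto simp: H1_def L1_def zero_fun_def)
  show "f + g \<in> H1" if "f \<in> H1" "g \<in> H1" for f g
    using that is_Hilbert_transform_add unfolding H1_def plus_fun_def by (blast intro: L1_add)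
  show "(\<lambda>x. c * f x) \<in> H1" if "f \<in> H1" for f c
    using that is_Hilbert_transform_scale unfolding H1_def by (blast intro: L1_scale)
qed

text \<open>Two Hilbert transforms of \<open>f\<close> have the same Fourier transform off 0, so
  their difference has norm 0. Thus any explicit one computes the norm, and the choice operator
  disappears.\<close>

lemma H1_norm_eq:
  assumes f: "f \<in> L1" and g: "is_Hilbert_transform f g"
  shows "H1_norm f = L1_norm f + L1_norm g"
proof -
  define k where "k = Hilbert_transform f"
  have k: "is_Hilbert_transform f k"
    unfolding k_def Hilbert_transform_def using someI[of "is_Hilbert_transform f" g] g by simp
  obtain g' where g': "integrable lborel g'" "\<And>\<zeta>. fourier g \<zeta> = ft g' \<zeta>" "L1_norm g = nrm g'"
    using g L1_borel_representative[of g] by (metis is_Hilbert_transform_def)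
  obtain k' where k': "integrable lborel k'" "\<And>\<zeta>. fourier k \<zeta> = ft k' \<zeta>" "L1_norm k = nrm k'"
    using k L1_borel_representative[of k] by (metis is_Hilbert_transform_def)
  have "ft (\<lambda>x. g' x - k' x) \<zeta> = 0" if "\<zeta> \<noteq> 0" for \<zeta>
    using g k that by (simp add: ft_diff g'(1) k'(1) is_Hilbert_transform_def flip: g'(2) k'(2))
  then have z: "nrm (\<lambda>x. g' x - k' x) = 0"
    using g'(1) k'(1) by (intro nrm_eq_0_of_ft) auto
  have "nrm g' \<le> nrm k'"
    using nrm_add_le[of k' "\<lambda>x. g' x - k' x"] g'(1) k'(1) z by simp
  moreover have "nrm k' \<le> nrm g'"
    using nrm_diff_le[of g' "\<lambda>x. g' x - k' x"] g'(1) k'(1) z by simp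
  ultimately show ?thesis
    by (simp add: H1_norm_def g'(3) k'(3) flip: k_def)
qed

text \<open>The multiplier is \<open>\<i>\<close> on the negative frequencies, where
  \<open>U\<close> lives, and \<open>- \<i>\<close> on the positive ones, where \<open>cnj U\<close>
  lives. So \<open>U + cnj U\<close> goes to \<open>\<i> * (U - cnj U)\<close>.\<close>

lemma hardy_is_Hilbert_transform:
  assumes U: "hardy U"
  shows "is_Hilbert_transform (\<lambda>x. of_real (2 * Re (U x))) (\<lambda>x. of_real (- 2 * Im (U x)))"
proof -
  note iU = hardy_integrable[OF U]
  then have iC: "integrable lborel (\<lambda>x. cnj (U x))" by simp
  have re: "(\<lambda>x. complex_of_real (2 * Re (U x))) = (\<lambda>x. U x + cnj (U x))"
    by (auto simp: complex_eq_iff)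
  have im: "(\<lambda>x. complex_of_real (- 2 * Im (U x))) = (\<lambda>x. \<i> * (U x - cnj (U x)))"
    by (auto simp: complex_eq_iff)
  have "ft (\<lambda>x. \<i> * (U x - cnj (U x))) \<zeta> = - \<i> * of_real (\<zeta> / \<bar>\<zeta>\<bar>) * ft (\<lambda>x. U x + cnj (U x)) \<zeta>"
    if "\<zeta> \<noteq> 0" for \<zeta>
  proof (cases "\<zeta> > 0")
    case True
    then show ?thesis
      using hardy_ft[OF U True] by (simp add: ft_scale ft_diff[OF iU iC] ft_add[OF iU iC] ft_cnj)
  next
    case False
    then have "ft U (- \<zeta>) = 0" using hardy_ft[OF U, of "- \<zeta>"] that by simp
    with False that show ?thesis
      by (simp add: ft_scale ft_diff[OF iU iC] ft_add[OF iU iC] ft_cnj)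
  qed
  moreover have "integrable lborel (\<lambda>x. U x + cnj (U x))" "integrable lborel (\<lambda>x. \<i> * (U x - cnj (U x)))"
    using iU iC by auto
  ultimately show ?thesis
    unfolding re im is_Hilbert_transform_def by (simp add: borel_L1)
qed

lemma hardy_real_part_H1: "hardy U \<Longrightarrow> (\<lambda>x. of_real (2 * Re (U x))) \<in> H1"
  using hardy_is_Hilbert_transform[of U] borel_L1(1)[of "\<lambda>x. of_real (2 * Re (U x))"] hardy_integrable[of U]
  by (auto simp: H1_def)

text \<open>For \<open>k\<close> the Hilbert transform of \<open>f\<close> this is the projection
  onto negative frequencies: at \<open>\<zeta> > 0\<close> the two terms cancel.\<close>

lemma hardy_half:
  assumes "integrable lborel f" "integrable lborel k" "\<And>\<zeta>. \<zeta> > 0 \<Longrightarrow> ft k \<zeta> = - \<i> * ft f \<zeta>"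
  shows "hardy (\<lambda>x. (1/2) * (f x - \<i> * k x))"
proof -
  have i: "integrable lborel (\<lambda>x. \<i> * k x)" using assms by auto
  show ?thesis
    unfolding hardy_def ft_scale using assms by (auto simp: ft_diff[OF assms(1) i] ft_scale)
qed

lemma hardy_res:
  assumes "\<bar>\<kappa>\<bar> = 1" "bd F C" "e > 0" "hardy F"
  shows "hardy (twisted_shift.res \<kappa> L e F)"
proof -
  interpret twisted_shift \<kappa> L by unfold_locales (fact assms)
  show ?thesis
    unfolding res_def[abs_def]
  proof (rule hardy_suminf[OF bd_res_term[OF assms(2,3)] sums_summable[OF res_const_sums[OF assms(2,3)]]])
    show "hardy (\<lambda>x. of_real ((1 / (1 + e)) ^ Suc n * \<kappa> ^ n) * F (x - of_nat n * L))" for n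
      using hardy_scale[OF hardy_translate[OF assms(4)]] by (simp only: translate_def)
  qed
qed

lemma hardy_flat:
  assumes "\<bar>\<kappa>\<bar> = 1" "bd F C" "hardy F"
  shows "hardy (twisted_shift.flat \<kappa> L m l F)"
proof -
  interpret twisted_shift \<kappa> L by unfold_locales (fact assms)
  show ?thesis
    unfolding flat_def[abs_def]
    by (rule hardy_suminf[OF bd_flat_term[OF assms(2)] sums_summable[OF bd_flat_sums]])
      (auto intro!: hardy_scale hardy_res[OF assms(1,2) _ assms(3)])
qed

text \<open>This is where real coefficients are indispensable: taking \<open>2 * Re\<close> commutes
  with them, but not with complex ones.\<close>

lemma real_part_in_cspan:
  assumes "s \<in> real_span G"
  shows "(\<lambda>x. of_real (2 * Re (s x))) \<in> cspan ((\<lambda>g x. of_real (2 * Re (g x))) ` G)"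
  using assms
proof induction
  case zero
  show ?case using cfun.span_zero by (simp add: zero_fun_def)
next
  case (step s g c)
  have "(\<lambda>x. complex_of_real (2 * Re (g x))) \<in> cspan ((\<lambda>g x. of_real (2 * Re (g x))) ` G)"
    using cfun.span_base[OF imageI[OF step.hyps(2), of "\<lambda>g x. complex_of_real (2 * Re (g x))"]] .
  note cg = cfun.span_scale[OF this, of "of_real c"]
  have eq: "(\<lambda>x. complex_of_real (2 * Re (s x + of_real c * g x))) =
      (\<lambda>x. complex_of_real (2 * Re (s x))) + (\<lambda>x. of_real c * complex_of_real (2 * Re (g x)))"
    by (rule ext) (simp add: plus_fun_apply distrib_left)
  show ?case
    unfolding eq by (rule cfun.span_add[OF step.IH cg])
qed

text \<open>Real and imaginary part of \<open>f\<close> are approximated separately by real parts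
  from the real span and recombined with the scalar \<open>\<i>\<close>, which the complex span
  permits. The imaginary parts of the same approximants take care of the Hilbert transform.\<close>

lemma dense_in_H1_of_hardy:
  fixes G :: "(real \<Rightarrow> complex) set"
  assumes G: "\<And>g. g \<in> G \<Longrightarrow> hardy g"
    and dst: "\<And>U e. hardy U \<Longrightarrow> e > 0 \<Longrightarrow> \<exists>s\<in>real_span G. nrm (\<lambda>x. U x - s x) < e"
  shows "dense_in_H1 (cspan ((\<lambda>g x. of_real (2 * Re (g x))) ` G))" (is "dense_in_H1 ?C")
  unfolding dense_in_H1_def
proof (intro conjI ballI allI impI)
  show "?C \<subseteq> H1"
    by (rule cfun.span_minimal[OF _ subspace_H1]) (use hardy_real_part_H1[OF G] in blast)
next
  fix f and e :: real assume f: "f \<in> H1" and e: "e > 0"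
  then obtain k where k: "is_Hilbert_transform f k" and fL: "f \<in> L1" by (auto simp: H1_def)
  then have kL: "k \<in> L1" by (simp add: is_Hilbert_transform_def)
  obtain f' where f': "integrable lborel f'" "AE x in lebesgue. f x = f' x" "\<And>\<zeta>. fourier f \<zeta> = ft f' \<zeta>"
    using L1_borel_representative[OF fL] by metis
  obtain k' where k': "integrable lborel k'" "AE x in lebesgue. k x = k' x" "\<And>\<zeta>. fourier k \<zeta> = ft k' \<zeta>"
    using L1_borel_representative[OF kL] by metis
  have fk: "ft k' \<zeta> = - \<i> * of_real (\<zeta> / \<bar>\<zeta>\<bar>) * ft f' \<zeta>" if "\<zeta> \<noteq> 0" for \<zeta>
    using k that unfolding is_Hilbert_transform_def f'(3) k'(3) by blast
  have iC: "integrable lborel (\<lambda>x. cnj (f' x))" "integrable lborel (\<lambda>x. cnj (k' x))"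
    using f'(1) k'(1) by simp_all
  have re: "complex_of_real (Re z) = (1/2) * (z + cnj z)" for z by (simp add: complex_eq_iff)
  have im: "complex_of_real (Im z) = (- \<i> / 2) * (z - cnj z)" for z by (simp add: complex_eq_iff)
  \<comment> \<open>The real part of \<open>k'\<close> is the Hilbert transform of the real part of
    \<open>f'\<close>, so \<open>2 * Re (U x)\<close> is the real part of \<open>f'\<close> and
    \<open>- 2 * Im (U x)\<close> that of \<open>k'\<close>; \<open>V\<close> does the same for the
    imaginary parts.\<close>
  define U where "U x = (1/2) * (complex_of_real (Re (f' x)) - \<i> * complex_of_real (Re (k' x)))" for x
  define V where "V x = (1/2) * (complex_of_real (Im (f' x)) - \<i> * complex_of_real (Im (k' x)))" for x
  have U: "hardy U"
    unfolding U_def[abs_def] 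
  proof (rule hardy_half)
    show "ft (\<lambda>x. complex_of_real (Re (k' x))) \<zeta> = - \<i> * ft (\<lambda>x. complex_of_real (Re (f' x))) \<zeta>" if "\<zeta> > 0" for \<zeta>
      using fk[of \<zeta>] fk[of "- \<zeta>"] that
      unfolding re ft_scale ft_add[OF f'(1) iC(1)] ft_add[OF k'(1) iC(2)] ft_cnj
      by (simp add: field_simps)
  qed (use f'(1) k'(1) in auto)
  have V: "hardy V"
    unfolding V_def[abs_def]
  proof (rule hardy_half)
    show "ft (\<lambda>x. complex_of_real (Im (k' x))) \<zeta> = - \<i> * ft (\<lambda>x. complex_of_real (Im (f' x))) \<zeta>" if "\<zeta> > 0" for \<zeta>
      using fk[of \<zeta>] fk[of "- \<zeta>"] that
      unfolding im ft_scale ft_diff[OF f'(1) iC(1)] ft_diff[OF k'(1) iC(2)] ft_cnj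
      by (simp add: field_simps)
  qed (use f'(1) k'(1) in auto)
  \<comment> \<open>Each of the two L1-norms is at most twice the sum of both errors, hence below
    \<open>e / 2\<close>.\<close>
  obtain s where s: "s \<in> real_span G" "nrm (\<lambda>x. U x - s x) < e / 8"
    using dst[OF U, of "e/8"] e by auto
  obtain t where t: "t \<in> real_span G" "nrm (\<lambda>x. V x - t x) < e / 8"
    using dst[OF V, of "e/8"] e by auto
  have hs: "hardy w" if "w \<in> real_span G" for w
    using that
  proof induction
    case zero
    show ?case by (simp add: hardy_def ft_def)
  next
    case (step s g c)
    show ?case by (rule hardy_add[OF step.IH hardy_scale[OF G[OF step.hyps(2)]]])
  qed
  let ?p = "\<lambda>x. U x - s x" and ?q = "\<lambda>x. V x - t x"
  have p: "integrable lborel ?p" and q: "integrable lborel ?q"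
    using hardy_integrable[OF U] hardy_integrable[OF V] hardy_integrable[OF hs[OF s(1)]] hardy_integrable[OF hs[OF t(1)]]
    by auto
  let ?h = "\<lambda>x. complex_of_real (2 * Re (s x)) + \<i> * complex_of_real (2 * Re (t x))"
  let ?l = "\<lambda>x. complex_of_real (- 2 * Im (s x)) + \<i> * complex_of_real (- 2 * Im (t x))"
  have hC: "?h \<in> ?C"
    using cfun.span_add[OF real_part_in_cspan[OF s(1)] cfun.span_scale[OF real_part_in_cspan[OF t(1)], of "\<i>"]]
    unfolding plus_fun_def .
  have L1s: "(\<lambda>x. complex_of_real (2 * Re (w x))) \<in> L1" if "w \<in> real_span G" for w
    using hardy_real_part_H1[OF hs[OF that]] by (simp add: H1_def)
  have hl: "is_Hilbert_transform ?h ?l"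
    by (intro is_Hilbert_transform_add is_Hilbert_transform_scale hardy_is_Hilbert_transform hs s t L1s L1_scale)
  have hL: "?h \<in> L1" by (intro L1_add L1_scale L1s s t)
  have H: "is_Hilbert_transform (\<lambda>x. f x - ?h x) (\<lambda>x. k x - ?l x)"
    by (rule is_Hilbert_transform_diff[OF fL hL k hl])
  have fhL: "(\<lambda>x. f x - ?h x) \<in> L1"
    by (rule L1_diff[OF fL hL])
  have bound: "L1_norm F < e / 2"
    if F: "F \<in> L1" and le: "AE x in lebesgue. norm (F x) \<le> 2 * norm (?p x) + 2 * norm (?q x)" for F
  proof -
    have i: "integrable lborel (\<lambda>x. 2 * norm (?p x) + 2 * norm (?q x))" using p q by auto
    then have i': "integrable lebesgue (\<lambda>x. 2 * norm (?p x) + 2 * norm (?q x))"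
      using integrable_completion[of "\<lambda>x. 2 * norm (?p x) + 2 * norm (?q x)" lborel]
        borel_measurable_integrable by blast
    have "L1_norm F \<le> (LINT x|lebesgue. 2 * norm (?p x) + 2 * norm (?q x))"
      unfolding L1_norm_def using F i' le by (intro integral_mono_AE) (auto simp: L1_def)
    also have "\<dots> = (LINT x|lborel. 2 * norm (?p x) + 2 * norm (?q x))"
      using borel_measurable_integrable[OF i] by (rule integral_completion)
    also have "\<dots> = 2 * nrm ?p + 2 * nrm ?q"
      using p q by (simp add: nrm_def)
    also have "\<dots> < e / 2" using s(2) t(2) by simp
    finally show ?thesis .
  qed
  have tri: "norm (complex_of_real a + \<i> * complex_of_real b) \<le> \<bar>a\<bar> + \<bar>b\<bar>" for a b
    using norm_triangle_ineq[of "complex_of_real a" "\<i> * complex_of_real b"] by (simp add: norm_mult)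
  have "L1_norm (\<lambda>x. f x - ?h x) < e / 2"
  proof (rule bound[OF fhL], use f'(2) in eventually_elim)
    case (elim x)
    have "f x - ?h x = complex_of_real (2 * Re (?p x)) + \<i> * complex_of_real (2 * Re (?q x))"
      unfolding elim U_def V_def by (simp add: complex_eq_iff)
    then show ?case
      using tri[of "2 * Re (?p x)" "2 * Re (?q x)"] abs_Re_le_cmod[of "?p x"] abs_Re_le_cmod[of "?q x"]
      by (simp only: abs_mult)
  qed
  moreover have "L1_norm (\<lambda>x. k x - ?l x) < e / 2"
  proof (rule bound, use H in \<open>simp add: is_Hilbert_transform_def\<close>, use k'(2) in eventually_elim)
    case (elim x)
    have "k x - ?l x = complex_of_real (- 2 * Im (?p x)) + \<i> * complex_of_real (- 2 * Im (?q x))"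
      unfolding elim U_def V_def by (simp add: complex_eq_iff)
    then show ?case
      using tri[of "- 2 * Im (?p x)" "- 2 * Im (?q x)"] abs_Im_le_cmod[of "?p x"] abs_Im_le_cmod[of "?q x"]
      by (simp only: abs_mult)
  qed
  ultimately have "H1_norm (\<lambda>x. f x - ?h x) < e"
    using H1_norm_eq[OF fhL H] by simp
  then show "\<exists>h\<in>?C. H1_norm (\<lambda>x. f x - h x) < e" by (rule bexI[OF _ hC])
qed

theorem theorem1p2:
  fixes r :: "int \<Rightarrow> real" and \<gamma> :: real and \<Lambda> :: "real set"
  assumes "0 < \<gamma>" and "\<gamma> < 1"
    and "\<And>n. 0 < \<bar>r n\<bar> \<and> \<bar>r n\<bar> \<le> \<gamma> ^ nat \<bar>n\<bar>"
    and "\<Lambda> = {of_int n + r n | n. True}"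
  shows "\<exists>f\<^sub>1\<in>H1. \<exists>f\<^sub>2\<in>H1.
    dense_in_H1 (cspan ({translate \<mu> f\<^sub>1 | \<mu>. \<mu> \<in> \<Lambda>} \<union> {translate \<nu> f\<^sub>2 | \<nu>. \<nu> \<in> \<Lambda>}))"
proof -
  \<comment> \<open>With \<open>\<gamma> ^ N < 1/8\<close> the required inequality follows from
    \<open>4 / 8 < (7/8)\<^sup>2\<close>.\<close>
  obtain N where N: "\<gamma> ^ N < 1/8"
    using real_arch_pow_inv[of "1/8" \<gamma>] assms(2) by auto
  have "(7/8)\<^sup>2 \<le> (1 - \<gamma> ^ N)\<^sup>2" using N by (intro power_mono) auto
  then have N': "4 * \<gamma> ^ N < (1 - \<gamma> ^ N)\<^sup>2" using N by (simp add: power2_eq_square)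
  define F where "F \<kappa> = twisted_shift.flat \<kappa> (real N) 0 0 (cauchy_ker 1 0)" for \<kappa> :: real
  define G where "G = {translate \<mu> (F 1) | \<mu>. \<mu> \<in> \<Lambda>} \<union> {translate \<nu> (F (-1)) | \<nu>. \<nu> \<in> \<Lambda>}"
  have b0: "bd (cauchy_ker 1 0) (ker_bound 1)" by (rule bd_cauchy_ker_0) simp
  have F: "hardy (F \<kappa>)" if "\<bar>\<kappa>\<bar> = 1" for \<kappa>
    unfolding F_def by (rule hardy_flat[OF that b0 hardy_cauchy_ker])
  have G: "hardy g" if "g \<in> G" for g
    using that F[of 1] F[of "-1"] by (auto simp: G_def intro: hardy_translate)
  interpret R: real_subspace "real_span G"
    by (rule real_subspace_real_span) (rule hardy_integrable[OF G])
  have gen: "R.dst (translate (of_int n + r n) (F \<kappa>)) = 0" if "\<kappa> = 1 \<or> \<kappa> = -1" for n \<kappa>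
    using that by (intro R.dst_mem real_span_base) (auto simp: G_def assms(4))
  interpret P: perturbed_span "real_span G" 1 N r \<gamma>
    using gen[of 1] assms N' by unfold_locales (auto simp: F_def)
  interpret M: perturbed_span "real_span G" "-1" N r \<gamma>
    using gen[of "-1"] assms N' by unfold_locales (auto simp: F_def)
  have "R.dst (cauchy_ker 1 j) = 0" for j
  proof -
    let ?W = "cauchy_ker 1 j"
    have W: "bd ?W (ker_bound 1)" using bd_cauchy_ker[of 1 j] by simp
    have "R.dst (P.tdiff ?W) = 0" "R.dst (M.tdiff ?W) = 0"
      using P.null_orbit_tdiff_ker[of j] M.null_orbit_tdiff_ker[of j]
      unfolding R.null_orbit_def by (metis of_int_0 translate_0)+
    then have "R.dst (\<lambda>x. P.tdiff ?W x + M.tdiff ?W x) \<le> 0"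
      using R.dst_add_le[OF bd_integrable[OF P.bd_tdiff[OF W]] bd_integrable[OF M.bd_tdiff[OF W]]] by simp
    \<comment> \<open>For \<open>\<kappa> = 1\<close> and \<open>\<kappa> = -1\<close> the operators
      are \<open>1 - \<tau>\<close> and \<open>1 + \<tau>\<close>; their sum is 2.\<close>
    moreover have "?W = (\<lambda>x. of_real (1/2) * (P.tdiff ?W x + M.tdiff ?W x))"
      by (simp add: P.tdiff_def M.tdiff_def)
    ultimately show ?thesis
      using R.dst_scale_le[of "1/2" "\<lambda>x. P.tdiff ?W x + M.tdiff ?W x"] R.dst_nonneg[of ?W] by simp
  qed
  then have dst: "\<exists>s\<in>real_span G. nrm (\<lambda>x. U x - s x) < e" if "hardy U" "e > 0" for U e
    using R.dst_lessD[of U e] R.dst_hardy[of U] that by simp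
  define f where "f \<kappa> x = complex_of_real (2 * Re (F \<kappa> x))" for \<kappa> x
  have "(\<lambda>g x. of_real (2 * Re (g x))) ` G =
      {translate \<mu> (f 1) | \<mu>. \<mu> \<in> \<Lambda>} \<union> {translate \<nu> (f (-1)) | \<nu>. \<nu> \<in> \<Lambda>}"
    unfolding G_def f_def translate_def by (auto simp: image_iff) 
  with dense_in_H1_of_hardy[OF G dst]
  have "dense_in_H1 (cspan ({translate \<mu> (f 1) | \<mu>. \<mu> \<in> \<Lambda>} \<union> {translate \<nu> (f (-1)) | \<nu>. \<nu> \<in> \<Lambda>}))"
    by simp
  moreover have "f 1 \<in> H1" "f (-1) \<in> H1"
    using hardy_real_part_H1[OF F] by (simp_all add: f_def[abs_def])
  ultimately show ?thesis by blast
qed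

end
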